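(* Let $\mathfrak{T}\in\mathrm{Diff}^+$, let $\delta>0$, and let $\tau>0$ satisfy $1+\tau\lambda>0$. Assume that $\mathfrak{t}^1,\mathfrak{t}^2\in\nabla\mathfrak{X}_\delta^+$ satisfy, for $j=1,2$, the estimates $$\Big|\Big\langle\frac{\mathfrak{t}^j-\mathrm{id}}{\tau}-\mathbf{v}(\mathfrak{t}^j;\mathfrak{T}),\nabla\psi\Big\rangle_{L^2(\mathfrak{T}_\#\bar u)}\Big|\le\rho_j\,\|\nabla\psi\|_{L^2(\mathfrak{T}_\#\bar u)}$$ for all $\psi\in\mathrm{T}\mathfrak{X}_\delta$, with constants $\rho_1,\rho_2\ge0$. Then $$\|\mathfrak{t}^1-\mathfrak{t}^2\|_{L^2(\mathfrak{T}_\#\bar u)}\le\frac{\tau}{1+\tau\lambda}(\rho_1+\rho_2).$$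
   Context: $\Omega=(0,1)^d$. The pressure $\mathrm{P}:\mathbb{R}_{\ge0}\to\mathbb{R}$ is continuous, smooth on $\mathbb{R}_{>0}$ and strictly increasing; $h:\mathbb{R}_{\ge0}\to\mathbb{R}$ is defined (up to an affine normalization) by $\mathrm{P}'(r)=r\,h''(r)$ for $r>0$. A function $f:\Omega\to\mathbb{R}$ is symmetric-periodic if it has a continuous extension to $\mathbb{R}^d$ that is even and $2$-periodic in each coordinate; it is $C^k$-symmetric-periodic if the extension is $C^k$. The potential $V$ is $C^\infty$-symmetric-periodic, with modulus of convexity $\lambda\in\mathbb{R}$: $\nabla^2V\ge\lambda\mathbf 1$. $\bar u:\Omega\to(0,\infty)$ is a fixed reference density of total mass $M$. $\mathrm{Diff}^+$ is the class of orientation-preserving $C^1$-diffeomorphisms of $\overline\Omega$ onto itself that fix the corners. Push-forward: $\mathfrak{T}_\#\bar u=\frac{\bar u}{\det \mathrm{D}\mathfrak{T}}\circ\mathfrak{T}^{-1}$. Velocity: $\mathbf{v}[u]=-\nabla[h'(u)+V]$ for a density $u$, and $\mathbf{v}(\mathfrak{t};\mathfrak{T}):=\mathbf{v}\big[(\mathfrak{t}\circ\mathfrak{T})_\#\bar u\big]\circ\mathfrak{t}$. Ansatz spaces: let $\mathcal I=\mathbb{N}_0^d\setminus\{0\}$, $\mathfrak{b}_{\mathbf k}(x)=\frac{2^{d/2}}{\pi|\mathbf k|_2}\cos(k_1\pi x_1)\cdots\cos(k_d\pi x_d)$ for $\mathbf k\in\mathcal I$, and $\mathcal I_\delta=\{\mathbf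 k\in\mathcal I:|\mathbf k|_\infty\le K\}$ with $K\in\mathbb{N}$ such that $K\delta\in[1,2)$. With $\mathfrak{q}(x)=\frac12|x|^2$, put $\mathrm{T}\mathfrak{X}_\delta=\operatorname{span}\{\mathfrak{b}_{\mathbf k}\}_{\mathbf k\in\mathcal I_\delta}$, $\mathfrak{X}=\{\phi:\overline\Omega\to\mathbb{R};\ \phi\text{ convex},\ \nabla\phi(\Omega)\subseteq\Omega\}$, $\mathfrak{X}_\delta=\{\mathfrak{q}+\psi;\ \psi\in\mathrm{T}\mathfrak{X}_\delta\}\cap\mathfrak{X}$, $\mathfrak{X}_\delta^+=\{\phi\in\mathfrak{X}_\delta;\ \inf_\Omega\det\nabla^2\phi>0\}$, $\nabla\mathfrak{X}_\delta^+=\{\nabla\phi;\phi\in\mathfrak{X}_\delta^+\}$.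
   Formalization: Added: McCann's condition that (P(r)-P(0))/r^(1-1/d) is nondecreasing for r>0 (the claim is false without it if d>=2), and that the densities (t^j∘T)_#ū are differentiable on Ω with velocities v(t^j;T) in L²(T_#ū), so that the inner products make sense. *)

theory Defs
  imports "HOL-Analysis.Analysis"
begin

definition Omega :: "(real^'n) set" where
  "Omega = box 0 1"

definition Omega_bar :: "(real^'n) set" where
  "Omega_bar = cbox 0 1"


subsection \<open>Differential calculus on real^'n\<close>

definition grad :: "(real^'n \<Rightarrow> real) \<Rightarrow> real^'n \<Rightarrow> real^'n" where
  "grad f x = (THE D. GDERIV f x :> D)"

definition hessian :: "(real^'n \<Rightarrow> real) \<Rightarrow> real^'n \<Rightarrow> real^'n^'n" where
  "hessian f x = jacobian (grad f) (at x)"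

primrec Ck :: "nat \<Rightarrow> (real^'n \<Rightarrow> real) \<Rightarrow> bool" where
  "Ck 0 f \<longleftrightarrow> continuous_on UNIV f"
| "Ck (Suc k) f \<longleftrightarrow> (\<forall>x. f differentiable (at x)) \<and> (\<forall>i. Ck k (\<lambda>x. grad f x $ i))"

text \<open>C-infinity symmetric-periodic functions on Omega; the values of f outside Omega are
  irrelevant, \<open>F\<close> is the extension.\<close>

definition smooth_symmetric_periodic :: "(real^'n \<Rightarrow> real) \<Rightarrow> bool" where
  "smooth_symmetric_periodic f \<longleftrightarrow> (\<exists>F.
     (\<forall>x\<in>Omega. F x = f x) \<and> (\<forall>k. Ck k F) \<and>
     (\<forall>x i. F (\<chi> j. if j = i then - (x $ j) else x $ j) = F x) \<and>
     (\<forall>x i. F (x + 2 *\<^sub>R axis i 1) = F x))"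

definition C1_on :: "'a::real_normed_vector set \<Rightarrow> ('a \<Rightarrow> 'b::real_normed_vector) \<Rightarrow> bool" where
  "C1_on S f \<longleftrightarrow> (\<exists>f' :: 'a \<Rightarrow> 'a \<Rightarrow>\<^sub>L 'b. continuous_on S f' \<and>
     (\<forall>x\<in>S. (f has_derivative blinfun_apply (f' x)) (at x within S)))"

definition Diff_plus :: "(real^'n \<Rightarrow> real^'n) set" where
  "Diff_plus = {T. bij_betw T Omega_bar Omega_bar \<and>
     C1_on Omega_bar T \<and> C1_on Omega_bar (inv_into Omega_bar T) \<and>
     (\<forall>x\<in>Omega. det (jacobian T (at x)) > 0) \<and>
     (\<forall>c. (\<forall>i. c $ i = 0 \<or> c $ i = 1) \<longrightarrow> T c = c)}"


subsection \<open>Densities and velocities\<close>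

text \<open>Densities are functions on Omega; their values elsewhere are never used.\<close>

definition push_forward :: "(real^'n \<Rightarrow> real^'n) \<Rightarrow> (real^'n \<Rightarrow> real) \<Rightarrow> real^'n \<Rightarrow> real" where
  "push_forward T u = (\<lambda>x. u x / det (jacobian T (at x))) \<circ> inv_into Omega T"

definition velocity ::
  "(real \<Rightarrow> real) \<Rightarrow> (real^'n \<Rightarrow> real) \<Rightarrow> (real^'n \<Rightarrow> real) \<Rightarrow> real^'n \<Rightarrow> real^'n" where
  "velocity h V u = (\<lambda>y. - grad (\<lambda>z. deriv h (u z) + V z) y)"

definition velocity_at ::
  "(real \<Rightarrow> real) \<Rightarrow> (real^'n \<Rightarrow> real) \<Rightarrow> (real^'n \<Rightarrow> real) \<Rightarrow>
   (real^'n \<Rightarrow> real^'n) \<Rightarrow> (real^'n \<Rightarrow> real^'n) \<Rightarrow> real^'n \<Rightarrow> real^'n" where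
  "velocity_at h V ubar t T = velocity h V (push_forward (t \<circ> T) ubar) \<circ> t"

definition L2_fields :: "(real^'n \<Rightarrow> real) \<Rightarrow> (real^'n \<Rightarrow> real^'n) set" where
  "L2_fields u = {a. set_borel_measurable lborel Omega a \<and>
     set_integrable lborel Omega (\<lambda>x. (norm (a x))\<^sup>2 * u x)}"

definition L2_inner ::
  "(real^'n \<Rightarrow> real) \<Rightarrow> (real^'n \<Rightarrow> real^'n) \<Rightarrow> (real^'n \<Rightarrow> real^'n) \<Rightarrow> real" where
  "L2_inner u a b = (LINT x:Omega|lborel. (a x \<bullet> b x) * u x)"

definition L2_norm :: "(real^'n \<Rightarrow> real) \<Rightarrow> (real^'n \<Rightarrow> real^'n) \<Rightarrow> real" where
  "L2_norm u a = sqrt (L2_inner u a a)"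

text \<open>McCann's displacement convexity condition in dimension d, for the pressure
  normalised to vanish at 0 (h is only given up to an affine function, and adding a constant
  to h shifts the pressure r h' - h by a constant). For the normalisation h(0) = 0 it says that
  s^d h(s^(-d)) is convex and nonincreasing in s > 0; for d = 1 it is just monotonicity of P.
  For d > 1 the internal energy need not be convex along the transport maps without it.\<close>

definition mccann_condition :: "nat \<Rightarrow> (real \<Rightarrow> real) \<Rightarrow> bool" where
  "mccann_condition d P \<longleftrightarrow>
     mono_on {0<..} (\<lambda>r. (P r - P 0) / r powr (1 - 1 / real d))"


subsection \<open>Ansatz spaces\<close>

definition cos_basis :: "nat^'n \<Rightarrow> real^'n \<Rightarrow> real" where
  "cos_basis k x = 2 powr (real CARD('n) / 2) / (pi * norm (\<chi> i. real (k $ i)))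
     * (\<Prod>i\<in>UNIV. cos (real (k $ i) * pi * x $ i))"

definition index_set :: "nat \<Rightarrow> (nat^'n) set" where
  "index_set K = {k. k \<noteq> 0 \<and> (\<forall>i. k $ i \<le> K)}"

text \<open>Elements of the ansatz spaces are represented by their canonical extensions to real^'n.
  The mesh width delta enters only through the cut-off K.\<close>

definition TX :: "nat \<Rightarrow> (real^'n \<Rightarrow> real) set" where
  "TX K = {\<psi>. \<exists>c. \<psi> = (\<lambda>x. \<Sum>k\<in>index_set K. c k * cos_basis k x)}"

definition qfun :: "real^'n \<Rightarrow> real" where
  "qfun x = (norm x)\<^sup>2 / 2"

text \<open>A convex function is differentiable only almost everywhere, so the gradient condition
  is imposed at points of differentiability.\<close>

definition X_space :: "(real^'n \<Rightarrow> real) set" where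
  "X_space = {\<phi>. convex_on Omega_bar \<phi> \<and>
     (\<forall>x\<in>Omega. \<phi> differentiable (at x) \<longrightarrow> grad \<phi> x \<in> Omega)}"

definition X_ansatz :: "nat \<Rightarrow> (real^'n \<Rightarrow> real) set" where
  "X_ansatz K = {\<lambda>x. qfun x + \<psi> x | \<psi>. \<psi> \<in> TX K} \<inter> X_space"

definition X_plus :: "nat \<Rightarrow> (real^'n \<Rightarrow> real) set" where
  "X_plus K = {\<phi> \<in> X_ansatz K. (INF x\<in>Omega. det (hessian \<phi> x)) > 0}"

definition grad_X_plus :: "nat \<Rightarrow> (real^'n \<Rightarrow> real^'n) set" where
  "grad_X_plus K = grad ` X_plus K"

end

theory Submission
  imports Defs
begin

text \<open>
  Write \<open>u\<close> for the density of \<open>T_# ubar\<close> and \<open>w = t1 - t2\<close>, which is the gradient of an element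
  of the ansatz space and hence an admissible test field in both estimates. Subtracting them, the
  claim reduces to the monotonicity \<open>\<integral> (v1 - v2) \<bullet> w u \<le> - lam \<integral> |w|^2 u\<close>. The potential contributes
  this pointwise. For the internal energy put \<open>q_j = P(u_j) - P(0)\<close>, where \<open>u_j\<close> is the transported
  density, and \<open>p_j = q_j(t_j)\<close>. All interpolations \<open>t_r = t1 + r (t2 - t1)\<close> are diffeomorphisms of the open cube, so
  \<open>\<integral> q_j(t_r) det D t_r\<close> does not depend on \<open>r\<close>; its derivative at \<open>r = 0\<close> replaces integration by
  parts and needs neither boundary values of the densities nor the Piola identity. What remains is
  \<open>p1 (d/dr) det(A1 + r (A2 - A1)) + p2 (d/dr) det(A2 + r (A1 - A2)) \<ge> 0\<close> at \<open>r = 0\<close>, which follows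
  by diagonalizing the Hessians \<open>A1, A2\<close> simultaneously from the inequality between the arithmetic
  and the geometric mean and McCann's condition.
\<close>

subsection \<open>Simultaneous diagonalization\<close>

text \<open>The obstacle is regularity. The transported densities are only differentiable on the
  open cube, their gradients need not be continuous, and nothing is known near the boundary.
  Integrability is therefore extracted from the velocities being in L2: the relation between
  \<open>P\<close> and \<open>h\<close> turns the density-weighted internal velocity into the
  pressure gradient, which is thus integrable, and then so is the pressure. Differentiating the
  integral at \<open>r = 0\<close> is the second difficulty, since the gradient of
  \<open>q_j\<close> sampled along \<open>t_r\<close> need not depend continuously on
  \<open>r\<close>. It is done in the image variable \<open>y = t_r(x)\<close>: there
  \<open>q_j\<close> and its gradient sit at the fixed point \<open>y\<close>, only continuous
  factors move with \<open>r\<close>, and dominated convergence applies. The interpolations are onto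
  because gradients of cosines have no normal component on the faces of the cube, so each face stays
  in its hyperplane. The displacement from \<open>t1\<close> to \<open>t2\<close> tests the first
  velocity and the reverse one the second; McCann's condition acts on the sum of the two determinant
  terms.\<close>

lemma linear_coeff_zero_if_nonpos:
  fixes b c :: real
  assumes "\<And>t. b * t + c * t\<^sup>2 \<le> 0"
  shows "b = 0"
proof (rule ccontr)
  assume "b \<noteq> 0"
  \<comment> \<open>This \<open>t\<close> has the sign of \<open>b\<close> and is small enough for
    the linear term to dominate: the sum becomes
    \<open>(\<bar>c\<bar> + 1 + c) * t\<^sup>2\<close>.\<close>
  define t where "t = b / (\<bar>c\<bar> + 1)"
  have "t \<noteq> 0" "b = t * (\<bar>c\<bar> + 1)" using \<open>b \<noteq> 0\<close> by (auto simp: t_def field_simps)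
  then have "b * t + c * t\<^sup>2 = (\<bar>c\<bar> + 1 + c) * t\<^sup>2" by (simp add: algebra_simps power2_eq_square)
  also have "\<dots> > 0" using \<open>t \<noteq> 0\<close> by (intro mult_pos_pos) auto
  finally show False using assms[of t] by simp
qed

lemma inner_matrix_symmetric:
  fixes A :: "real^'n^'n"
  assumes "transpose A = A"
  shows "x \<bullet> (A *v y) = (A *v x) \<bullet> y"
  by (metis assms dot_lmul_matrix vector_transpose_matrix)

text \<open>Rayleigh quotient: \<open>v\<close> maximizes the form of \<open>B\<close> on the
  \<open>A\<close>-unit sphere of the \<open>A\<close>-orthogonal complement \<open>S\<close> of the
  eigenvectors found so far. The first order condition gives the eigenvalue equation against
  \<open>S\<close>, the symmetry of \<open>B\<close> gives it against the old eigenvectors.\<close>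

lemma generalized_eigenvector_exists:
  fixes A B :: "real^'n^'n" and e :: "'n \<Rightarrow> real^'n"
  assumes A: "transpose A = A" and B: "transpose B = B"
    and pos: "\<And>x. x \<noteq> 0 \<Longrightarrow> x \<bullet> (A *v x) > 0"
    and F: "F \<noteq> UNIV"
    and ortho: "\<And>i j. i \<in> F \<Longrightarrow> j \<in> F \<Longrightarrow> e i \<bullet> (A *v e j) = (if i = j then 1 else 0)"
    and eig: "\<And>i. i \<in> F \<Longrightarrow> B *v e i = \<beta> i *\<^sub>R (A *v e i)"
  obtains v b where "\<And>i. i \<in> F \<Longrightarrow> e i \<bullet> (A *v v) = 0" "v \<bullet> (A *v v) = 1"
    "B *v v = b *\<^sub>R (A *v v)"
proof -
  define S where "S = {x. \<forall>i\<in>F. (A *v e i) \<bullet> x = 0}"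
  define C where "C = {x \<in> S. x \<bullet> (A *v x) = 1}"
  have "subspace S" by (auto simp: S_def subspace_def inner_add_right)
  \<comment> \<open>\<open>S\<close> is cut out by fewer than \<open>CARD('n)\<close> linear
    equations, so it contains a nonzero vector.\<close>
  have "dim ((\<lambda>i. A *v e i) ` F) \<le> card ((\<lambda>i. A *v e i) ` F)" by (rule dim_le_card') simp
  also have "\<dots> \<le> card F" by (rule card_image_le) simp
  also have "\<dots> < CARD('n)" using F by (simp add: psubset_card_mono psubset_eq)
  finally obtain z where z: "z \<noteq> 0" "\<And>y. y \<in> span ((\<lambda>i. A *v e i) ` F) \<Longrightarrow> orthogonal z y"
    using orthogonal_to_subspace_exists[of "(\<lambda>i. A *v e i) ` F"] by auto
  have zS: "z \<in> S" unfolding S_def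
  proof safe
    fix i assume "i \<in> F"
    then have "A *v e i \<in> span ((\<lambda>i. A *v e i) ` F)" by (intro span_base imageI)
    from z(2)[OF this] show "(A *v e i) \<bullet> z = 0" by (simp add: orthogonal_def inner_commute)
  qed
  have contA: "continuous_on X (\<lambda>x. x \<bullet> (A *v x))" for X by (intro continuous_intros)
  have contB: "continuous_on X (\<lambda>x. x \<bullet> (B *v x))" for X by (intro continuous_intros)
  have "closed S" using \<open>subspace S\<close> by (rule closed_subspace)
  \<comment> \<open>The minimum of the form of \<open>A\<close> on the Euclidean sphere is a
    positive coercivity constant, which bounds \<open>C\<close>.\<close>
  have "compact (sphere 0 1 :: (real^'n) set)" by simp
  moreover have "sphere 0 1 \<noteq> ({} :: (real^'n) set)" by simp
  ultimately obtain m where m: "m \<in> sphere 0 1" "\<And>x. x \<in> sphere 0 1 \<Longrightarrow> m \<bullet> (A *v m) \<le> x \<bullet> (A *v x)"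
    using continuous_attains_inf[OF _ _ contA] by metis
  define \<mu> where "\<mu> = m \<bullet> (A *v m)"
  have "m \<noteq> 0" using m(1) by auto
  then have \<mu>: "\<mu> > 0" using pos unfolding \<mu>_def by blast
  have scal: "(c *\<^sub>R x) \<bullet> (A *v (c *\<^sub>R x)) = c\<^sup>2 * (x \<bullet> (A *v x))" for c x
    by (simp add: matrix_vector_mult_scaleR power2_eq_square)
  have lower: "\<mu> * (norm x)\<^sup>2 \<le> x \<bullet> (A *v x)" for x
  proof (cases "x = 0")
    case False
    then have "\<mu> \<le> ((1 / norm x) *\<^sub>R x) \<bullet> (A *v ((1 / norm x) *\<^sub>R x))"
      unfolding \<mu>_def by (intro m(2)) simp
    also have "\<dots> = (x \<bullet> (A *v x)) / (norm x)\<^sup>2" unfolding scal by (simp add: power_divide)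
    finally show ?thesis using False by (simp add: field_simps)
  qed simp
  have "bounded C"
  proof (rule boundedI)
    fix x assume "x \<in> C"
    then have "\<mu> * (norm x)\<^sup>2 \<le> 1" using lower[of x] by (simp add: C_def)
    then have "(norm x)\<^sup>2 \<le> 1 / \<mu>" using \<mu> by (simp add: field_simps)
    then show "norm x \<le> sqrt (1 / \<mu>)" by (metis real_le_rsqrt)
  qed
  moreover have "closed C"
  proof -
    have "closed {x. x \<bullet> (A *v x) = 1}"
      by (intro closed_Collect_eq contA continuous_on_const)
    moreover have "C = S \<inter> {x. x \<bullet> (A *v x) = 1}" by (auto simp: C_def)
    ultimately show ?thesis using \<open>closed S\<close> by auto
  qed
  ultimately have "compact C" by (simp add: compact_eq_bounded_closed)
  define r where "r = z \<bullet> (A *v z)"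
  have "r > 0" using pos z r_def by auto
  have "(1 / sqrt r) *\<^sub>R z \<in> C"
    using zS \<open>subspace S\<close> \<open>r > 0\<close> scal[of "1 / sqrt r" z]
    by (auto simp: C_def r_def[symmetric] subspace_scale power_divide)
  then have "C \<noteq> {}" by auto
  from continuous_attains_sup[OF \<open>compact C\<close> this contB]
  obtain v where v: "v \<in> C" "\<And>x. x \<in> C \<Longrightarrow> x \<bullet> (B *v x) \<le> v \<bullet> (B *v v)" by blast
  define b where "b = v \<bullet> (B *v v)"
  have vS: "v \<in> S" and v1: "v \<bullet> (A *v v) = 1" using v(1) by (auto simp: C_def)
  \<comment> \<open>By homogeneity, maximality on \<open>C\<close> becomes an inequality on all of
    \<open>S\<close>, with equality at \<open>v\<close>.\<close>
  have le: "x \<bullet> (B *v x) \<le> b * (x \<bullet> (A *v x))" if "x \<in> S" for x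
  proof (cases "x = 0")
    case False
    define s where "s = x \<bullet> (A *v x)"
    have "s > 0" using pos False s_def by auto
    have "(1 / sqrt s) *\<^sub>R x \<in> C"
      using that \<open>subspace S\<close> \<open>s > 0\<close> scal[of "1 / sqrt s" x]
      by (auto simp: C_def s_def[symmetric] subspace_scale power_divide)
    from v(2)[OF this] have "(x \<bullet> (B *v x)) / s \<le> b"
      using \<open>s > 0\<close> by (simp add: matrix_vector_mult_scaleR b_def)
    then show ?thesis using \<open>s > 0\<close> by (simp add: s_def[symmetric] field_simps)
  qed simp
  \<comment> \<open>Along \<open>v + t *\<^sub>R y\<close> the inequality is a quadratic in
    \<open>t\<close> without constant term, so its linear coefficient vanishes.\<close>
  have orth: "(B *v v - b *\<^sub>R (A *v v)) \<bullet> y = 0" if y: "y \<in> S" for y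
  proof -
    define c where "c = y \<bullet> (B *v y) - b * (y \<bullet> (A *v y))"
    define d where "d = 2 * ((B *v v - b *\<^sub>R (A *v v)) \<bullet> y)"
    have "d * t + c * t\<^sup>2 \<le> 0" for t
    proof -
      have "v + t *\<^sub>R y \<in> S" using vS y \<open>subspace S\<close> by (simp add: subspace_add subspace_scale)
      from le[OF this] show ?thesis
        using v1 inner_matrix_symmetric[OF A, of v y] inner_matrix_symmetric[OF B, of v y]
          inner_commute[of y "A *v v"] inner_commute[of y "B *v v"]
        unfolding c_def d_def b_def
        by (simp add: algebra_simps power2_eq_square)
    qed
    then have "d = 0" by (rule linear_coeff_zero_if_nonpos)
    then show ?thesis by (simp add: d_def)
  qed
  have v0: "e i \<bullet> (A *v v) = 0" if "i \<in> F" for i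
    using vS that by (auto simp: S_def inner_matrix_symmetric[OF A])
  have orth_e: "(B *v v - b *\<^sub>R (A *v v)) \<bullet> e i = 0" if "i \<in> F" for i
  proof -
    have "(B *v v) \<bullet> e i = v \<bullet> (B *v e i)" by (rule inner_matrix_symmetric[OF B, symmetric])
    also have "\<dots> = \<beta> i * (v \<bullet> (A *v e i))" using eig[OF that] by simp
    also have "v \<bullet> (A *v e i) = e i \<bullet> (A *v v)"
      using inner_matrix_symmetric[OF A, of v "e i"] by (simp only: inner_commute)
    also have "\<dots> = 0" using v0[OF that] .
    finally show ?thesis using v0[OF that] inner_commute[of "A *v v" "e i"] by (simp add: inner_diff_left)
  qed
  \<comment> \<open>Subtracting the \<open>A\<close>-orthogonal projection onto the old eigenvectors
    moves an arbitrary \<open>y\<close> into \<open>S\<close>.\<close>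
  have "(B *v v - b *\<^sub>R (A *v v)) \<bullet> y = 0" for y
  proof -
    let ?d = "B *v v - b *\<^sub>R (A *v v)"
    define y' where "y' = y - (\<Sum>i\<in>F. ((A *v e i) \<bullet> y) *\<^sub>R e i)"
    have "y' \<in> S" unfolding S_def y'_def
    proof (safe)
      fix i assume i: "i \<in> F"
      have "(\<Sum>j\<in>F. ((A *v e j) \<bullet> y) * ((A *v e i) \<bullet> e j)) = (\<Sum>j\<in>F. ((A *v e j) \<bullet> y) * (if i = j then 1 else 0))"
        using ortho[OF i] by (intro sum.cong) (auto simp: inner_matrix_symmetric[OF A])
      also have "\<dots> = (A *v e i) \<bullet> y" using i by (simp add: if_distrib[of "(*) _"] cong: if_cong)
      finally show "(A *v e i) \<bullet> (y - (\<Sum>i\<in>F. ((A *v e i) \<bullet> y) *\<^sub>R e i)) = 0"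
        by (simp add: inner_diff_right inner_sum_right)
    qed
    then have "?d \<bullet> y' = 0" by (rule orth)
    moreover have "?d \<bullet> (\<Sum>i\<in>F. ((A *v e i) \<bullet> y) *\<^sub>R e i) = 0"
      unfolding inner_sum_right by (rule sum.neutral) (simp add: orth_e)
    ultimately show ?thesis unfolding y'_def inner_diff_right[of ?d y] by linarith
  qed
  from this[of "B *v v - b *\<^sub>R (A *v v)"] have "B *v v = b *\<^sub>R (A *v v)" by simp
  then show thesis using v0 v1 that by blast
qed

text \<open>Eigenvectors are added one index at a time. \<open>A\<close> itself acts as the inner
  product, so no square root of it has to be taken.\<close>

lemma simultaneous_diagonalization:
  fixes A B :: "real^'n^'n"
  assumes A: "transpose A = A" and B: "transpose B = B"
    and pos: "\<And>x. x \<noteq> 0 \<Longrightarrow> x \<bullet> (A *v x) > 0"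
  obtains e :: "'n \<Rightarrow> real^'n" and \<beta> :: "'n \<Rightarrow> real"
  where "\<And>i j. e i \<bullet> (A *v e j) = (if i = j then 1 else 0)"
    "\<And>i. B *v e i = \<beta> i *\<^sub>R (A *v e i)"
proof -
  have "\<exists>e \<beta>. (\<forall>i\<in>F. \<forall>j\<in>F. e i \<bullet> (A *v e j) = (if i = j then 1 else 0)) \<and>
      (\<forall>i\<in>F. B *v e i = \<beta> i *\<^sub>R (A *v e i))" for F :: "'n set"
  proof (induction F rule: finite_induct[OF finite])
    case 1
    then show ?case by simp
  next
    case (2 k F)
    then obtain e \<beta> where e: "\<And>i j. i \<in> F \<Longrightarrow> j \<in> F \<Longrightarrow> e i \<bullet> (A *v e j) = (if i = j then 1 else 0)"
      "\<And>i. i \<in> F \<Longrightarrow> B *v e i = \<beta> i *\<^sub>R (A *v e i)" by blast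
    have "F \<noteq> UNIV" using 2 by auto
    from generalized_eigenvector_exists[OF A B pos this e]
    obtain v b where v: "\<And>i. i \<in> F \<Longrightarrow> e i \<bullet> (A *v v) = 0" "v \<bullet> (A *v v) = 1"
      "B *v v = b *\<^sub>R (A *v v)" by blast
    have v': "v \<bullet> (A *v e i) = 0" if "i \<in> F" for i
      using v(1)[OF that] inner_matrix_symmetric[OF A, of v "e i"] inner_commute[of "A *v v" "e i"] by simp
    have "(e(k := v)) i \<bullet> (A *v (e(k := v)) j) = (if i = j then 1 else 0)"
      if "i \<in> insert k F" "j \<in> insert k F" for i j
      using that e(1) v v' 2(2) by auto
    moreover have "B *v (e(k := v)) i = (\<beta>(k := b)) i *\<^sub>R (A *v (e(k := v)) i)" if "i \<in> insert k F" for i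
      using that e(2) v 2(2) by auto
    ultimately show ?case by blast
  qed
  from this[of UNIV] show thesis using that by auto
qed

text \<open>With the eigenvectors as rows of \<open>E\<close>, congruence by \<open>E\<close> turns
  \<open>A\<close> into the identity and \<open>B\<close> into a diagonal matrix, hence every pencil
  into a diagonal one. The case \<open>a = 1\<close>, \<open>b = 0\<close> identifies
  \<open>(det E)\<^sup>2\<close> as the inverse of \<open>det A\<close>.\<close>

lemma det_pencil:
  fixes A B :: "real^'n^'n"
  assumes A: "transpose A = A" and B: "transpose B = B"
    and pos: "\<And>x. x \<noteq> 0 \<Longrightarrow> x \<bullet> (A *v x) > 0"
  obtains e :: "'n \<Rightarrow> real^'n" and \<beta> :: "'n \<Rightarrow> real"
  where "\<And>i. e i \<bullet> (A *v e i) = 1" "\<And>i. e i \<bullet> (B *v e i) = \<beta> i" "det A > 0"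
    "\<And>a b. det (a *\<^sub>R A + b *\<^sub>R B) = det A * (\<Prod>i\<in>UNIV. a + b * \<beta> i)"
proof -
  obtain e :: "'n \<Rightarrow> real^'n" and \<beta>
    where e: "\<And>i j. e i \<bullet> (A *v e j) = (if i = j then 1 else 0)"
    "\<And>i. B *v e i = \<beta> i *\<^sub>R (A *v e i)"
    by (rule simultaneous_diagonalization[OF A B]) (erule pos, rule that)
  define E :: "real^'n^'n" where "E = (\<chi> i. e i)"
  have prod: "(E ** M ** transpose E) $ i $ j = e i \<bullet> (M *v e j)" for M i j
  proof -
    have "(E ** M ** transpose E) $ i $ j = axis i 1 \<bullet> ((E ** M ** transpose E) *v axis j 1)"
      by (simp add: inner_axis' matrix_vector_mul_component) (simp add: inner_axis)
    also have "(E ** M ** transpose E) *v axis j 1 = E *v (M *v (transpose E *v axis j 1))"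
      by (simp only: matrix_vector_mul_assoc matrix_mul_assoc)
    also have "transpose E *v axis j 1 = e j"
      by (simp add: matrix_vector_mult_basis column_transpose row_def E_def)
    also have "axis i 1 \<bullet> (E *v (M *v e j)) = e i \<bullet> (M *v e j)"
      by (simp add: inner_axis' matrix_vector_mul_component E_def)
    finally show ?thesis .
  qed
  have key: "(det E)\<^sup>2 * det (a *\<^sub>R A + b *\<^sub>R B) = (\<Prod>i\<in>UNIV. a + b * \<beta> i)" for a b
  proof -
    let ?M = "a *\<^sub>R A + b *\<^sub>R B"
    have "e i \<bullet> (?M *v e j) = (if i = j then a + b * \<beta> i else 0)" for i j
      using e by (simp add: matrix_vector_mult_add_rdistrib scaleR_matrix_vector_assoc[symmetric] inner_add_right)
    then have "det (E ** ?M ** transpose E) = (\<Prod>i\<in>UNIV. a + b * \<beta> i)"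
      by (subst det_diagonal) (auto simp: prod)
    then show ?thesis by (simp add: det_mul det_transpose power2_eq_square ac_simps)
  qed
  from key[of 1 0] have one: "(det E)\<^sup>2 * det A = 1" by simp
  then have d: "det A > 0"
    using zero_less_mult_pos[of "(det E)\<^sup>2" "det A"] by (cases "det E = 0") auto
  have "det (a *\<^sub>R A + b *\<^sub>R B) = det A * (\<Prod>i\<in>UNIV. a + b * \<beta> i)" for a b
  proof -
    have "det A * (\<Prod>i\<in>UNIV. a + b * \<beta> i) = ((det E)\<^sup>2 * det A) * det (a *\<^sub>R A + b *\<^sub>R B)"
      unfolding key[symmetric] by (simp only: ac_simps)
    then show ?thesis using one by simp
  qed
  then show thesis using that[of e \<beta>] e d by simp
qed

subsection \<open>Determinants of pencils and McCann's condition\<close>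

text \<open>Jacobi's formula: the pairing of \<open>B\<close> with the cofactor matrix of
  \<open>A\<close>, that is, the derivative of the determinant at \<open>A\<close> in direction
  \<open>B\<close>. Written through the Leibniz formula it is polynomial in the entries, so its
  continuity is immediate.\<close>

definition det_deriv :: "real^'n^'n \<Rightarrow> real^'n^'n \<Rightarrow> real" where
  "det_deriv A B = (\<Sum>p | p permutes UNIV. of_int (sign p) *
     (\<Sum>i\<in>UNIV. B $ i $ p i * (\<Prod>j\<in>UNIV - {i}. A $ j $ p j)))"

lemma has_real_derivative_det:
  fixes A B :: "real^'n^'n"
  shows "((\<lambda>r. det (A + r *\<^sub>R B)) has_real_derivative det_deriv (A + r *\<^sub>R B) B) (at r within S)"
proof -
  have "((\<lambda>r. \<Prod>i\<in>UNIV. A $ i $ p i + r * B $ i $ p i) has_derivative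
      (\<lambda>h. \<Sum>i\<in>UNIV. (h * B $ i $ p i) * (\<Prod>j\<in>UNIV - {i}. A $ j $ p j + r * B $ j $ p j)))
      (at r within S)" for p :: "'n \<Rightarrow> 'n"
    by (rule has_derivative_prod) (auto intro!: derivative_eq_intros)
  then have "((\<lambda>r. \<Prod>i\<in>UNIV. A $ i $ p i + r * B $ i $ p i) has_real_derivative
      (\<Sum>i\<in>UNIV. B $ i $ p i * (\<Prod>j\<in>UNIV - {i}. A $ j $ p j + r * B $ j $ p j)))
      (at r within S)" for p :: "'n \<Rightarrow> 'n"
    unfolding has_field_derivative_def
    by (rule has_derivative_eq_rhs) (auto simp: fun_eq_iff sum_distrib_left ac_simps)
  then show ?thesis unfolding det_def det_deriv_def
    by (auto intro!: DERIV_sum DERIV_cmult)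
qed

lemma continuous_on_det [continuous_intros]:
  fixes A :: "'a::topological_space \<Rightarrow> real^'n^'n"
  assumes "continuous_on S A"
  shows "continuous_on S (\<lambda>x. det (A x))"
  unfolding det_def by (intro continuous_intros assms)

lemma continuous_on_det_deriv [continuous_intros]:
  fixes A B :: "'a::topological_space \<Rightarrow> real^'n^'n"
  assumes "continuous_on S A" "continuous_on S B"
  shows "continuous_on S (\<lambda>x. det_deriv (A x) (B x))"
  unfolding det_deriv_def by (intro continuous_intros assms)

locale spd_pair =
  fixes A1 A2 :: "real^'n^'n"
  assumes sym: "transpose A1 = A1" "transpose A2 = A2"
    and pos1: "\<And>x. x \<noteq> 0 \<Longrightarrow> x \<bullet> (A1 *v x) > 0"
    and pos2: "\<And>x. x \<noteq> 0 \<Longrightarrow> x \<bullet> (A2 *v x) > 0"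
begin

text \<open>The \<open>\<mu> i\<close> are the eigenvalues of the inverse of \<open>A1\<close> times
  \<open>A2\<close>; the segment is the pencil with coefficients \<open>1 - r\<close> and
  \<open>r\<close>.\<close>

lemma relative_eigenvalues:
  obtains \<mu> :: "'n \<Rightarrow> real" where "\<And>i. \<mu> i > 0" "det A1 > 0" "det A2 = det A1 * prod \<mu> UNIV"
    "\<And>r. det (A1 + r *\<^sub>R (A2 - A1)) = det A1 * (\<Prod>i\<in>UNIV. 1 + r * (\<mu> i - 1))"
proof -
  obtain e :: "'n \<Rightarrow> real^'n" and \<beta> :: "'n \<Rightarrow> real" where
    e: "\<And>i. e i \<bullet> (A1 *v e i) = 1" "\<And>i. e i \<bullet> (A2 *v e i) = \<beta> i" "det A1 > 0"
    and d: "\<And>a b. det (a *\<^sub>R A1 + b *\<^sub>R A2) = det A1 * (\<Prod>i\<in>UNIV. a + b * \<beta> i)"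
    by (rule det_pencil[OF sym]) (erule pos1, rule that)
  have "e i \<noteq> 0" for i using e(1)[of i] by auto
  then have "\<beta> i > 0" for i using pos2[of "e i"] e(2) by simp
  moreover have "det (A1 + r *\<^sub>R (A2 - A1)) = det A1 * (\<Prod>i\<in>UNIV. 1 + r * (\<beta> i - 1))" for r
    using d[of "1 - r" r] by (simp add: algebra_simps)
  moreover have "det A2 = det A1 * prod \<beta> UNIV" using d[of 0 1] by simp
  ultimately show thesis using that e(3) by blast
qed

text \<open>At \<open>r = 0\<close> the product rule leaves \<open>det A1\<close> times the sum of
  the \<open>\<mu> i - 1\<close>, and the arithmetic mean of the \<open>\<mu> i\<close> dominates
  their geometric mean, a root of \<open>det A2 / det A1\<close>.\<close>

lemma det_deriv_bound:
  "det_deriv A1 (A2 - A1) \<ge> real CARD('n) * det A1 * ((det A2 / det A1) powr (1 / real CARD('n)) - 1)"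
proof -
  obtain \<mu> :: "'n \<Rightarrow> real" where \<mu>: "\<And>i. \<mu> i > 0" and d: "det A1 > 0" "det A2 = det A1 * prod \<mu> UNIV"
    and pen: "\<And>r. det (A1 + r *\<^sub>R (A2 - A1)) = det A1 * (\<Prod>i\<in>UNIV. 1 + r * (\<mu> i - 1))"
    using relative_eigenvalues by blast
  have "((\<lambda>r. \<Prod>i\<in>UNIV. 1 + r * (\<mu> i - 1)) has_derivative
      (\<lambda>h. \<Sum>i\<in>UNIV. (h * (\<mu> i - 1)) * (\<Prod>j\<in>UNIV - {i}. 1 + 0 * (\<mu> j - 1)))) (at 0)"
    by (rule has_derivative_prod) (auto intro!: derivative_eq_intros)
  then have "((\<lambda>r. \<Prod>i\<in>UNIV. 1 + r * (\<mu> i - 1)) has_real_derivative (\<Sum>i\<in>UNIV. \<mu> i - 1)) (at 0)"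
    unfolding has_field_derivative_def
    by (rule has_derivative_eq_rhs) (auto simp: fun_eq_iff sum_distrib_left ac_simps)
  then have "((\<lambda>r. det (A1 + r *\<^sub>R (A2 - A1))) has_real_derivative det A1 * (\<Sum>i\<in>UNIV. \<mu> i - 1)) (at 0)"
    unfolding pen by (rule DERIV_cmult)
  with has_real_derivative_det[of A1 "A2 - A1" 0 UNIV]
  have eq: "det_deriv A1 (A2 - A1) = det A1 * (\<Sum>i\<in>UNIV. \<mu> i - 1)" by (auto dest: DERIV_unique)
  have "(prod \<mu> UNIV) powr (1 / real CARD('n)) \<le> (\<Sum>i\<in>UNIV. \<mu> i / real CARD('n))"
    using arith_geom_mean[of "UNIV :: 'n set" \<mu>] \<mu> by (auto simp: less_imp_le)
  also have "prod \<mu> UNIV = det A2 / det A1" using d by simp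
  finally have "real CARD('n) * (det A2 / det A1) powr (1 / real CARD('n)) \<le> (\<Sum>i\<in>UNIV. \<mu> i)"
    by (simp add: sum_divide_distrib[symmetric] field_simps)
  then have "det A1 * (real CARD('n) * (det A2 / det A1) powr (1 / real CARD('n)) - real CARD('n))
      \<le> det A1 * (\<Sum>i\<in>UNIV. \<mu> i - 1)"
    using d by (intro mult_left_mono) (auto simp: sum_subtractf)
  then show ?thesis unfolding eq by (simp add: algebra_simps)
qed

text \<open>Young's inequality bounds each factor below by \<open>\<mu> i powr r\<close>, so the
  determinant is log-concave on the segment and at least the smaller endpoint value. This keeps the
  interpolated maps uniformly nondegenerate.\<close>

lemma det_interpolation_ge:
  assumes "0 \<le> r" "r \<le> 1"
  shows "min (det A1) (det A2) \<le> det (A1 + r *\<^sub>R (A2 - A1))"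
proof -
  obtain \<mu> :: "'n \<Rightarrow> real" where \<mu>: "\<And>i. \<mu> i > 0" and d: "det A1 > 0" "det A2 = det A1 * prod \<mu> UNIV"
    and pen: "\<And>r. det (A1 + r *\<^sub>R (A2 - A1)) = det A1 * (\<Prod>i\<in>UNIV. 1 + r * (\<mu> i - 1))"
    using relative_eigenvalues by blast
  have pp: "prod \<mu> UNIV > 0" using \<mu> by (intro prod_pos) auto
  have young: "\<mu> i powr r \<le> 1 + r * (\<mu> i - 1)" for i
  proof -
    have "1 powr (1 - r) * \<mu> i powr r \<le> (1 - r) * 1 + r * \<mu> i"
      using assms \<mu>[of i] by (intro Youngs_inequality_0) auto
    then show ?thesis by (simp add: algebra_simps)
  qed
  have "(prod \<mu> UNIV) powr r = (\<Prod>i\<in>UNIV. \<mu> i powr r)"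
    by (rule prod_powr_distrib)
  also have "\<dots> \<le> (\<Prod>i\<in>UNIV. 1 + r * (\<mu> i - 1))" using young by (intro prod_mono) auto
  finally have *: "det A1 * (prod \<mu> UNIV) powr r \<le> det (A1 + r *\<^sub>R (A2 - A1))"
    unfolding pen using d by simp
  have "min 1 (prod \<mu> UNIV) \<le> (prod \<mu> UNIV) powr r"
  proof (cases "prod \<mu> UNIV \<ge> 1")
    case True
    then show ?thesis using ge_one_powr_ge_zero[of "prod \<mu> UNIV" r] assms by (simp add: min_def)
  next
    case False
    then show ?thesis using powr_mono'[of r 1 "prod \<mu> UNIV"] assms pp by (simp add: min_def)
  qed
  then have "det A1 * min 1 (prod \<mu> UNIV) \<le> det A1 * (prod \<mu> UNIV) powr r" using d by simp
  moreover have "min (det A1) (det A2) \<le> det A1 * min 1 (prod \<mu> UNIV)"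
    unfolding d(2) by (simp add: min_def)
  ultimately show ?thesis using * by linarith
qed

end

text \<open>After the determinant bounds, the sum is at least \<open>n * u powr (1 - 1 / n)\<close>
  times \<open>(f (u / D1) - f (u / D2)) * (D2 powr (1 / n) - D1 powr (1 / n))\<close>, where
  \<open>f\<close> is the quotient in McCann's condition. The two differences have the same sign,
  because \<open>f\<close> increases and \<open>u / D\<close> decreases in \<open>D\<close>.\<close>

lemma mccann_pointwise:
  fixes A1 A2 :: "real^'n^'n" and P :: "real \<Rightarrow> real"
  assumes "spd_pair A1 A2" and u: "u > 0"
    and mc: "mono_on {0<..} (\<lambda>r. (P r - P 0) / r powr (1 - 1 / real CARD('n)))"
    and mono: "strict_mono_on {0..} P"
  shows "(P (u / det A1) - P 0) * det_deriv A1 (A2 - A1)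
       + (P (u / det A2) - P 0) * det_deriv A2 (A1 - A2) \<ge> 0"
proof -
  interpret spd_pair A1 A2 by fact
  interpret sw: spd_pair A2 A1 using sym pos1 pos2 by unfold_locales auto
  define n where "n = real CARD('n)"
  define D1 where "D1 = det A1" define D2 where "D2 = det A2"
  have D: "D1 > 0" "D2 > 0" unfolding D1_def D2_def using relative_eigenvalues sw.relative_eigenvalues by blast+
  have n: "n \<ge> 1" by (simp add: n_def Suc_leI)
  \<comment> \<open>Nonnegativity is what allows the lower bounds for \<open>det_deriv\<close> to be
    multiplied by the pressure terms.\<close>
  have p: "P (u / D) - P 0 \<ge> 0" if "D > 0" for D
    using strict_mono_onD[OF mono, of 0 "u / D"] u that by simp
  define f where "f = (\<lambda>r. (P r - P 0) / r powr (1 - 1 / n))"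
  \<comment> \<open>The weight \<open>D powr (1 - 1 / n)\<close> coming from the determinant bound
    is the denominator of \<open>f\<close> at \<open>u / D\<close>, up to a power of
    \<open>u\<close>.\<close>
  have pf: "(P (u / D) - P 0) * D powr (1 - 1 / n) = u powr (1 - 1 / n) * f (u / D)" if "D > 0" for D
    using that u by (simp add: f_def powr_divide)
  have split: "n * D * ((E / D) powr (1 / n) - 1) = n * D powr (1 - 1 / n) * (E powr (1 / n) - D powr (1 / n))"
    if "D > 0" "E > 0" for D E
    using that by (simp add: powr_divide powr_diff field_simps)
  have 1: "(P (u / D1) - P 0) * det_deriv A1 (A2 - A1) \<ge>
      (P (u / D1) - P 0) * (n * D1 powr (1 - 1 / n) * (D2 powr (1 / n) - D1 powr (1 / n)))"
    unfolding split[OF D, symmetric]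
    using det_deriv_bound[folded n_def D1_def D2_def] p[OF D(1)] by (rule mult_left_mono)
  have 2: "(P (u / D2) - P 0) * det_deriv A2 (A1 - A2) \<ge>
      (P (u / D2) - P 0) * (n * D2 powr (1 - 1 / n) * (D1 powr (1 / n) - D2 powr (1 / n)))"
    unfolding split[OF D(2,1), symmetric]
    using sw.det_deriv_bound[folded n_def D1_def D2_def] p[OF D(2)] by (rule mult_left_mono)
  have "(f (u / D1) - f (u / D2)) * (D2 powr (1 / n) - D1 powr (1 / n)) \<ge> 0"
  proof (cases "D1 \<le> D2")
    case True
    then have "f (u / D2) \<le> f (u / D1)"
      using mc D u unfolding f_def n_def by (intro mono_onD[OF mc]) (auto simp: field_simps)
    moreover have "D1 powr (1 / n) \<le> D2 powr (1 / n)" using True D n by (intro powr_mono2) auto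
    ultimately show ?thesis by simp
  next
    case False
    then have "f (u / D1) \<le> f (u / D2)"
      using mc D u unfolding f_def n_def by (intro mono_onD[OF mc]) (auto simp: field_simps)
    moreover have "D2 powr (1 / n) \<le> D1 powr (1 / n)" using False D n by (intro powr_mono2) auto
    ultimately show ?thesis by (simp add: mult_nonpos_nonpos)
  qed
  then have "n * u powr (1 - 1 / n) * ((f (u / D1) - f (u / D2)) * (D2 powr (1 / n) - D1 powr (1 / n))) \<ge> 0"
    by (rule mult_nonneg_nonneg[rotated]) (use n in simp)
  also have "n * u powr (1 - 1 / n) * ((f (u / D1) - f (u / D2)) * (D2 powr (1 / n) - D1 powr (1 / n)))
    = n * (u powr (1 - 1 / n) * f (u / D1)) * (D2 powr (1 / n) - D1 powr (1 / n))
    + n * (u powr (1 - 1 / n) * f (u / D2)) * (D1 powr (1 / n) - D2 powr (1 / n))"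
    by (simp add: algebra_simps)
  also have "\<dots> = (P (u / D1) - P 0) * (n * D1 powr (1 - 1 / n) * (D2 powr (1 / n) - D1 powr (1 / n)))
    + (P (u / D2) - P 0) * (n * D2 powr (1 - 1 / n) * (D1 powr (1 / n) - D2 powr (1 / n)))"
    unfolding pf[OF D(1), symmetric] pf[OF D(2), symmetric] by (simp only: ac_simps)
  finally show ?thesis using 1 2 unfolding D1_def D2_def by linarith
qed

subsection \<open>Change of variables over arbitrary finite index types\<close>

text \<open>The change of variables theorems of the library need a well-ordered index type. The
  following type is a well-ordered copy of an arbitrary finite index type.\<close>

typedef ('n::finite) wo_index = "{..<CARD('n)}"
  by (rule exI[of _ 0]) simp

instantiation wo_index :: (finite) wellorder
begin

definition less_eq_wo_index :: "'a wo_index \<Rightarrow> 'a wo_index \<Rightarrow> bool" where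
  "less_eq_wo_index x y \<longleftrightarrow> Rep_wo_index x \<le> Rep_wo_index y"

definition less_wo_index :: "'a wo_index \<Rightarrow> 'a wo_index \<Rightarrow> bool" where
  "less_wo_index x y \<longleftrightarrow> Rep_wo_index x < Rep_wo_index y"

instance
proof
  fix P :: "'a wo_index \<Rightarrow> bool" and a
  assume P: "\<And>x. (\<And>y. y < x \<Longrightarrow> P y) \<Longrightarrow> P x"
  show "P a"
  proof (induction a rule: measure_induct_rule[of Rep_wo_index])
    case (less x)
    show ?case by (rule P, rule less.IH) (simp add: less_wo_index_def)
  qed
qed (auto simp: less_eq_wo_index_def less_wo_index_def Rep_wo_index_inject)

end

instance wo_index :: (finite) finite
proof
  have "(UNIV :: 'a wo_index set) = Abs_wo_index ` {..<CARD('a)}"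
    by (rule type_definition.Abs_image[OF type_definition_wo_index, symmetric])
  then show "finite (UNIV :: 'a wo_index set)" by (metis finite_imageI finite_lessThan)
qed

lemma card_wo_index: "CARD('n::finite wo_index) = CARD('n)"
  by (simp add: type_definition.card[OF type_definition_wo_index])

section \<open>Relabelling of coordinates\<close>

definition reindex :: "('m \<Rightarrow> 'n) \<Rightarrow> real^'n \<Rightarrow> real^'m" where
  "reindex \<rho> x = (\<chi> j. x $ \<rho> j)"

lemma linear_reindex: "linear (reindex \<rho>)"
  by (rule linearI) (simp_all add: reindex_def vec_eq_iff)

lemma reindex_reindex: "reindex \<sigma> (reindex \<rho> x) = reindex (\<rho> \<circ> \<sigma>) x"
  by (simp add: reindex_def)

lemma reindex_id [simp]: "reindex id x = x"
  by (simp add: reindex_def)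

lemma continuous_reindex: "continuous_on S (reindex \<rho> :: real^'n \<Rightarrow> real^'m)"
  unfolding reindex_def by (intro continuous_intros)

lemma prod_Basis_vec:
  fixes f :: "real^'n \<Rightarrow> 'b::comm_monoid_mult"
  shows "prod f Basis = (\<Prod>i\<in>UNIV. f (axis i 1))"
proof -
  have inj: "inj (\<lambda>i. axis i (1::real) :: real^'n)" by (simp add: inj_on_def axis_eq_axis)
  have "(Basis :: (real^'n) set) = (\<lambda>i. axis i 1) ` UNIV" by (auto simp: Basis_vec_def)
  then show ?thesis using prod.reindex[OF inj, of f] by (simp only: o_def)
qed

text \<open>Relabelling sends boxes to boxes with the same side lengths, and \<open>lborel\<close>
  is determined by the volumes of boxes.\<close>

lemma distr_reindex:
  fixes \<rho> :: "'m::finite \<Rightarrow> 'n::finite"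
  assumes "bij \<rho>"
  shows "distr lborel borel (reindex \<rho>) = lborel"
proof (rule lborel_eqI[symmetric])
  have meas: "reindex \<rho> \<in> borel_measurable (borel :: (real^'n) measure)"
    by (rule borel_measurable_continuous_onI) (rule continuous_reindex)
  fix l u :: "real^'m" assume lu: "\<And>b. b \<in> Basis \<Longrightarrow> l \<bullet> b \<le> u \<bullet> b"
  have "reindex \<rho> -` box l u = box (reindex (inv \<rho>) l) (reindex (inv \<rho>) u)"
  proof -
    have "(\<forall>i. l $ i < x $ \<rho> i \<and> x $ \<rho> i < u $ i) \<longleftrightarrow> (\<forall>j. l $ inv \<rho> j < x $ j \<and> x $ j < u $ inv \<rho> j)" for x :: "real^'n"
      using inv_f_f[OF bij_is_inj[OF assms]] surj_f_inv_f[OF bij_is_surj[OF assms]] by metis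
    then show ?thesis by (auto simp: mem_box_cart reindex_def)
  qed
  then have "emeasure (distr lborel borel (reindex \<rho>)) (box l u) =
      emeasure lborel (box (reindex (inv \<rho>) l) (reindex (inv \<rho>) u))"
    using meas by (subst emeasure_distr) auto
  also have "\<dots> = (\<Prod>b\<in>Basis. (reindex (inv \<rho>) u - reindex (inv \<rho>) l) \<bullet> b)"
  proof (rule emeasure_lborel_box)
    fix b :: "real^'n" assume "b \<in> Basis"
    then obtain i where "b = axis i 1" by (auto simp: Basis_vec_def)
    then show "reindex (inv \<rho>) l \<bullet> b \<le> reindex (inv \<rho>) u \<bullet> b"
      using lu[of "axis (inv \<rho> i) 1"] by (simp add: inner_axis reindex_def axis_in_Basis_iff)
  qed
  also have "(\<Prod>b\<in>Basis. (reindex (inv \<rho>) u - reindex (inv \<rho>) l) \<bullet> b) = (\<Prod>i\<in>UNIV. (u - l) $ inv \<rho> i)"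
    by (simp add: prod_Basis_vec inner_axis reindex_def)
  also have "\<dots> = (\<Prod>i\<in>UNIV. (u - l) $ i)"
    using bij_imp_bij_inv[OF assms] by (rule prod.reindex_bij_betw)
  also have "\<dots> = (\<Prod>b\<in>Basis. (u - l) \<bullet> b)"
    by (simp add: prod_Basis_vec inner_axis)
  finally show "emeasure (distr lborel borel (reindex \<rho>)) (box l u) = ennreal (\<Prod>b\<in>Basis. (u - l) \<bullet> b)" .
qed simp

text \<open>Conjugation by \<open>\<rho>\<close> is a sign preserving bijection between the
  permutations of the two index types, so the Leibniz sums agree term by term.\<close>

lemma det_reindex:
  fixes A :: "real^'n^'n" and \<rho> :: "'m::finite \<Rightarrow> 'n::finite"
  assumes "bij \<rho>"
  shows "det (\<chi> i j. A $ \<rho> i $ \<rho> j) = det A"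
proof -
  have bi: "bij_betw \<rho> UNIV UNIV" using assms by simp
  have "det A = (\<Sum>p | p permutes (UNIV :: 'm set). of_int (sign (map_permutation UNIV \<rho> p)) *
      (\<Prod>i\<in>UNIV. A $ i $ map_permutation UNIV \<rho> p i))"
    unfolding det_def
  proof (rule sum.reindex_bij_witness[where i = "map_permutation UNIV \<rho>" and j = "map_permutation UNIV (inv \<rho>)"])
    fix p :: "'n \<Rightarrow> 'n" assume "p \<in> {p. p permutes UNIV}"
    then have p: "p permutes UNIV" by simp
    show 1: "map_permutation UNIV \<rho> (map_permutation UNIV (inv \<rho>) p) = p"
      using bij_imp_bij_inv[OF assms] p surj_f_inv_f[OF bij_is_surj[OF assms]]
      by (rule map_permutation_compose_inv)
    show "map_permutation UNIV (inv \<rho>) p \<in> {p. p permutes UNIV}"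
      using map_permutation_permutes[OF bij_imp_bij_inv[OF assms] p] by simp
    show "of_int (sign (map_permutation UNIV \<rho> (map_permutation UNIV (inv \<rho>) p))) *
        (\<Prod>i\<in>UNIV. A $ i $ map_permutation UNIV \<rho> (map_permutation UNIV (inv \<rho>) p) i) =
        of_int (sign p) * (\<Prod>i\<in>UNIV. A $ i $ p i)"
      unfolding 1 ..
  next
    fix p :: "'m \<Rightarrow> 'm" assume "p \<in> {p. p permutes UNIV}"
    then have p: "p permutes UNIV" by simp
    show "map_permutation UNIV (inv \<rho>) (map_permutation UNIV \<rho> p) = p"
      using assms p inv_f_f[OF bij_is_inj[OF assms]] by (rule map_permutation_compose_inv)
    show "map_permutation UNIV \<rho> p \<in> {p. p permutes UNIV}"
      using map_permutation_permutes[OF assms p] by simp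
  qed
  also have "\<dots> = det (\<chi> i j. A $ \<rho> i $ \<rho> j)"
    unfolding det_def
  proof (intro sum.cong refl arg_cong2[where f = "(*)"])
    fix p :: "'m \<Rightarrow> 'm" assume p: "p \<in> {p. p permutes UNIV}"
    show "of_int (sign (map_permutation UNIV \<rho> p)) = (of_int (sign p) :: real)"
      using sign_map_permutation[OF bij_is_inj[OF assms], of p] p by simp
    have "(\<Prod>i\<in>UNIV. A $ i $ map_permutation UNIV \<rho> p i) =
        (\<Prod>i\<in>UNIV. A $ \<rho> i $ map_permutation UNIV \<rho> p (\<rho> i))"
      using bi by (rule prod.reindex_bij_betw[symmetric])
    also have "\<dots> = (\<Prod>i\<in>UNIV. A $ \<rho> i $ \<rho> (p i))"
      using map_permutation_apply[OF bij_is_inj[OF assms], of _ p] by simp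
    finally show "(\<Prod>i\<in>UNIV. A $ i $ map_permutation UNIV \<rho> p i) =
        (\<Prod>i\<in>UNIV. (\<chi> i j. A $ \<rho> i $ \<rho> j) $ i $ p i)" by simp
  qed
  finally show ?thesis by simp
qed

lemma det_matrix_reindex:
  fixes f :: "real^'n \<Rightarrow> real^'n" and \<rho> :: "'m::finite \<Rightarrow> 'n::finite"
  assumes "bij \<rho>"
  shows "det (matrix (reindex \<rho> \<circ> f \<circ> reindex (inv \<rho>))) = det (matrix f)"
proof -
  have "reindex (inv \<rho>) (axis j 1) = axis (\<rho> j) (1::real)" for j
    using inv_f_f[OF bij_is_inj[OF assms], of j] surj_f_inv_f[OF bij_is_surj[OF assms]]
    unfolding reindex_def vec_eq_iff axis_def vec_lambda_beta by metis
  then have "matrix (reindex \<rho> \<circ> f \<circ> reindex (inv \<rho>)) = (\<chi> i j. matrix f $ \<rho> i $ \<rho> j)"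
    by (simp add: matrix_def vec_eq_iff) (simp add: reindex_def)
  then show ?thesis using det_reindex[OF assms, of "matrix f"] by simp
qed

lemma integrable_reindex_iff:
  fixes \<rho> :: "'m::finite \<Rightarrow> 'n::finite" and f :: "real^'m \<Rightarrow> 'b::{banach, second_countable_topology}"
  assumes "bij \<rho>" "f \<in> borel_measurable borel"
  shows "integrable lborel (\<lambda>x. f (reindex \<rho> x)) \<longleftrightarrow> integrable lborel f"
    and "(LINT x|lborel. f (reindex \<rho> x)) = integral\<^sup>L lborel f"
proof -
  have m: "reindex \<rho> \<in> measurable lborel (borel :: (real^'m) measure)"
    using borel_measurable_continuous_onI[OF continuous_reindex] by simp
  show "integrable lborel (\<lambda>x. f (reindex \<rho> x)) \<longleftrightarrow> integrable lborel f"
    using integrable_distr_eq[OF m assms(2)] unfolding distr_reindex[OF assms(1)] by simp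
  show "(LINT x|lborel. f (reindex \<rho> x)) = integral\<^sup>L lborel f"
    using integral_distr[OF m assms(2)] unfolding distr_reindex[OF assms(1)] by simp
qed

text \<open>The underlying substitution rule concerns the Lebesgue completion; the Borel
  measurability of both integrands brings it back to \<open>lborel\<close>.\<close>

lemma change_of_variables_wo:
  fixes g :: "real^'m::{finite,wellorder} \<Rightarrow> real^'m::_" and f :: "real^'m::_ \<Rightarrow> real"
  assumes S: "S \<in> sets borel"
    and der: "\<And>x. x \<in> S \<Longrightarrow> (g has_derivative g' x) (at x within S)"
    and inj: "inj_on g S"
    and m1: "set_borel_measurable borel (g ` S) f"
    and m2: "set_borel_measurable borel S (\<lambda>x. \<bar>det (matrix (g' x))\<bar> * f (g x))"
  shows "set_integrable lborel S (\<lambda>x. \<bar>det (matrix (g' x))\<bar> * f (g x)) \<longleftrightarrow> set_integrable lborel (g ` S) f"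
    and "(LINT x:S|lborel. \<bar>det (matrix (g' x))\<bar> * f (g x)) = (LINT y:g ` S|lborel. f y)"
proof -
  have leb: "set_integrable lborel A h \<longleftrightarrow> h absolutely_integrable_on A"
      "(LINT x:A|lborel. h x) = (LINT x:A|lebesgue. h x)"
    if "set_borel_measurable borel A h" for A and h :: "real^'m::_ \<Rightarrow> real"
    using that unfolding set_integrable_def set_borel_measurable_def set_lebesgue_integral_def
    by (simp_all add: integrable_completion integral_completion)
  have S': "S \<in> sets lebesgue" using S by (simp add: sets_completionI_sets)
  let ?D = "\<lambda>x. \<bar>det (matrix (g' x))\<bar>"
  have *: "(\<lambda>x. ?D x * f (g x)) absolutely_integrable_on S \<and> integral S (\<lambda>x. ?D x * f (g x)) = b
      \<longleftrightarrow> f absolutely_integrable_on (g ` S) \<and> integral (g ` S) f = b" for b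
  proof -
    \<comment> \<open>The substitution rule speaks of vector values, so real functions are viewed as
      functions into \<open>real^1\<close>.\<close>
    have "(\<lambda>x. ?D x *\<^sub>R vec (f (g x)) :: real^1) absolutely_integrable_on S \<and>
        integral S (\<lambda>x. ?D x *\<^sub>R vec (f (g x))) = (vec b :: real^1)
      \<longleftrightarrow> (\<lambda>x. vec (f x) :: real^1) absolutely_integrable_on (g ` S) \<and>
           integral (g ` S) (\<lambda>x. vec (f x)) = (vec b :: real^1)"
      using S' der inj by (rule has_absolute_integral_change_of_variables)
    then show ?thesis
      by (simp flip: vec_cmul add: absolutely_integrable_on_1_iff integral_on_1_eq)
  qed
  show iff: "set_integrable lborel S (\<lambda>x. ?D x * f (g x)) \<longleftrightarrow> set_integrable lborel (g ` S) f"
    unfolding leb[OF m1] leb[OF m2] using * by blast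
  show "(LINT x:S|lborel. ?D x * f (g x)) = (LINT y:g ` S|lborel. f y)"
  proof (cases "set_integrable lborel (g ` S) f")
    case True
    then have a: "f absolutely_integrable_on (g ` S)" "(\<lambda>x. ?D x * f (g x)) absolutely_integrable_on S"
      using iff leb[OF m1] leb[OF m2] by auto
    then show ?thesis
      unfolding leb[OF m1] leb[OF m2] set_lebesgue_integral_eq_integral(2)[OF a(1)]
        set_lebesgue_integral_eq_integral(2)[OF a(2)]
      using *[of "integral (g ` S) f"] by blast
  next
    \<comment> \<open>By the equivalence neither side is integrable, and both integrals have the
      default value 0.\<close>
    case False
    then show ?thesis using iff
      by (simp add: set_integrable_def set_lebesgue_integral_def not_integrable_integral_eq)
  qed
qed

text \<open>Conjugating \<open>g\<close> by a relabelling of coordinates carries it to the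
  well-ordered copy of the index type. Relabelling preserves the measure and the determinant of the
  derivative, so the result transfers back.\<close>

lemma change_of_variables:
  fixes g :: "real^'n \<Rightarrow> real^'n" and f :: "real^'n \<Rightarrow> real"
  assumes S: "S \<in> sets borel"
    and der: "\<And>x. x \<in> S \<Longrightarrow> (g has_derivative g' x) (at x within S)"
    and inj: "inj_on g S"
    and m1: "set_borel_measurable borel (g ` S) f"
    and m2: "set_borel_measurable borel S (\<lambda>x. \<bar>det (matrix (g' x))\<bar> * f (g x))"
  shows "set_integrable lborel S (\<lambda>x. \<bar>det (matrix (g' x))\<bar> * f (g x)) \<longleftrightarrow> set_integrable lborel (g ` S) f"
    and "(LINT x:S|lborel. \<bar>det (matrix (g' x))\<bar> * f (g x)) = (LINT y:g ` S|lborel. f y)"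
proof -
  obtain \<rho> :: "'n wo_index \<Rightarrow> 'n" where \<rho>: "bij \<rho>"
    using finite_same_card_bij[of "UNIV :: 'n wo_index set" "UNIV :: 'n set"] card_wo_index by auto
  define L where "L = (reindex \<rho> :: real^'n \<Rightarrow> real^('n wo_index))"
  define L' where "L' = (reindex (inv \<rho>) :: real^('n wo_index) \<Rightarrow> real^'n)"
  have LL: "L' (L x) = x" "L (L' y) = y" for x y
    unfolding L_def L'_def reindex_reindex
    by (simp_all add: inj_iff[THEN iffD1, OF bij_is_inj[OF \<rho>]] surj_iff[THEN iffD1, OF bij_is_surj[OF \<rho>]])
  have mL': "L' \<in> borel \<rightarrow>\<^sub>M borel" unfolding L'_def
    by (rule borel_measurable_continuous_onI) (rule continuous_reindex)
  have dL: "(L has_derivative L) F" and dL': "(L' has_derivative L') F'" for F F'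
    unfolding L_def L'_def by (simp_all add: linear_imp_has_derivative linear_reindex)
  define T where "T = L ` S"
  have T: "T = L' -` S" unfolding T_def using LL by (auto simp: image_iff) metis
  define G where "G = L \<circ> g \<circ> L'"
  define G' where "G' = (\<lambda>y. L \<circ> g' (L' y) \<circ> L')"
  have GT: "G ` T = L' -` (g ` S)"
    unfolding G_def T_def using LL by (auto simp: image_iff) metis
  have det: "det (matrix (G' y)) = det (matrix (g' (L' y)))" for y
    unfolding G'_def L_def L'_def by (rule det_matrix_reindex[OF \<rho>])
  have transfer: "set_integrable lborel (L' -` A) (\<lambda>y. h (L' y)) \<longleftrightarrow> set_integrable lborel A h"
      "(LINT y:L' -` A|lborel. h (L' y)) = (LINT x:A|lborel. h x)"
      "set_borel_measurable borel (L' -` A) (\<lambda>y. h (L' y))"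
    if "set_borel_measurable borel A h" for A and h :: "real^'n \<Rightarrow> real"
  proof -
    let ?k = "\<lambda>x. indicator A x *\<^sub>R h x"
    have k: "?k \<in> borel_measurable borel" using that by (simp add: set_borel_measurable_def)
    have eq: "(\<lambda>y. indicator (L' -` A) y *\<^sub>R h (L' y)) = (\<lambda>y. ?k (L' y))"
      by (auto simp: indicator_def fun_eq_iff)
    show "set_integrable lborel (L' -` A) (\<lambda>y. h (L' y)) \<longleftrightarrow> set_integrable lborel A h"
      "(LINT y:L' -` A|lborel. h (L' y)) = (LINT x:A|lborel. h x)"
      unfolding set_integrable_def set_lebesgue_integral_def eq
      unfolding L'_def by (rule integrable_reindex_iff[OF bij_imp_bij_inv[OF \<rho>] k])+
    show "set_borel_measurable borel (L' -` A) (\<lambda>y. h (L' y))"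
      unfolding set_borel_measurable_def eq by (rule measurable_compose[OF mL' k])
  qed
  have T1: "T \<in> sets borel" using measurable_sets[OF mL' S] by (simp add: T)
  have T2: "(G has_derivative G' y) (at y within T)" if "y \<in> T" for y
  proof -
    have y: "L' y \<in> S" "L' ` T = S" using that LL by (auto simp: T image_iff) metis
    have "(g \<circ> L' has_derivative g' (L' y) \<circ> L') (at y within T)"
      using dL' der[OF y(1)] by (intro diff_chain_within) (simp_all add: y(2))
    from diff_chain_within[OF this dL] show ?thesis by (simp add: G_def G'_def o_assoc)
  qed
  have T3: "inj_on G T"
  proof (rule inj_onI)
    fix a b assume ab: "a \<in> T" "b \<in> T" "G a = G b"
    then have "g (L' a) = g (L' b)" using LL by (metis G_def comp_apply)
    then have "L' a = L' b" using ab inj by (auto simp: T dest: inj_onD)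
    then show "a = b" using LL by metis
  qed
  have T4: "set_borel_measurable borel (G ` T) (\<lambda>y. f (L' y))"
    unfolding GT using transfer(3)[OF m1] .
  have eq: "(\<lambda>y. \<bar>det (matrix (G' y))\<bar> * f (L' (G y))) = (\<lambda>y. (\<lambda>x. \<bar>det (matrix (g' x))\<bar> * f (g x)) (L' y))"
    by (simp add: det G_def LL)
  have T5: "set_borel_measurable borel T (\<lambda>y. \<bar>det (matrix (G' y))\<bar> * f (L' (G y)))"
    unfolding T eq using transfer(3)[OF m2] .
  have "set_integrable lborel T (\<lambda>y. \<bar>det (matrix (G' y))\<bar> * f (L' (G y))) \<longleftrightarrow>
      set_integrable lborel (G ` T) (\<lambda>y. f (L' y))"
    "(LINT x:T|lborel. \<bar>det (matrix (G' x))\<bar> * f (L' (G x))) = (LINT y:G ` T|lborel. f (L' y))"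
    by (rule change_of_variables_wo[OF T1 T2 T3 T4 T5]; assumption)+
  then show "set_integrable lborel S (\<lambda>x. \<bar>det (matrix (g' x))\<bar> * f (g x)) \<longleftrightarrow> set_integrable lborel (g ` S) f"
    and "(LINT x:S|lborel. \<bar>det (matrix (g' x))\<bar> * f (g x)) = (LINT y:g ` S|lborel. f y)"
    unfolding GT eq unfolding T transfer(1,2)[OF m1] transfer(1,2)[OF m2] by auto
qed

subsection \<open>Integration along displacements\<close>

text \<open>\<open>G\<close> is not assumed continuous, but it is a pointwise limit of difference
  quotients of \<open>f\<close>, which are Borel.\<close>

lemma set_borel_measurable_gradient:
  fixes f :: "'a::euclidean_space \<Rightarrow> real"
  assumes S: "open S" and der: "\<And>x. x \<in> S \<Longrightarrow> (f has_derivative (\<lambda>v. G x \<bullet> v)) (at x)"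
  shows "set_borel_measurable borel S G"
  unfolding set_borel_measurable_def
proof (subst borel_measurable_euclidean_space, intro ballI)
  fix b :: 'a assume b: "b \<in> Basis"
  \<comment> \<open>Extension by zero makes the quotients Borel on the whole space. From a point of
    the open set \<open>S\<close> the shifted points eventually lie in \<open>S\<close>, where
    \<open>F\<close> agrees with \<open>f\<close>.\<close>
  define F where "F = (\<lambda>x. indicator S x * f x)"
  have "continuous_on S f"
    by (intro continuous_at_imp_continuous_on ballI has_derivative_continuous[OF der])
  from borel_measurable_continuous_on_indicator[OF borel_open[OF S] this]
  have F[measurable]: "F \<in> borel_measurable borel" by (simp add: F_def)
  have [measurable]: "S \<in> sets borel" using S by simp
  have "(\<lambda>n. indicator S x * ((F (x + (1 / real (Suc n)) *\<^sub>R b) - F x) / (1 / real (Suc n))))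
      \<longlonglongrightarrow> (indicator S x *\<^sub>R G x) \<bullet> b" for x
  proof (cases "x \<in> S")
    case True
    have lim: "(\<lambda>n. 1 / real (Suc n)) \<longlonglongrightarrow> 0" using LIMSEQ_inverse_real_of_nat by (simp only: inverse_eq_divide)
    then have lim': "filterlim (\<lambda>n. 1 / real (Suc n)) (at 0) sequentially" by (simp add: filterlim_at)
    have "((\<lambda>s. x + s *\<^sub>R b) has_derivative (\<lambda>s. s *\<^sub>R b)) (at 0)" by (auto intro!: derivative_eq_intros)
    moreover have "(f has_derivative (\<lambda>v. G x \<bullet> v)) (at (x + 0 *\<^sub>R b))" using der True by simp
    ultimately have "((\<lambda>s. f (x + s *\<^sub>R b)) has_derivative (\<lambda>s. G x \<bullet> (s *\<^sub>R b))) (at 0)"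
      by (rule has_derivative_compose)
    then have "((\<lambda>s. f (x + s *\<^sub>R b)) has_real_derivative G x \<bullet> b) (at 0)"
      unfolding has_field_derivative_def by (rule has_derivative_eq_rhs) (simp add: mult.commute fun_eq_iff)
    then have "((\<lambda>s. (f (x + s *\<^sub>R b) - f x) / s) \<longlongrightarrow> G x \<bullet> b) (at 0)"
      by (simp add: has_field_derivative_iff)
    then have "(\<lambda>n. (f (x + (1 / real (Suc n)) *\<^sub>R b) - f x) / (1 / real (Suc n))) \<longlonglongrightarrow> G x \<bullet> b"
      by (rule filterlim_compose[OF _ lim'])
    moreover have "\<forall>\<^sub>F n in sequentially. x + (1 / real (Suc n)) *\<^sub>R b \<in> S"
    proof -
      have "(\<lambda>n. x + (1 / real (Suc n)) *\<^sub>R b) \<longlonglongrightarrow> x + 0 *\<^sub>R b" by (intro tendsto_intros lim)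
      then show ?thesis using S True by (auto dest: topological_tendstoD)
    qed
    then have "\<forall>\<^sub>F n in sequentially. (f (x + (1 / real (Suc n)) *\<^sub>R b) - f x) / (1 / real (Suc n))
        = indicator S x * ((F (x + (1 / real (Suc n)) *\<^sub>R b) - F x) / (1 / real (Suc n)))"
      by eventually_elim (use True in \<open>simp add: F_def\<close>)
    ultimately have "(\<lambda>n. indicator S x * ((F (x + (1 / real (Suc n)) *\<^sub>R b) - F x) / (1 / real (Suc n))))
        \<longlonglongrightarrow> G x \<bullet> b" by (rule Lim_transform_eventually)
    then show ?thesis using True by simp
  qed simp
  then show "(\<lambda>x. (indicator S x *\<^sub>R G x) \<bullet> b) \<in> borel_measurable borel"
    by (rule borel_measurable_LIMSEQ_real) measurable
qed

lemma set_integral_nonneg: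
  fixes f :: "'a \<Rightarrow> real"
  assumes "\<And>x. x \<in> A \<Longrightarrow> 0 \<le> f x"
  shows "0 \<le> (LINT x:A|M. f x)"
  unfolding set_lebesgue_integral_def by (rule integral_nonneg_AE) (use assms in \<open>auto simp: indicator_def\<close>)

text \<open>The bound on the L1 norms is uniform in \<open>s\<close>, so \<open>f'\<close> is
  jointly integrable over parameter and space and the order of integration can be exchanged.\<close>

lemma Fubini_FTC:
  fixes f f' :: "real \<Rightarrow> 'a::euclidean_space \<Rightarrow> real"
  assumes S: "S \<in> sets borel"
    and meas: "(\<lambda>(s, x). indicator {0..1} s * (indicator S x * f' s x)) \<in> borel_measurable (borel \<Otimes>\<^sub>M borel)"
    and int: "\<And>s. s \<in> {0..1} \<Longrightarrow> set_integrable lborel S (f' s)"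
    and bound: "\<And>s. s \<in> {0..1} \<Longrightarrow> (LINT x:S|lborel. \<bar>f' s x\<bar>) \<le> B"
    and der: "\<And>s x. x \<in> S \<Longrightarrow> s \<in> {0..1} \<Longrightarrow> ((\<lambda>s. f s x) has_real_derivative f' s x) (at s within {0..1})"
    and fm: "\<And>s. s \<in> {0..1} \<Longrightarrow> set_borel_measurable borel S (f s)"
    and R: "R \<in> {0..1}"
  shows "set_integrable lborel S (\<lambda>x. f R x - f 0 x)"
    and "set_integrable lborel {0..1} (\<lambda>s. LINT x:S|lborel. f' s x)"
    and "(LINT x:S|lborel. f R x - f 0 x) = (LINT s:{0..R}|lborel. LINT x:S|lborel. f' s x)"
proof -
  define h where "h = (\<lambda>(s, x). indicator {0..1} s * (indicator S x * f' s x))"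
  have hm[measurable]: "h \<in> borel_measurable (lborel \<Otimes>\<^sub>M lborel)"
    using meas unfolding h_def[symmetric] by (simp cong: measurable_cong_sets sets_pair_measure_cong)
  have slice: "integrable lborel (\<lambda>x. h (s, x))" for s
    using int[of s] by (cases "s \<in> {0..1}") (auto simp: h_def set_integrable_def)
  have "(LINT x|lborel. norm (h (s, x))) = indicator {0..1} s * (LINT x:S|lborel. \<bar>f' s x\<bar>)" for s
    by (auto simp: h_def set_lebesgue_integral_def abs_mult indicator_def)
  moreover have "0 \<le> (LINT x:S|lborel. \<bar>f' s x\<bar>)" for s by (rule set_integral_nonneg) simp
  ultimately have nb: "norm (LINT x|lborel. norm (h (s, x))) \<le> norm (indicator {0..1} s * B)" for s
    using bound[of s] by (auto simp: indicator_def intro: order_trans)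
  have "integrable lborel (\<lambda>s. LINT x|lborel. norm (h (s, x)))"
  proof (rule Bochner_Integration.integrable_bound)
    show "integrable lborel (\<lambda>s::real. indicator {0..1} s * B)" by simp
    show "AE s in lborel. norm (LINT x|lborel. norm (h (s, x))) \<le> norm (indicator {0..1} s * B)"
      using nb by simp
  qed measurable
  then have ih: "integrable (lborel \<Otimes>\<^sub>M lborel) h"
    using slice by (intro lborel_pair.Fubini_integrable) auto
  define k where "k = (\<lambda>(s, x). indicator {0..R} s * h (s, x))"
  have km[measurable]: "k \<in> borel_measurable (lborel \<Otimes>\<^sub>M lborel)" unfolding k_def by measurable
  have ik: "integrable (lborel \<Otimes>\<^sub>M lborel) k"
    by (rule Bochner_Integration.integrable_bound[OF ih km]) (auto simp: k_def indicator_def)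
  have keq: "k (s, x) = indicator {0..R} s * (indicator S x * f' s x)" for s x
    using R by (auto simp: k_def h_def indicator_def)
  have AEk: "AE x in lborel. integrable lborel (\<lambda>s. k (s, x))"
    using lborel_pair.AE_integrable_snd[of "\<lambda>s x. k (s, x)"] ik by simp
  \<comment> \<open>The fundamental theorem holds for the gauge integral of any derivative.
    Integrability of the slice, available for almost every \<open>x\<close>, identifies that
    integral with the Lebesgue integral.\<close>
  have ftc: "indicator S x * (f R x - f 0 x) = (LINT s|lborel. k (s, x))"
    if "integrable lborel (\<lambda>s. k (s, x))" for x
  proof (cases "x \<in> S")
    case True
    have "((\<lambda>s. f' s x) has_integral (f R x - f 0 x)) {0..R}"
    proof (rule fundamental_theorem_of_calculus)
      fix s assume s: "s \<in> {0..R}"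
      then have "s \<in> {0..1}" "{0..R} \<subseteq> {0..1}" using R by auto
      then show "((\<lambda>s. f s x) has_vector_derivative f' s x) (at s within {0..R})"
        using der[OF True] by (metis has_vector_derivative_within_subset has_real_derivative_iff_has_vector_derivative)
    qed (use R in auto)
    moreover have si: "set_integrable lborel {0..R} (\<lambda>s. f' s x)"
      using that True unfolding keq set_integrable_def by simp
    ultimately have "f R x - f 0 x = (LINT s:{0..R}|lborel. f' s x)"
      by (metis has_integral_set_lebesgue has_integral_unique set_borel_integral_eq_integral(2)
          integral_unique)
    then show ?thesis using True by (simp add: keq set_lebesgue_integral_def)
  qed (simp add: keq)
  have m: "(\<lambda>x. indicator S x * (f R x - f 0 x)) \<in> borel_measurable lborel"
    using borel_measurable_diff[OF fm[OF R, unfolded set_borel_measurable_def] fm[of 0, unfolded set_borel_measurable_def]]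
    by (simp add: right_diff_distrib)
  have AEeq: "AE x in lborel. (LINT s|lborel. k (s, x)) = indicator S x * (f R x - f 0 x)"
    using AEk by eventually_elim (simp add: ftc)
  have ik2: "integrable lborel (\<lambda>x. LINT s|lborel. k (s, x))"
    using lborel_pair.integrable_snd[of "\<lambda>s x. k (s, x)"] ik by simp
  then show "set_integrable lborel S (\<lambda>x. f R x - f 0 x)"
    unfolding set_integrable_def
    using integrable_cong_AE[OF _ m AEeq] by (simp add: borel_measurable_integrable)
  have *: "(LINT x|lborel. h (s, x)) = indicator {0..1} s * (LINT x:S|lborel. f' s x)" for s
    by (simp add: h_def set_lebesgue_integral_def)
  show "set_integrable lborel {0..1} (\<lambda>s. LINT x:S|lborel. f' s x)"
    using lborel_pair.integrable_fst'[OF ih] unfolding set_integrable_def * by simp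
  have "(LINT x:S|lborel. f R x - f 0 x) = (LINT x|lborel. LINT s|lborel. k (s, x))"
    unfolding set_lebesgue_integral_def
    using integral_cong_AE[OF _ m AEeq] borel_measurable_integrable[OF ik2] by simp
  also have "\<dots> = (LINT s|lborel. LINT x|lborel. k (s, x))"
    using lborel_pair.Fubini_integral[of "\<lambda>s x. k (s, x)"] ik by simp
  also have "\<dots> = (LINT s:{0..R}|lborel. LINT x:S|lborel. f' s x)"
    by (simp add: keq set_lebesgue_integral_def)
  finally show "(LINT x:S|lborel. f R x - f 0 x) = (LINT s:{0..R}|lborel. LINT x:S|lborel. f' s x)" .
qed

section \<open>Displacements with velocity constant in time\<close>

text \<open>The maps are only required to send \<open>S\<close> injectively into itself, with
  Jacobian at least \<open>c\<close>. Surjectivity is added where it is used, so that the setting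
  also covers the dilation of a smaller cube to the whole one.\<close>

locale displacement =
  fixes S :: "(real^'n) set" and a b :: "real^'n \<Rightarrow> real^'n" and A B :: "real^'n \<Rightarrow> real^'n^'n"
    and M c :: real
  assumes open_S: "open S"
    and der_a: "\<And>x. (a has_derivative (*v) (A x)) (at x)"
    and der_b: "\<And>x. (b has_derivative (*v) (B x)) (at x)"
    and cont_A: "continuous_on UNIV A" and cont_B: "continuous_on UNIV B"
    and b_bound: "\<And>x. x \<in> S \<Longrightarrow> norm (b x) \<le> M"
    and c: "c > 0"
    and det_ge: "\<And>r x. r \<in> {0..1} \<Longrightarrow> x \<in> S \<Longrightarrow> c \<le> det (A x + r *\<^sub>R B x)"
    and inj: "\<And>r. r \<in> {0..1} \<Longrightarrow> inj_on (\<lambda>x. a x + r *\<^sub>R b x) S"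
    and into: "\<And>r x. r \<in> {0..1} \<Longrightarrow> x \<in> S \<Longrightarrow> a x + r *\<^sub>R b x \<in> S"
begin

definition t where "t r x = a x + r *\<^sub>R b x"
definition D where "D r x = det (A x + r *\<^sub>R B x)"

lemma S_borel [measurable]: "S \<in> sets borel" using open_S by simp

lemma cont_a: "continuous_on X a" and cont_b: "continuous_on X b"
  by (intro continuous_at_imp_continuous_on ballI has_derivative_continuous[OF der_a]
      has_derivative_continuous[OF der_b])+

lemma measurable_a [measurable]: "a \<in> borel_measurable borel"
  and measurable_b [measurable]: "b \<in> borel_measurable borel"
  by (rule borel_measurable_continuous_onI[OF cont_a] borel_measurable_continuous_onI[OF cont_b])+

lemma der_t: "(t r has_derivative (*v) (A x + r *\<^sub>R B x)) (at x within X)"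
proof -
  have "((\<lambda>x. a x + r *\<^sub>R b x) has_derivative (\<lambda>v. A x *v v + r *\<^sub>R (B x *v v))) (at x within X)"
    by (intro has_derivative_add has_derivative_scaleR_right has_derivative_at_withinI[OF der_a]
        has_derivative_at_withinI[OF der_b])
  then show ?thesis unfolding t_def
    by (rule has_derivative_eq_rhs)
      (simp add: fun_eq_iff matrix_vector_mult_add_rdistrib scaleR_matrix_vector_assoc)
qed

lemma cont_t: "continuous_on X (t r)"
  by (rule has_derivative_continuous_on[OF der_t])

lemma measurable_t [measurable]: "t r \<in> borel_measurable borel"
  by (rule borel_measurable_continuous_onI[OF cont_t])

lemma cont_D: "continuous_on UNIV (\<lambda>(r, x). D r x)"
  unfolding D_def case_prod_unfold
  by (intro continuous_intros continuous_on_compose2[OF cont_A] continuous_on_compose2[OF cont_B]) auto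

lemma measurable_D [measurable]: "D r \<in> borel_measurable borel"
proof -
  have "continuous_on UNIV (D r)"
    using continuous_on_compose2[OF cont_D, of UNIV "\<lambda>x. (r, x)"]
    by (simp add: continuous_on_Pair)
  then show ?thesis by (rule borel_measurable_continuous_onI)
qed

lemma D_ge: "r \<in> {0..1} \<Longrightarrow> x \<in> S \<Longrightarrow> c \<le> D r x"
  unfolding D_def by (rule det_ge)

lemma t_in: "r \<in> {0..1} \<Longrightarrow> x \<in> S \<Longrightarrow> t r x \<in> S"
  unfolding t_def by (rule into)

lemma inj_t: "r \<in> {0..1} \<Longrightarrow> inj_on (t r) S"
  using inj unfolding t_def .

lemma open_image_t: "r \<in> {0..1} \<Longrightarrow> X \<subseteq> S \<Longrightarrow> open X \<Longrightarrow> open (t r ` X)"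
  by (rule invariance_of_domain[OF cont_t _ inj_on_subset[OF inj_t]])

text \<open>\<open>g\<close> is controlled only on \<open>S\<close>; since \<open>t r\<close> maps
  \<open>S\<close> into \<open>S\<close>, the indicator of \<open>S\<close> may be inserted at
  \<open>t r x\<close> without changing the function.\<close>

lemma comp_measurable:
  fixes g :: "real^'n \<Rightarrow> 'b::{real_normed_vector, second_countable_topology}"
  assumes "r \<in> {0..1}" "set_borel_measurable borel S g"
  shows "set_borel_measurable borel S (\<lambda>x. g (t r x))"
proof -
  have [measurable]: "(\<lambda>x. indicator S x *\<^sub>R g x) \<in> borel_measurable borel"
    using assms(2) by (simp add: set_borel_measurable_def)
  from measurable_compose[OF measurable_t this]
  have [measurable]: "(\<lambda>x. indicator S (t r x) *\<^sub>R g (t r x)) \<in> borel_measurable borel" .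
  have "(\<lambda>x. indicator S x *\<^sub>R (indicator S (t r x) *\<^sub>R g (t r x))) \<in> borel_measurable borel"
    by measurable
  moreover have "(\<lambda>x. indicator S x *\<^sub>R (indicator S (t r x) *\<^sub>R g (t r x))) = (\<lambda>x. indicator S x *\<^sub>R g (t r x))"
    using t_in[OF assms(1)] by (auto simp: indicator_def fun_eq_iff)
  ultimately show ?thesis by (simp add: set_borel_measurable_def)
qed

lemma change_of_variables_t:
  fixes g :: "real^'n \<Rightarrow> real"
  assumes r: "r \<in> {0..1}" and g: "set_borel_measurable borel S g"
  shows "set_integrable lborel S (\<lambda>x. D r x * g (t r x)) \<longleftrightarrow> set_integrable lborel (t r ` S) g"
    and "(LINT x:S|lborel. D r x * g (t r x)) = (LINT y:t r ` S|lborel. g y)"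
proof -
  have abs: "\<bar>det (matrix ((*v) (A x + r *\<^sub>R B x)))\<bar> = D r x" if "x \<in> S" for x
    using D_ge[OF r that] c by (simp add: D_def)
  have [measurable]: "t r ` S \<in> sets borel" using open_image_t[OF r _ open_S] by simp
  have [measurable]: "(\<lambda>x. indicator S x *\<^sub>R g x) \<in> borel_measurable borel"
    using g by (simp add: set_borel_measurable_def)
  have [measurable]: "(\<lambda>x. indicator S x *\<^sub>R g (t r x)) \<in> borel_measurable borel"
    using comp_measurable[OF r g] by (simp add: set_borel_measurable_def)
  have m1: "set_borel_measurable borel (t r ` S) g"
  proof -
    have "(\<lambda>x. indicator (t r ` S) x *\<^sub>R (indicator S x *\<^sub>R g x)) \<in> borel_measurable borel" by measurable
    moreover have "(\<lambda>x. indicator (t r ` S) x *\<^sub>R (indicator S x *\<^sub>R g x)) = (\<lambda>x. indicator (t r ` S) x *\<^sub>R g x)"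
      using t_in[OF r] by (auto simp: indicator_def fun_eq_iff)
    ultimately show ?thesis by (simp add: set_borel_measurable_def)
  qed
  have eq: "indicator S x * (\<bar>det (A x + r *\<^sub>R B x)\<bar> * y) = indicator S x * (D r x * y)" for x y
    using abs[of x] by (auto simp: indicator_def)
  have m2: "set_borel_measurable borel S (\<lambda>x. \<bar>det (matrix ((*v) (A x + r *\<^sub>R B x)))\<bar> * g (t r x))"
  proof -
    have "(\<lambda>x. D r x * (indicator S x *\<^sub>R g (t r x))) \<in> borel_measurable borel" by measurable
    then show ?thesis by (simp add: set_borel_measurable_def eq mult.left_commute)
  qed
  have *: "S \<in> sets borel" by simp
  note cv = change_of_variables[OF * der_t inj_t[OF r] m1 m2]
  show "set_integrable lborel S (\<lambda>x. D r x * g (t r x)) \<longleftrightarrow> set_integrable lborel (t r ` S) g"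
    using cv(1) by (simp add: set_integrable_def eq)
  show "(LINT x:S|lborel. D r x * g (t r x)) = (LINT y:t r ` S|lborel. g y)"
    using cv(2) by (simp add: set_lebesgue_integral_def eq)
qed

text \<open>Injectivity turns the weighted integral into one over the image, a subset of
  \<open>S\<close>; the lower bound \<open>c\<close> on the Jacobian then removes the weight at the
  price of the factor \<open>1 / c\<close>.\<close>

lemma integrable_comp:
  fixes g :: "real^'n \<Rightarrow> real"
  assumes r: "r \<in> {0..1}" and g: "set_borel_measurable borel S g" "set_integrable lborel S g"
  shows "set_integrable lborel S (\<lambda>x. g (t r x))"
    and "set_integrable lborel S (\<lambda>x. D r x * g (t r x))"
    and "(LINT x:S|lborel. \<bar>g (t r x)\<bar>) \<le> (LINT x:S|lborel. \<bar>g x\<bar>) / c"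
    and "(LINT x:S|lborel. D r x * \<bar>g (t r x)\<bar>) \<le> (LINT x:S|lborel. \<bar>g x\<bar>)"
proof -
  have img: "t r ` S \<subseteq> S" "t r ` S \<in> sets lborel"
    using t_in[OF r] open_image_t[OF r _ open_S] by auto
  have gi: "set_integrable lborel (t r ` S) g" by (rule set_integrable_subset[OF g(2) img(2,1)])
  then show i2: "set_integrable lborel S (\<lambda>x. D r x * g (t r x))"
    using change_of_variables_t(1)[OF r g(1)] by simp
  have le: "c * \<bar>g (t r x)\<bar> \<le> D r x * \<bar>g (t r x)\<bar>" if "x \<in> S" for x
    using D_ge[OF r that] by (simp add: mult_right_mono)
  show i1: "set_integrable lborel S (\<lambda>x. g (t r x))"
  proof (rule set_integrable_bound)
    show "set_integrable lborel S (\<lambda>x. (1 / c) * (D r x * g (t r x)))" using i2 by simp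
    show "set_borel_measurable lborel S (\<lambda>x. g (t r x))"
      using comp_measurable[OF r g(1)] by (simp add: set_borel_measurable_def)
    show "AE x in lborel. x \<in> S \<longrightarrow> norm (g (t r x)) \<le> norm ((1 / c) * (D r x * g (t r x)))"
    proof (intro AE_I2 impI)
      fix x assume "x \<in> S"
      from le[OF this] D_ge[OF r this] c
      show "norm (g (t r x)) \<le> norm ((1 / c) * (D r x * g (t r x)))"
        by (simp add: abs_mult field_simps)
    qed
  qed
  have ga: "set_borel_measurable borel S (\<lambda>x. \<bar>g x\<bar>)" "set_integrable lborel S (\<lambda>x. \<bar>g x\<bar>)"
    using borel_measurable_abs[OF g(1)[unfolded set_borel_measurable_def]] set_integrable_abs[OF g(2)]
    by (simp_all add: set_borel_measurable_def abs_mult)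
  have gai: "set_integrable lborel (t r ` S) (\<lambda>x. \<bar>g x\<bar>)" by (rule set_integrable_subset[OF ga(2) img(2,1)])
  have i3: "set_integrable lborel S (\<lambda>x. D r x * \<bar>g (t r x)\<bar>)"
    using change_of_variables_t(1)[OF r ga(1)] gai by simp
  have "(LINT x:S|lborel. D r x * \<bar>g (t r x)\<bar>) = (LINT y:t r ` S|lborel. \<bar>g y\<bar>)"
    by (rule change_of_variables_t(2)[OF r ga(1)])
  also have "\<dots> \<le> (LINT y:S|lborel. \<bar>g y\<bar>)"
    using gai ga(2) img(1) unfolding set_integrable_def set_lebesgue_integral_def
    by (intro integral_mono) (auto simp: indicator_def)
  finally show 4: "(LINT x:S|lborel. D r x * \<bar>g (t r x)\<bar>) \<le> (LINT x:S|lborel. \<bar>g x\<bar>)" .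
  have "c * (LINT x:S|lborel. \<bar>g (t r x)\<bar>) = (LINT x:S|lborel. c * \<bar>g (t r x)\<bar>)" by simp
  also have "\<dots> \<le> (LINT x:S|lborel. D r x * \<bar>g (t r x)\<bar>)"
    using i1 i3 le by (intro set_integral_mono) (auto intro: set_integrable_abs)
  also note 4
  finally show "(LINT x:S|lborel. \<bar>g (t r x)\<bar>) \<le> (LINT x:S|lborel. \<bar>g x\<bar>) / c"
    using c by (simp add: field_simps)
qed

text \<open>Joint measurability in \<open>s\<close> and \<open>x\<close> is what exchanging the
  order of integration asks for.\<close>

lemma measurable_along:
  fixes g :: "real^'n \<Rightarrow> 'b::{real_normed_vector, second_countable_topology}"
  assumes "set_borel_measurable borel S g"
  shows "(\<lambda>(s, x). (indicator {0..1::real} s * indicator S x :: real) *\<^sub>R g (t s x)) \<in> borel_measurable (borel \<Otimes>\<^sub>M borel)"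
proof -
  have [measurable]: "(\<lambda>x. indicator S x *\<^sub>R g x) \<in> borel_measurable borel"
    using assms by (simp add: set_borel_measurable_def)
  have "(\<lambda>(s, x). t s x) \<in> borel_measurable (borel \<Otimes>\<^sub>M borel)"
    unfolding t_def by measurable
  from measurable_compose[OF this \<open>(\<lambda>x. indicator S x *\<^sub>R g x) \<in> borel_measurable borel\<close>]
  have [measurable]: "(\<lambda>(s, x). indicator S (t s x) *\<^sub>R g (t s x)) \<in> borel_measurable (borel \<Otimes>\<^sub>M borel)"
    by (simp add: case_prod_unfold)
  have "(\<lambda>(s, x). (indicator {0..1::real} s * indicator S x :: real) *\<^sub>R (indicator S (t s x) *\<^sub>R g (t s x)))
      \<in> borel_measurable (borel \<Otimes>\<^sub>M borel)"
    by measurable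
  moreover have "(\<lambda>(s, x). (indicator {0..1::real} s * indicator S x :: real) *\<^sub>R (indicator S (t s x) *\<^sub>R g (t s x)))
      = (\<lambda>(s, x). (indicator {0..1} s * indicator S x) *\<^sub>R g (t s x))"
    using t_in by (auto simp: indicator_def fun_eq_iff)
  ultimately show "(\<lambda>(s, x). (indicator {0..1::real} s * indicator S x :: real) *\<^sub>R g (t s x)) \<in> borel_measurable (borel \<Otimes>\<^sub>M borel)"
    by simp
qed

end

context displacement
begin

lemma der_comp_t:
  assumes q: "\<And>x. x \<in> S \<Longrightarrow> (q has_derivative (\<lambda>v. G x \<bullet> v)) (at x)"
    and s: "s \<in> {0..1}" "x \<in> S"
  shows "((\<lambda>s. q (t s x)) has_real_derivative G (t s x) \<bullet> b x) (at s within X)"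
proof -
  have "((\<lambda>s. t s x) has_derivative (\<lambda>r. r *\<^sub>R b x)) (at s within X)"
    unfolding t_def by (auto intro!: derivative_eq_intros)
  from has_derivative_compose[OF this q[OF t_in[OF s]]]
  show ?thesis unfolding has_field_derivative_def
    by (rule has_derivative_eq_rhs) (simp add: fun_eq_iff mult.commute)
qed

lemma measurable_gradient_along:
  assumes G: "set_borel_measurable borel S G"
  shows "(\<lambda>(s, x). indicator {0..1} s * (indicator S x * (G (t s x) \<bullet> b x))) \<in> borel_measurable (borel \<Otimes>\<^sub>M borel)"
proof -
  note measurable_along[OF G, measurable]
  have "(\<lambda>p. (\<lambda>(s, x). (indicator {0..1::real} s * indicator S x :: real) *\<^sub>R G (t s x)) p \<bullet> b (snd p))
      \<in> borel_measurable (borel \<Otimes>\<^sub>M borel)" by measurable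
  then show ?thesis by (simp add: case_prod_unfold mult.assoc)
qed

text \<open>The difference is the integral over \<open>s\<close> of
  \<open>G (t s x) \<bullet> b x\<close>, and the L1 norm of each slice is at most
  \<open>\<bar>M\<bar> / c\<close> times that of \<open>G\<close>.\<close>

lemma displacement_difference_integrable:
  assumes q: "\<And>x. x \<in> S \<Longrightarrow> (q has_derivative (\<lambda>v. G x \<bullet> v)) (at x)"
    and Gi: "set_integrable lborel S (\<lambda>x. norm (G x))"
  shows "set_integrable lborel S (\<lambda>x. q (t 1 x) - q (t 0 x))"
proof -
  have Gm: "set_borel_measurable borel S G" by (rule set_borel_measurable_gradient[OF open_S q])
  then have [measurable]: "(\<lambda>x. indicator S x *\<^sub>R G x) \<in> borel_measurable borel"
    by (simp add: set_borel_measurable_def)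
  have "(\<lambda>x. norm (indicator S x *\<^sub>R G x)) \<in> borel_measurable borel" by measurable
  then have Gnm: "set_borel_measurable borel S (\<lambda>x. norm (G x))"
    by (simp add: set_borel_measurable_def)
  have qm: "set_borel_measurable borel S q" unfolding set_borel_measurable_def
    by (intro borel_measurable_continuous_on_indicator S_borel continuous_at_imp_continuous_on ballI
        has_derivative_continuous[OF q])
  have bd: "\<bar>G (t s x) \<bullet> b x\<bar> \<le> M * norm (G (t s x))" if "x \<in> S" for s x
  proof -
    have "\<bar>G (t s x) \<bullet> b x\<bar> \<le> norm (G (t s x)) * norm (b x)" by (rule Cauchy_Schwarz_ineq2)
    also have "\<dots> \<le> norm (G (t s x)) * M" using b_bound[OF that] by (intro mult_left_mono) auto
    finally show ?thesis by (simp add: mult.commute)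
  qed
  have i1: "set_integrable lborel S (\<lambda>x. M * norm (G (t s x)))" if "s \<in> {0..1}" for s
    using integrable_comp(1)[OF that Gnm Gi] by simp
  have i2: "set_integrable lborel S (\<lambda>x. G (t s x) \<bullet> b x)" if s: "s \<in> {0..1}" for s
  proof (rule set_integrable_bound[OF i1[OF s]])
    have [measurable]: "(\<lambda>x. indicator S x *\<^sub>R G (t s x)) \<in> borel_measurable borel"
      using comp_measurable[OF s Gm] by (simp add: set_borel_measurable_def)
    have "(\<lambda>x. (indicator S x *\<^sub>R G (t s x)) \<bullet> b x) \<in> borel_measurable borel" by measurable
    then show "set_borel_measurable lborel S (\<lambda>x. G (t s x) \<bullet> b x)"
      by (simp add: set_borel_measurable_def)
    show "AE x in lborel. x \<in> S \<longrightarrow> norm (G (t s x) \<bullet> b x) \<le> norm (M * norm (G (t s x)))"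
      using bd by (intro AE_I2 impI) (metis abs_ge_self order_trans real_norm_def)
  qed
  have "set_integrable lborel S (\<lambda>x. (\<lambda>s x. q (t s x)) 1 x - (\<lambda>s x. q (t s x)) 0 x)"
  proof (rule Fubini_FTC(1)[OF S_borel measurable_gradient_along[OF Gm] i2])
    fix s :: real assume s: "s \<in> {0..1}"
    have "(LINT x:S|lborel. \<bar>G (t s x) \<bullet> b x\<bar>) \<le> (LINT x:S|lborel. M * norm (G (t s x)))"
      using i1[OF s] i2[OF s] bd by (intro set_integral_mono) (auto intro: set_integrable_abs)
    also have "\<dots> = M * (LINT x:S|lborel. \<bar>norm (G (t s x))\<bar>)" by simp
    also have "\<dots> \<le> \<bar>M\<bar> * ((LINT x:S|lborel. \<bar>norm (G x)\<bar>) / c)"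
      using integrable_comp(3)[OF s Gnm Gi]
      by (intro mult_mono) (auto intro!: set_integral_nonneg)
    finally show "(LINT x:S|lborel. \<bar>G (t s x) \<bullet> b x\<bar>) \<le> \<bar>M\<bar> * ((LINT x:S|lborel. \<bar>norm (G x)\<bar>) / c)" .
  next
    fix s :: real and x assume "x \<in> S" "s \<in> {0..1}"
    then show "((\<lambda>s. q (t s x)) has_real_derivative G (t s x) \<bullet> b x) (at s within {0..1})"
      by (intro der_comp_t q)
  next
    fix s :: real assume s: "s \<in> {0..1}"
    show "set_borel_measurable borel S (\<lambda>x. q (t s x))" by (rule comp_measurable[OF s qm])
  qed auto
  then show ?thesis by simp
qed

section \<open>Invariance of integrals under surjective displacements\<close>

definition E where "E r x = det_deriv (A x + r *\<^sub>R B x) (B x)"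

lemma cont_E: "continuous_on UNIV (\<lambda>(r, x). E r x)"
  unfolding E_def case_prod_unfold
  by (intro continuous_intros continuous_on_compose2[OF cont_A] continuous_on_compose2[OF cont_B]) auto

lemma der_D: "((\<lambda>r. D r x) has_real_derivative E r x) (at r within X)"
  unfolding D_def E_def by (rule has_real_derivative_det)

definition T_inv where "T_inv r = inv_into S (t r)"

lemma T_inv_t: "r \<in> {0..1} \<Longrightarrow> x \<in> S \<Longrightarrow> T_inv r (t r x) = x"
  unfolding T_inv_def by (rule inv_into_f_f[OF inj_t])

lemma cont_T_inv: "r \<in> {0..1} \<Longrightarrow> continuous_on (t r ` S) (T_inv r)"
  by (rule continuous_on_inverse_open[OF open_S cont_t]) (auto intro: T_inv_t)

text \<open>The preimage \<open>x n\<close> of \<open>y\<close> under \<open>t (r n)\<close>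
  satisfies \<open>t 0 (x n) = y - r n *\<^sub>R b (x n)\<close>. This tends to \<open>y\<close>
  because \<open>b\<close> is bounded, and then the continuity of the single inverse
  \<open>T_inv 0\<close> suffices.\<close>

lemma T_inv_tendsto:
  assumes onto: "\<And>r. r \<in> {0..1} \<Longrightarrow> t r ` S = S"
    and r: "\<And>n::nat. r n \<in> {0..1}" "r \<longlonglongrightarrow> 0" and y: "y \<in> S"
  shows "(\<lambda>n. T_inv (r n) y) \<longlonglongrightarrow> T_inv 0 y"
proof -
  define x where "x = (\<lambda>n. T_inv (r n) y)"
  have x: "x n \<in> S" "t (r n) (x n) = y" for n
    using onto[OF r(1)[of n]] y
    by (auto simp: x_def T_inv_def inv_into_into f_inv_into_f)
  have eq: "t 0 (x n) = y - r n *\<^sub>R b (x n)" for n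
    using x(2)[of n] unfolding t_def by (simp add: algebra_simps)
  have "(\<lambda>n. r n *\<^sub>R b (x n)) \<longlonglongrightarrow> 0"
  proof (rule Lim_null_comparison)
    show "\<forall>\<^sub>F n in sequentially. norm (r n *\<^sub>R b (x n)) \<le> \<bar>r n\<bar> * M"
      using b_bound[OF x(1)] by (intro always_eventually allI) (simp add: mult_left_mono)
    show "(\<lambda>n. \<bar>r n\<bar> * M) \<longlonglongrightarrow> 0" using r(2) by (auto intro!: tendsto_eq_intros)
  qed
  then have lim: "(\<lambda>n. t 0 (x n)) \<longlonglongrightarrow> y" unfolding eq using tendsto_diff[OF tendsto_const] by fastforce
  have "continuous_on S (T_inv 0)" using cont_T_inv[of 0] onto[of 0] by simp
  then have "isCont (T_inv 0) y" using open_S y by (simp add: continuous_on_eq_continuous_at)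
  from isCont_tendsto_compose[OF this lim] show ?thesis
    using T_inv_t[of 0, OF _ x(1)] by (simp add: x_def)
qed

text \<open>In the variable \<open>y = a x\<close> this is the divergence theorem for
  \<open>q\<close> times the field \<open>b \<circ> T_inv 0\<close>, with no flux through the
  boundary. Surjectivity of every \<open>t s\<close> takes the place of boundary values.\<close>

lemma continuity_equation:
  assumes onto: "\<And>r. r \<in> {0..1} \<Longrightarrow> t r ` S = S"
    and E_bound: "\<And>r x. r \<in> {0..1} \<Longrightarrow> x \<in> S \<Longrightarrow> \<bar>E r x\<bar> \<le> L"
    and q: "\<And>x. x \<in> S \<Longrightarrow> (q has_derivative (\<lambda>v. G x \<bullet> v)) (at x)"
    and Gi: "set_integrable lborel S (\<lambda>x. norm (G x))"
    and qi: "set_integrable lborel S q"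
  shows "set_integrable lborel S (\<lambda>x. (G (a x) \<bullet> b x) * det (A x) + q (a x) * det_deriv (A x) (B x))"
    and "(LINT x:S|lborel. (G (a x) \<bullet> b x) * det (A x) + q (a x) * det_deriv (A x) (B x)) = 0"
proof -
  have Gm: "set_borel_measurable borel S G" by (rule set_borel_measurable_gradient[OF open_S q])
  then have Gm'[measurable]: "(\<lambda>x. indicator S x *\<^sub>R G x) \<in> borel_measurable borel"
    by (simp add: set_borel_measurable_def)
  have qm: "set_borel_measurable borel S q" unfolding set_borel_measurable_def
    by (intro borel_measurable_continuous_on_indicator S_borel continuous_at_imp_continuous_on ballI
        has_derivative_continuous[OF q])
  then have qm'[measurable]: "(\<lambda>x. indicator S x *\<^sub>R q x) \<in> borel_measurable borel"
    by (simp add: set_borel_measurable_def)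
  define f where "f = (\<lambda>s x. q (t s x) * D s x)"
  define f' where "f' = (\<lambda>s x. (G (t s x) \<bullet> b x) * D s x + q (t s x) * E s x)"
  \<comment> \<open>\<open>\<Phi> s\<close> is the integrand \<open>f' s\<close> after the
    substitution \<open>y = t s x\<close>. Here \<open>G\<close> and \<open>q\<close> are evaluated
    at \<open>y\<close> whatever \<open>s\<close> is, so the dependence on \<open>s\<close> lies in
    continuous factors only, and \<open>W\<close> dominates all \<open>\<Phi> s\<close> at
    once.\<close>
  define \<Phi> where "\<Phi> = (\<lambda>s y. G y \<bullet> b (T_inv s y) + q y * (E s (T_inv s y) / D s (T_inv s y)))"
  define W where "W = (\<lambda>y. M * norm (G y) + \<bar>q y\<bar> * (L / c))"
  have f'_eq: "f' s x = D s x * \<Phi> s (t s x)" if "s \<in> {0..1}" "x \<in> S" for s x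
    using D_ge[OF that] c by (simp add: f'_def \<Phi>_def T_inv_t[OF that] field_simps)
  have Ti: "T_inv s y \<in> S" if "s \<in> {0..1}" "y \<in> S" for s y
    using that onto[OF that(1)] by (simp add: T_inv_def inv_into_into)
  have \<Phi>_le: "\<bar>\<Phi> s y\<bar> \<le> W y" if "s \<in> {0..1}" "y \<in> S" for s y
  proof -
    let ?x = "T_inv s y"
    have "\<bar>G y \<bullet> b ?x\<bar> \<le> norm (G y) * norm (b ?x)" by (rule Cauchy_Schwarz_ineq2)
    also have "\<dots> \<le> norm (G y) * M" using b_bound[OF Ti[OF that]] by (intro mult_left_mono) auto
    finally have 1: "\<bar>G y \<bullet> b ?x\<bar> \<le> M * norm (G y)" by (simp add: mult.commute)
    have "\<bar>E s ?x / D s ?x\<bar> = \<bar>E s ?x\<bar> / D s ?x"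
      using D_ge[OF that(1) Ti[OF that]] c by simp
    also have "\<dots> \<le> L / c"
      using D_ge[OF that(1) Ti[OF that]] c E_bound[OF that(1) Ti[OF that]]
      by (intro frac_le) auto
    finally have "\<bar>q y * (E s ?x / D s ?x)\<bar> \<le> \<bar>q y\<bar> * (L / c)"
      unfolding abs_mult by (intro mult_left_mono) auto
    then show ?thesis using 1 unfolding \<Phi>_def W_def by linarith
  qed
  have Wi: "set_integrable lborel S W" unfolding W_def
    by (intro set_integral_add set_integrable_mult_right set_integrable_mult_left Gi set_integrable_abs qi)
  have \<Phi>m: "set_borel_measurable borel S (\<Phi> s)" if s: "s \<in> {0..1}" for s
  proof -
    have ct: "continuous_on S (T_inv s)" using cont_T_inv[OF s] onto[OF s] by simp
    have cD: "continuous_on S (\<lambda>y. D s (T_inv s y))"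
      using continuous_on_compose2[OF cont_D, of S "\<lambda>y. (s, T_inv s y)"] ct
      by (simp add: continuous_on_Pair)
    have cE: "continuous_on S (\<lambda>y. E s (T_inv s y))"
      using continuous_on_compose2[OF cont_E, of S "\<lambda>y. (s, T_inv s y)"] ct
      by (simp add: continuous_on_Pair)
    have "continuous_on S (\<lambda>y. b (T_inv s y))"
      using continuous_on_compose2[OF cont_b[of UNIV] ct] by simp
    then have [measurable]: "(\<lambda>y. indicator S y *\<^sub>R b (T_inv s y)) \<in> borel_measurable borel"
      by (intro borel_measurable_continuous_on_indicator S_borel)
    have nz: "D s (T_inv s y) \<noteq> 0" if "y \<in> S" for y
      using D_ge[OF s Ti[OF s that]] c by auto
    have "continuous_on S (\<lambda>y. E s (T_inv s y) / D s (T_inv s y))"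
      using nz by (intro continuous_on_divide cE cD) auto
    then have [measurable]: "(\<lambda>y. indicator S y *\<^sub>R (E s (T_inv s y) / D s (T_inv s y))) \<in> borel_measurable borel"
      by (intro borel_measurable_continuous_on_indicator S_borel)
    have "(\<lambda>y. (indicator S y *\<^sub>R G y) \<bullet> (indicator S y *\<^sub>R b (T_inv s y)) +
        (indicator S y *\<^sub>R q y) * (indicator S y *\<^sub>R (E s (T_inv s y) / D s (T_inv s y)))) \<in> borel_measurable borel"
      by measurable
    moreover have "(\<lambda>y. (indicator S y *\<^sub>R G y) \<bullet> (indicator S y *\<^sub>R b (T_inv s y)) +
        (indicator S y *\<^sub>R q y) * (indicator S y *\<^sub>R (E s (T_inv s y) / D s (T_inv s y))))
      = (\<lambda>y. indicator S y *\<^sub>R \<Phi> s y)" by (auto simp: \<Phi>_def indicator_def fun_eq_iff)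
    ultimately show ?thesis by (simp add: set_borel_measurable_def)
  qed
  have \<Phi>i: "set_integrable lborel S (\<Phi> s)" if s: "s \<in> {0..1}" for s
  proof (rule set_integrable_bound[OF Wi])
    show "set_borel_measurable lborel S (\<Phi> s)" using \<Phi>m[OF s] by (simp add: set_borel_measurable_def)
    show "AE x in lborel. x \<in> S \<longrightarrow> norm (\<Phi> s x) \<le> norm (W x)"
      using \<Phi>_le[OF s] by (intro AE_I2 impI) (metis abs_ge_self order_trans real_norm_def)
  qed
  have cong: "indicator S x *\<^sub>R f' s x = indicator S x *\<^sub>R (D s x * \<Phi> s (t s x))" if "s \<in> {0..1}" for s x
    using f'_eq[OF that, of x] by (simp add: indicator_def)
  have f'i: "set_integrable lborel S (f' s)" if s: "s \<in> {0..1}" for s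
    using integrable_comp(2)[OF s \<Phi>m[OF s] \<Phi>i[OF s]] unfolding set_integrable_def cong[OF s] .
  have K: "(LINT x:S|lborel. f' s x) = (LINT y:S|lborel. \<Phi> s y)" if s: "s \<in> {0..1}" for s
    using change_of_variables_t(2)[OF s \<Phi>m[OF s]] unfolding set_lebesgue_integral_def cong[OF s] onto[OF s] .
  have f'b: "(LINT x:S|lborel. \<bar>f' s x\<bar>) \<le> (LINT x:S|lborel. W x)" if s: "s \<in> {0..1}" for s
  proof -
    have "indicator S x *\<^sub>R \<bar>f' s x\<bar> = indicator S x *\<^sub>R (D s x * \<bar>\<Phi> s (t s x)\<bar>)" for x
      using f'_eq[OF s, of x] D_ge[OF s, of x] c by (auto simp: indicator_def abs_mult)
    then have "(LINT x:S|lborel. \<bar>f' s x\<bar>) = (LINT x:S|lborel. D s x * \<bar>\<Phi> s (t s x)\<bar>)"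
      by (simp only: set_lebesgue_integral_def)
    also have "\<dots> \<le> (LINT x:S|lborel. \<bar>\<Phi> s x\<bar>)" by (rule integrable_comp(4)[OF s \<Phi>m[OF s] \<Phi>i[OF s]])
    also have "\<dots> \<le> (LINT x:S|lborel. W x)"
      using \<Phi>_le[OF s] by (intro set_integral_mono set_integrable_abs \<Phi>i s Wi)
    finally show ?thesis .
  qed
  have f'm: "(\<lambda>(s, x). indicator {0..1} s * (indicator S x * f' s x)) \<in> borel_measurable (borel \<Otimes>\<^sub>M borel)"
  proof -
    have [measurable]: "(\<lambda>(r, x). D r x) \<in> borel_measurable (borel \<Otimes>\<^sub>M borel)"
      "(\<lambda>(r, x). E r x) \<in> borel_measurable (borel \<Otimes>\<^sub>M borel)"
      unfolding borel_prod using cont_D cont_E by (auto intro: borel_measurable_continuous_onI)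
    note measurable_gradient_along[OF Gm, measurable] measurable_along[OF qm, measurable]
    have "(\<lambda>p. (\<lambda>(s, x). indicator {0..1} s * (indicator S x * (G (t s x) \<bullet> b x))) p * (\<lambda>(r, x). D r x) p
       + (\<lambda>(s, x). (indicator {0..1} s * indicator S x :: real) *\<^sub>R q (t s x)) p * (\<lambda>(r, x). E r x) p)
      \<in> borel_measurable (borel \<Otimes>\<^sub>M borel)" by measurable
    then show ?thesis by (simp add: f'_def case_prod_unfold algebra_simps)
  qed
  have der: "((\<lambda>s. f s x) has_real_derivative f' s x) (at s within {0..1})"
    if "x \<in> S" "s \<in> {0..1}" for s x
    unfolding f_def f'_def
    using DERIV_mult[OF der_comp_t[OF q that(2,1)] der_D] by (simp add: algebra_simps)
  have fm: "set_borel_measurable borel S (f s)" if s: "s \<in> {0..1}" for s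
  proof -
    have [measurable]: "(\<lambda>x. indicator S x *\<^sub>R q (t s x)) \<in> borel_measurable borel"
      using comp_measurable[OF s qm] by (simp add: set_borel_measurable_def)
    have "(\<lambda>x. (indicator S x *\<^sub>R q (t s x)) * D s x) \<in> borel_measurable borel" by measurable
    then show ?thesis by (simp add: set_borel_measurable_def f_def mult.assoc)
  qed
  note fubini = Fubini_FTC[OF S_borel f'm f'i f'b der fm]
  define k where "k = (\<lambda>s. LINT x:S|lborel. f' s x)"
  have ki: "set_integrable lborel {0..1} k" unfolding k_def by (rule fubini(2)[of 0]) auto
  have f_int: "set_integrable lborel S (f s)" "(LINT x:S|lborel. f s x) = (LINT y:S|lborel. q y)"
    if s: "s \<in> {0..1}" for s
    using integrable_comp(2)[OF s qm qi] change_of_variables_t(2)[OF s qm]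
    unfolding f_def onto[OF s] by (simp_all add: mult.commute)
  \<comment> \<open>The integral of \<open>f s\<close> does not depend on \<open>s\<close>, so every
    integral of \<open>k\<close> starting at 0 vanishes.\<close>
  have k0: "integral {0..R} k = 0" if R: "R \<in> {0..1}" for R
  proof -
    have "set_integrable lborel {0..R} k"
      using R by (intro set_integrable_subset[OF ki]) auto
    then have "integral {0..R} k = (LINT s:{0..R}|lborel. k s)"
      by (simp add: set_borel_integral_eq_integral(2))
    also have "\<dots> = (LINT x:S|lborel. f R x - f 0 x)"
      unfolding k_def by (rule fubini(3)[symmetric]) (use R in auto)
    also have "\<dots> = 0"
      using f_int[OF R] f_int[of 0] by (simp add: set_integral_diff)
    finally show ?thesis .
  qed
  \<comment> \<open>Vanishing of these integrals determines \<open>k\<close> only almost everywhere;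
    continuity at 0 is what pins down \<open>k 0\<close>.\<close>
  have "continuous (at 0 within {0..1}) k"
    unfolding continuous_within_sequentially
  proof (intro allI impI, elim conjE)
    fix r :: "nat \<Rightarrow> real" assume r: "\<forall>n. r n \<in> {0..1}" "r \<longlonglongrightarrow> 0"
    have lim: "(\<lambda>n. \<Phi> (r n) y) \<longlonglongrightarrow> \<Phi> 0 y" if y: "y \<in> S" for y
    proof -
      note x = T_inv_tendsto[OF onto r(1)[rule_format] r(2) y]
      have p: "(\<lambda>n. (r n, T_inv (r n) y)) \<longlonglongrightarrow> (0, T_inv 0 y)" by (intro tendsto_Pair r x)
      have "(\<lambda>n. D (r n) (T_inv (r n) y)) \<longlonglongrightarrow> D 0 (T_inv 0 y)"
        using continuous_on_tendsto_compose[OF cont_D p] by simp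
      moreover have "(\<lambda>n. E (r n) (T_inv (r n) y)) \<longlonglongrightarrow> E 0 (T_inv 0 y)"
        using continuous_on_tendsto_compose[OF cont_E p] by simp
      moreover have "(\<lambda>n. b (T_inv (r n) y)) \<longlonglongrightarrow> b (T_inv 0 y)"
        using continuous_on_tendsto_compose[OF cont_b[of UNIV] x] by simp
      moreover have "D 0 (T_inv 0 y) \<noteq> 0" using D_ge[of 0, OF _ Ti[of 0, OF _ y]] c by auto
      ultimately show ?thesis unfolding \<Phi>_def by (intro tendsto_intros)
    qed
    have "(\<lambda>n. LINT y|lborel. indicator S y *\<^sub>R \<Phi> (r n) y) \<longlonglongrightarrow> (LINT y|lborel. indicator S y *\<^sub>R \<Phi> 0 y)"
    proof (rule integral_dominated_convergence[where w = "\<lambda>y. indicator S y *\<^sub>R W y"])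
      show "(\<lambda>y. indicator S y *\<^sub>R \<Phi> 0 y) \<in> borel_measurable lborel"
        using \<Phi>m[of 0] by (simp add: set_borel_measurable_def)
      show "(\<lambda>y. indicator S y *\<^sub>R \<Phi> (r n) y) \<in> borel_measurable lborel" for n
        using \<Phi>m[of "r n"] r(1) by (simp add: set_borel_measurable_def)
      show "integrable lborel (\<lambda>y. indicator S y *\<^sub>R W y)" using Wi by (simp add: set_integrable_def)
      show "AE y in lborel. (\<lambda>n. indicator S y *\<^sub>R \<Phi> (r n) y) \<longlonglongrightarrow> indicator S y *\<^sub>R \<Phi> 0 y"
        using lim by (auto simp: indicator_def)
      show "AE y in lborel. norm (indicator S y *\<^sub>R \<Phi> (r n) y) \<le> indicator S y *\<^sub>R W y" for n
        using \<Phi>_le[OF r(1)[rule_format, of n]] by (auto simp: indicator_def)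
    qed
    then have "(\<lambda>n. k (r n)) \<longlonglongrightarrow> k 0"
      using K r(1) by (simp add: k_def set_lebesgue_integral_def)
    then show "(k \<circ> r) \<longlonglongrightarrow> k 0" by (simp add: o_def)
  qed
  moreover have "k integrable_on {0..1}" using set_borel_integral_eq_integral(1)[OF ki] .
  \<comment> \<open>The primitive of \<open>k\<close> has derivative \<open>k 0\<close> at 0 by
    continuity, and derivative 0 because it vanishes on \<open>{0..1}\<close>.\<close>
  ultimately have "((\<lambda>u. integral {0..u} k) has_vector_derivative k 0) (at 0 within {0..1})"
    using integral_has_vector_derivative_continuous_at[of k 0 1 0 "{}"] by simp
  moreover have "((\<lambda>u. integral {0..u} k) has_vector_derivative 0) (at 0 within {0..1})"
    by (rule has_vector_derivative_transform[OF _ k0 has_vector_derivative_const]) auto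
  ultimately have "k 0 = 0"
    by (rule vector_derivative_unique_within[rotated]) (simp add: trivial_limit_within)
  moreover have "k 0 = (LINT x:S|lborel. (G (a x) \<bullet> b x) * det (A x) + q (a x) * det_deriv (A x) (B x))"
    by (simp add: k_def f'_def t_def D_def E_def)
  ultimately show "(LINT x:S|lborel. (G (a x) \<bullet> b x) * det (A x) + q (a x) * det_deriv (A x) (B x)) = 0"
    by simp
  show "set_integrable lborel S (\<lambda>x. (G (a x) \<bullet> b x) * det (A x) + q (a x) * det_deriv (A x) (B x))"
    using f'i[of 0] by (simp add: f'_def t_def D_def E_def)
qed

end

subsection \<open>Integrability on the cube\<close>

lemma mat_mult_vec: "mat k *v x = k *\<^sub>R (x :: real^'n)"
  by (simp add: matrix_vector_mult_def mat_def vec_eq_iff if_distrib[of "\<lambda>c. c * _"] cong: if_cong)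

lemma det_mat: "det (mat k :: real^'n^'n) = k ^ CARD('n)"
  by (subst det_diagonal) (simp_all add: mat_def)

lemma open_Omega: "open Omega" and convex_Omega: "convex Omega"
  and compact_Omega_bar: "compact Omega_bar" and Omega_subset: "Omega \<subseteq> Omega_bar"
  by (auto simp: Omega_def Omega_bar_def box_subset_cbox intro: open_box convex_box)

lemma mem_Omega: "x \<in> Omega \<longleftrightarrow> (\<forall>i. 0 < x $ i \<and> x $ i < 1)"
  by (simp add: Omega_def mem_box_cart)

lemma mem_Omega_bar: "x \<in> Omega_bar \<longleftrightarrow> (\<forall>i. 0 \<le> x $ i \<and> x $ i \<le> 1)"
  by (simp add: Omega_bar_def mem_box_cart)

lemma set_integrable_bounded_Omega:
  fixes f :: "real^'n \<Rightarrow> 'b::{banach, second_countable_topology}"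
  assumes "set_borel_measurable borel Omega f" "\<And>x. x \<in> Omega \<Longrightarrow> norm (f x) \<le> C"
  shows "set_integrable lborel Omega f"
proof (rule set_integrable_bound[of _ _ "\<lambda>_. C"])
  show "set_integrable lborel (Omega :: (real^'n) set) (\<lambda>_. C)"
    unfolding set_integrable_def Omega_def
    using emeasure_lborel_box_finite[of "0 :: real^'n" 1]
    by (intro integrable_scaleR_left integrable_real_indicator) simp_all
  show "set_borel_measurable lborel Omega f" using assms(1) by (simp add: set_borel_measurable_def)
  show "AE x in lborel. x \<in> Omega \<longrightarrow> norm (f x) \<le> norm C"
    using assms(2) by (intro AE_I2 impI) (metis abs_ge_self order_trans real_norm_def)
qed

text \<open>The displacement from the half-size copy of the cube around its centre, on which \<open>q\<close> is
  bounded, to the whole cube makes boundary regularity of \<open>q\<close> unnecessary.\<close>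

lemma gradient_integrable_imp_integrable_Omega:
  fixes q :: "real^'n \<Rightarrow> real"
  assumes q: "\<And>x. x \<in> Omega \<Longrightarrow> (q has_derivative (\<lambda>v. G x \<bullet> v)) (at x)"
    and Gi: "set_integrable lborel Omega (\<lambda>x. norm (G x))"
  shows "set_integrable lborel Omega q"
proof -
  define z :: "real^'n" where "z = vec (1 / 2)"
  define a where "a = (\<lambda>x. z + (1 / 2) *\<^sub>R (x - z))"
  define b where "b = (\<lambda>x. (1 / 2) *\<^sub>R (x - z))"
  \<comment> \<open>The displacement is the dilation by \<open>(1 + r) / 2\<close> about the centre
    \<open>z\<close>: the identity at \<open>r = 1\<close>, and a map into the compact cube
    \<open>Q\<close> at \<open>r = 0\<close>.\<close>
  have comp: "(a x + r *\<^sub>R b x) $ i = 1 / 2 + (1 + r) / 2 * (x $ i - 1 / 2)" for x r i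
    by (simp add: a_def b_def z_def field_simps)
  have mat: "mat (1 / 2) + r *\<^sub>R mat (1 / 2) = (mat ((1 + r) / 2) :: real^'n^'n)" for r
    by (simp add: mat_def vec_eq_iff field_simps)
  interpret displacement Omega a b "\<lambda>_. mat (1 / 2)" "\<lambda>_. mat (1 / 2)" "norm (vec 1 :: real^'n)" "(1 / 2) ^ CARD('n)"
  proof
    show "(a has_derivative (*v) (mat (1 / 2))) (at x)" for x
      unfolding a_def mat_mult_vec[abs_def] by (auto intro!: derivative_eq_intros)
    show "(b has_derivative (*v) (mat (1 / 2))) (at x)" for x
      unfolding b_def mat_mult_vec[abs_def] by (auto intro!: derivative_eq_intros)
    show "norm (b x) \<le> norm (vec 1 :: real^'n)" if "x \<in> Omega" for x
    proof (rule norm_le_componentwise_cart)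
      fix i
      show "norm (b x $ i) \<le> norm (vec 1 $ i :: real)"
        using that[unfolded mem_Omega, rule_format, of i] by (simp add: b_def z_def abs_le_iff)
    qed
    show "(1 / 2) ^ CARD('n) \<le> det (mat (1 / 2) + r *\<^sub>R mat (1 / 2) :: real^'n^'n)" if "r \<in> {0..1}" for r :: real
      unfolding mat det_mat using that by (intro power_mono) auto
    show "inj_on (\<lambda>x. a x + r *\<^sub>R b x) Omega" if "r \<in> {0..1}" for r
      using that by (intro inj_onI) (auto simp: vec_eq_iff comp simp del: vector_add_component vector_scaleR_component)
    show "a x + r *\<^sub>R b x \<in> Omega" if "r \<in> {0..1}" "x \<in> Omega" for r x
      unfolding mem_Omega comp
    proof
      fix i
      define s where "s = (1 + r) / 2"
      have s: "0 < s" "s \<le> 1" using that(1) by (auto simp: s_def)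
      have x: "\<bar>x $ i - 1 / 2\<bar> < 1 / 2" using that(2)[unfolded mem_Omega, rule_format, of i] by linarith
      have "\<bar>s * (x $ i - 1 / 2)\<bar> \<le> 1 * \<bar>x $ i - 1 / 2\<bar>"
        unfolding abs_mult using s by (intro mult_right_mono) auto
      then have "\<bar>s * (x $ i - 1 / 2)\<bar> < 1 / 2" using x by simp
      then show "0 < 1 / 2 + (1 + r) / 2 * (x $ i - 1 / 2) \<and> 1 / 2 + (1 + r) / 2 * (x $ i - 1 / 2) < 1"
        unfolding s_def[symmetric] abs_less_iff by (intro conjI) linarith+
    qed
  qed (auto simp: open_Omega)
  have qc: "continuous_on Omega q"
    by (intro continuous_at_imp_continuous_on ballI has_derivative_continuous[OF q])
  then have qm: "set_borel_measurable borel Omega q" unfolding set_borel_measurable_def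
    by (intro borel_measurable_continuous_on_indicator S_borel)
  have t1: "t 1 x = x" for x
    unfolding t_def using comp[of x 1] by (simp add: vec_eq_iff del: vector_add_component vector_scaleR_component)
  have 1: "set_integrable lborel Omega (\<lambda>x. q (t 1 x) - q (t 0 x))"
    by (rule displacement_difference_integrable[OF q Gi])
  define Q where "Q = cbox (vec (1 / 4)) (vec (3 / 4) :: real^'n)"
  have "Q \<subseteq> Omega"
  proof
    fix x assume "x \<in> Q"
    then have Q: "1 / 4 \<le> x $ i" "x $ i \<le> 3 / 4" for i by (simp_all add: Q_def mem_box_cart)
    have "0 < x $ i \<and> x $ i < 1" for i using Q[of i] by (intro conjI) linarith+
    then show "x \<in> Omega" by (simp add: mem_Omega)
  qed
  then have "compact (q ` Q)" using qc by (intro compact_continuous_image) (auto simp: Q_def intro: continuous_on_subset)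
  then obtain C where C: "\<And>y. y \<in> Q \<Longrightarrow> norm (q y) \<le> C" by (meson bounded_iff compact_imp_bounded imageI)
  have "t 0 x \<in> Q" if "x \<in> Omega" for x
    using that unfolding t_def by (auto simp: a_def z_def Q_def mem_box_cart mem_Omega less_imp_le field_simps)
  then have 0: "set_integrable lborel Omega (\<lambda>x. q (t 0 x))"
    using C by (intro set_integrable_bounded_Omega comp_measurable qm) auto
  show ?thesis using set_integral_add(1)[OF 1 0] by (simp add: t1)
qed

subsection \<open>Cosine ansatz functions\<close>

text \<open>Products of functions of one coordinate: differentiation in coordinate \<open>i\<close>
  replaces the factor \<open>i\<close>, so function update describes all partial
  derivatives.\<close>

definition tensor :: "('n \<Rightarrow> real \<Rightarrow> real) \<Rightarrow> real^'n \<Rightarrow> real" where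
  "tensor f x = (\<Prod>i\<in>UNIV. f i (x $ i))"

lemma tensor_upd: "tensor (f(i := g)) x = g (x $ i) * (\<Prod>j\<in>UNIV - {i}. f j (x $ j))"
  unfolding tensor_def by (subst prod.remove[of UNIV i]) (auto intro!: prod.cong)

lemma has_derivative_tensor:
  assumes "\<And>i s. (f i has_real_derivative f' i s) (at s)"
  shows "(tensor f has_derivative (\<lambda>v. (\<chi> i. tensor (f(i := f' i)) x) \<bullet> v)) (at x)"
proof -
  have "((\<lambda>x. f i (x $ i)) has_derivative (\<lambda>v. f' i (x $ i) * v $ i)) (at x)" for i
    by (rule has_derivative_compose[OF bounded_linear_imp_has_derivative[OF bounded_linear_vec_nth]
        assms[unfolded has_field_derivative_def]])
  then have "((\<lambda>x. \<Prod>i\<in>UNIV. f i (x $ i)) has_derivative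
      (\<lambda>v. \<Sum>i\<in>UNIV. (f' i (x $ i) * v $ i) * (\<Prod>j\<in>UNIV - {i}. f j (x $ j)))) (at x)"
    by (rule has_derivative_prod)
  then show ?thesis unfolding tensor_def[symmetric]
    by (rule has_derivative_eq_rhs) (simp add: inner_vec_def tensor_upd fun_eq_iff ac_simps)
qed

lemma continuous_on_tensor:
  assumes "\<And>i. continuous_on UNIV (f i)"
  shows "continuous_on UNIV (tensor f)"
  unfolding tensor_def
  by (intro continuous_on_prod continuous_on_compose2[OF assms] continuous_intros) auto

text \<open>The last clause is the homogeneous Neumann condition on the faces of the cube, imposed
  on their full hyperplanes. Carrying gradient and Hessian as witnesses makes the notion visibly
  closed under linear combinations.\<close>

definition neumann_potential ::
  "(real^'n \<Rightarrow> real) \<Rightarrow> (real^'n \<Rightarrow> real^'n) \<Rightarrow> (real^'n \<Rightarrow> real^'n^'n) \<Rightarrow> bool" where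
  "neumann_potential f g H \<longleftrightarrow> (\<forall>x. (f has_derivative (\<lambda>v. g x \<bullet> v)) (at x)) \<and>
     (\<forall>x. (g has_derivative (*v) (H x)) (at x)) \<and> continuous_on UNIV H \<and>
     (\<forall>x. transpose (H x) = H x) \<and> (\<forall>x i. x $ i = 0 \<or> x $ i = 1 \<longrightarrow> g x $ i = 0)"

lemma neumann_potential_zero: "neumann_potential (\<lambda>x. 0) (\<lambda>x. 0) (\<lambda>x. 0)"
  unfolding neumann_potential_def
  by (auto simp: transpose_def vec_eq_iff matrix_vector_mult_def intro!: derivative_eq_intros)

lemma neumann_potential_add:
  assumes "neumann_potential f g H" "neumann_potential f' g' H'"
  shows "neumann_potential (\<lambda>x. f x + f' x) (\<lambda>x. g x + g' x) (\<lambda>x. H x + H' x)"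
  unfolding neumann_potential_def
proof (intro conjI allI impI)
  fix x
  show "((\<lambda>x. f x + f' x) has_derivative (\<lambda>v. (g x + g' x) \<bullet> v)) (at x)"
    using assms unfolding neumann_potential_def inner_add_left by (intro has_derivative_add) auto
  show "((\<lambda>x. g x + g' x) has_derivative (*v) (H x + H' x)) (at x)"
    using assms unfolding neumann_potential_def matrix_vector_mult_add_rdistrib[abs_def]
    by (intro has_derivative_add) auto
  show "transpose (H x + H' x) = H x + H' x"
    using assms unfolding neumann_potential_def by (auto simp: transpose_def vec_eq_iff)
  show "(g x + g' x) $ i = 0" if "x $ i = 0 \<or> x $ i = 1" for i
    using assms that unfolding neumann_potential_def by auto
qed (use assms in \<open>auto simp: neumann_potential_def intro: continuous_on_add\<close>)

lemma neumann_potential_scale: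
  assumes "neumann_potential f g H"
  shows "neumann_potential (\<lambda>x. c * f x) (\<lambda>x. c *\<^sub>R g x) (\<lambda>x. c *\<^sub>R H x)"
  unfolding neumann_potential_def
proof (intro conjI allI impI)
  fix x
  show "((\<lambda>x. c * f x) has_derivative (\<lambda>v. (c *\<^sub>R g x) \<bullet> v)) (at x)"
    using assms unfolding neumann_potential_def inner_scaleR_left
    by (intro has_derivative_mult_right) auto
  show "((\<lambda>x. c *\<^sub>R g x) has_derivative (*v) (c *\<^sub>R H x)) (at x)"
    using assms unfolding neumann_potential_def scaleR_matrix_vector_assoc[symmetric]
    by (intro has_derivative_scaleR_right) auto
  show "transpose (c *\<^sub>R H x) = c *\<^sub>R H x"
    using assms unfolding neumann_potential_def by (auto simp: transpose_def vec_eq_iff)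
  show "(c *\<^sub>R g x) $ i = 0" if "x $ i = 0 \<or> x $ i = 1" for i
    using assms that unfolding neumann_potential_def by auto
qed (use assms in \<open>auto simp: neumann_potential_def intro: continuous_on_scaleR\<close>)

lemma neumann_potential_cos_basis:
  fixes k :: "nat^'n"
  shows "\<exists>g H. neumann_potential (cos_basis k) g H"
proof -
  define C where "C = 2 powr (real CARD('n) / 2) / (pi * norm ((\<chi> i. real (k $ i)) :: real^'n))"
  define \<kappa> where "\<kappa> i = real (k $ i) * pi" for i
  define F where "F = (\<lambda>i s. cos (\<kappa> i * s))"
  define F' where "F' = (\<lambda>i s. - \<kappa> i * sin (\<kappa> i * s))"
  define F'' where "F'' = (\<lambda>i s. - (\<kappa> i)\<^sup>2 * cos (\<kappa> i * s))"
  have dF: "(F i has_real_derivative F' i s) (at s)" for i s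
    unfolding F_def F'_def by (auto intro!: derivative_eq_intros)
  have dF': "(F' i has_real_derivative F'' i s) (at s)" for i s
    unfolding F''_def F'_def by (auto intro!: derivative_eq_intros simp: power2_eq_square)
  define g where "g = (\<lambda>x. \<chi> i. tensor (F(i := F' i)) x)"
  \<comment> \<open>Row \<open>i\<close> is the gradient of component \<open>i\<close> of
    \<open>g\<close>. The inner update yields \<open>F''\<close> in the factor \<open>i\<close> when
    \<open>j = i\<close>, and first derivatives in both factors otherwise, without a case
    distinction.\<close>
  define H where "H = (\<lambda>x. \<chi> i j. tensor ((F(i := F' i))(j := (F'(i := F'' i)) j)) x)"
  have "neumann_potential (tensor F) g H"
    unfolding neumann_potential_def
  proof (intro conjI allI impI)
    fix x
    show "(tensor F has_derivative (\<lambda>v. g x \<bullet> v)) (at x)"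
      unfolding g_def by (rule has_derivative_tensor) (rule dF)
    have "((\<lambda>x. g x $ i) has_derivative (\<lambda>v. H x $ i \<bullet> v)) (at x)" for i
    proof -
      have "((F(i := F' i)) j has_real_derivative (F'(i := F'' i)) j s) (at s)" for j s
        using dF dF' by simp
      from has_derivative_tensor[of "F(i := F' i)" "F'(i := F'' i)", OF this]
      show ?thesis by (simp add: g_def H_def)
    qed
    then have "(g has_derivative (\<lambda>v. \<chi> i. H x $ i \<bullet> v)) (at x)"
      by (subst has_derivative_componentwise_within) (auto simp: Basis_vec_def inner_axis)
    then show "(g has_derivative (*v) (H x)) (at x)"
      by (rule has_derivative_eq_rhs) (simp add: fun_eq_iff vec_eq_iff matrix_vector_mul_component)
    show "transpose (H x) = H x"
    proof -
      have "H x $ j $ i = H x $ i $ j" for i j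
        by (cases "i = j") (simp_all add: H_def fun_upd_twist)
      then show ?thesis by (simp add: transpose_def vec_eq_iff)
    qed
    \<comment> \<open>The differentiated factor is a sine with a frequency that is an integer
      multiple of \<pi>, so it vanishes at 0 and 1.\<close>
    show "g x $ i = 0" if "x $ i = 0 \<or> x $ i = 1" for i
      using that by (auto simp: g_def tensor_upd F'_def \<kappa>_def)
  next
    show "continuous_on UNIV H" unfolding H_def
    proof (intro continuous_on_vec_lambda continuous_on_tensor)
      fix i j l
      have "continuous_on UNIV (F l)" "continuous_on UNIV (F' l)" "continuous_on UNIV (F'' l)" for l
        unfolding F_def F'_def F''_def by (intro continuous_intros)+
      then show "continuous_on UNIV (((F(i := F' i))(j := (F'(i := F'' i)) j)) l)"
        by (simp add: fun_upd_apply)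
    qed
  qed
  from neumann_potential_scale[OF this, of C] have "neumann_potential (cos_basis k) (\<lambda>x. C *\<^sub>R g x) (\<lambda>x. C *\<^sub>R H x)"
    by (simp add: cos_basis_def[abs_def] tensor_def F_def \<kappa>_def C_def)
  then show ?thesis by blast
qed

lemma TX_neumann_potential:
  assumes "\<psi> \<in> TX K"
  obtains g H where "neumann_potential \<psi> g H"
proof -
  obtain c where \<psi>: "\<psi> = (\<lambda>x. \<Sum>k\<in>index_set K. c k * cos_basis k x)" using assms by (auto simp: TX_def)
  have "\<exists>g H. neumann_potential (\<lambda>x. \<Sum>k\<in>I. c k * cos_basis k x) g H" for I
  proof (induction I rule: infinite_finite_induct)
    case (insert k I)
    then obtain g H g' H' where "neumann_potential (\<lambda>x. \<Sum>k\<in>I. c k * cos_basis k x) g H"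
      "neumann_potential (cos_basis k) g' H'"
      using neumann_potential_cos_basis by blast
    from neumann_potential_add[OF neumann_potential_scale[OF this(2), of "c k"] this(1)]
    show ?case using insert(1,2) by auto
  qed (auto intro: neumann_potential_zero)
  then show thesis using that unfolding \<psi> by blast
qed

lemma TX_diff: "\<psi> \<in> TX K \<Longrightarrow> \<psi>' \<in> TX K \<Longrightarrow> (\<lambda>x. \<psi> x - \<psi>' x) \<in> TX K"
proof -
  assume "\<psi> \<in> TX K" "\<psi>' \<in> TX K"
  then obtain c c' where "\<psi> = (\<lambda>x. \<Sum>k\<in>index_set K. c k * cos_basis k x)"
    "\<psi>' = (\<lambda>x. \<Sum>k\<in>index_set K. c' k * cos_basis k x)" by (auto simp: TX_def)
  then have "(\<lambda>x. \<psi> x - \<psi>' x) = (\<lambda>x. \<Sum>k\<in>index_set K. (c k - c' k) * cos_basis k x)"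
    by (simp add: sum_subtractf[symmetric] left_diff_distrib)
  then show ?thesis unfolding TX_def mem_Collect_eq by (rule exI[where x = "\<lambda>k. c k - c' k"])
qed

lemma grad_eqI: "(f has_derivative (\<lambda>v. g \<bullet> v)) (at x) \<Longrightarrow> grad f x = g"
  unfolding grad_def
proof (rule the_equality)
  assume g: "(f has_derivative (\<lambda>v. g \<bullet> v)) (at x)"
  then show "GDERIV f x :> g" by (simp add: gderiv_def inner_commute)
  fix D assume "GDERIV f x :> D"
  then have "(f has_derivative (\<lambda>v. D \<bullet> v)) (at x)" by (simp add: gderiv_def inner_commute)
  from has_derivative_unique[OF this g] show "D = g" by (metis vector_eq_rdot)
qed

lemma has_derivative_qfun: "(qfun has_derivative (\<lambda>v. x \<bullet> v)) (at x)"
  unfolding qfun_def[abs_def] power2_norm_eq_inner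
  by (auto intro!: derivative_eq_intros simp: inner_commute)

subsection \<open>Gradients of convex ansatz functions\<close>

text \<open>The mean value theorem along the segment, tested with its own direction. It serves the
  injectivity of the transport maps as well as the monotonicity, with modulus \<open>lam\<close>, of
  the gradient of the potential.\<close>

lemma derivative_mean_value_inner:
  fixes t :: "real^'n \<Rightarrow> real^'n"
  assumes S: "convex S" and der: "\<And>x. x \<in> S \<Longrightarrow> (t has_derivative (*v) (A x)) (at x)"
    and xy: "x \<in> S" "y \<in> S"
  obtains z where "z \<in> S" "(t y - t x) \<bullet> (y - x) = (y - x) \<bullet> (A z *v (y - x))"
proof -
  define v where "v = y - x"
  have seg: "x + s *\<^sub>R v \<in> S" if "0 \<le> s" "s \<le> 1" for s
    using convexD[OF S xy(1,2), of "1 - s" s] that by (simp add: v_def algebra_simps)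
  have d: "((\<lambda>s. t (x + s *\<^sub>R v) \<bullet> v) has_real_derivative (A (x + s *\<^sub>R v) *v v) \<bullet> v) (at s)"
    if "0 \<le> s" "s \<le> 1" for s
  proof -
    have "((\<lambda>s. x + s *\<^sub>R v) has_derivative (\<lambda>r. r *\<^sub>R v)) (at s)" by (auto intro!: derivative_eq_intros)
    from has_derivative_inner_left[OF has_derivative_compose[OF this der[OF seg[OF that]]], of v]
    show ?thesis unfolding has_field_derivative_def
      by (rule has_derivative_eq_rhs) (simp add: fun_eq_iff matrix_vector_mult_scaleR)
  qed
  obtain s where s: "0 < s" "s < 1"
    "t (x + 1 *\<^sub>R v) \<bullet> v - t (x + 0 *\<^sub>R v) \<bullet> v = (1 - 0) * ((A (x + s *\<^sub>R v) *v v) \<bullet> v)"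
    using MVT2[of 0 1 "\<lambda>s. t (x + s *\<^sub>R v) \<bullet> v" "\<lambda>s. (A (x + s *\<^sub>R v) *v v) \<bullet> v"] d by auto
  have "(t y - t x) \<bullet> v = v \<bullet> (A (x + s *\<^sub>R v) *v v)"
  proof -
    have "(t y - t x) \<bullet> v = t (x + 1 *\<^sub>R v) \<bullet> v - t (x + 0 *\<^sub>R v) \<bullet> v"
      by (simp add: v_def inner_diff_left)
    then show ?thesis unfolding s(3) by (simp only: inner_commute[of v]) simp
  qed
  then show thesis using that[OF seg[of s]] s(1,2) by (simp add: v_def)
qed

text \<open>The tangent inequalities at the two points add up to the claim. Each is a limit of
  slopes along the segment, which convexity bounds by the total increment.\<close>

lemma convex_on_gradient_monotone:
  fixes f :: "real^'n \<Rightarrow> real"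
  assumes cv: "convex_on S f" and S: "open S"
    and der: "\<And>x. x \<in> S \<Longrightarrow> (f has_derivative (\<lambda>v. t x \<bullet> v)) (at x)"
    and xy: "x \<in> S" "y \<in> S"
  shows "(t y - t x) \<bullet> (y - x) \<ge> 0"
proof -
  have above: "f y - f x \<ge> t x \<bullet> (y - x)" if xy: "x \<in> S" "y \<in> S" for x y
  proof -
    define v where "v = y - x"
    have "((\<lambda>s. x + s *\<^sub>R v) has_derivative (\<lambda>r. r *\<^sub>R v)) (at 0)" by (auto intro!: derivative_eq_intros)
    moreover have "(f has_derivative (\<lambda>v. t x \<bullet> v)) (at (x + 0 *\<^sub>R v))" using der xy by simp
    ultimately have "((\<lambda>s. f (x + s *\<^sub>R v)) has_derivative (\<lambda>r. t x \<bullet> (r *\<^sub>R v))) (at 0)"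
      by (rule has_derivative_compose)
    then have "((\<lambda>s. f (x + s *\<^sub>R v)) has_real_derivative t x \<bullet> v) (at 0)"
      unfolding has_field_derivative_def by (rule has_derivative_eq_rhs) (simp add: fun_eq_iff)
    then have "((\<lambda>s. (f (x + s *\<^sub>R v) - f x) / s) \<longlongrightarrow> t x \<bullet> v) (at 0)"
      by (simp add: has_field_derivative_iff)
    then have lim: "((\<lambda>s. (f (x + s *\<^sub>R v) - f x) / s) \<longlongrightarrow> t x \<bullet> v) (at_right 0)"
      by (rule tendsto_mono[rotated]) (simp add: at_le)
    have "\<forall>\<^sub>F s in at_right 0. (f (x + s *\<^sub>R v) - f x) / s \<le> f y - f x"
      unfolding eventually_at_right_field
    proof (intro exI[of _ 1] conjI allI impI)
      fix s :: real assume s: "0 < s" "s < 1"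
      have "f ((1 - s) *\<^sub>R x + s *\<^sub>R y) \<le> (1 - s) * f x + s * f y"
        using convex_onD[OF cv, of s x y] s xy by simp
      moreover have "(1 - s) *\<^sub>R x + s *\<^sub>R y = x + s *\<^sub>R v" by (simp add: v_def algebra_simps)
      ultimately have "f (x + s *\<^sub>R v) - f x \<le> s * (f y - f x)" by (simp add: algebra_simps)
      then show "(f (x + s *\<^sub>R v) - f x) / s \<le> f y - f x" using s by (simp add: field_simps)
    qed simp
    from tendsto_upperbound[OF lim this] show ?thesis by (simp add: v_def)
  qed
  have "f y - f x \<ge> t x \<bullet> (y - x)" "f x - f y \<ge> t y \<bullet> (x - y)" using above xy by auto
  then show ?thesis by (simp add: inner_diff_left inner_diff_right)
qed

text \<open>The quadratic form is a limit of difference quotients of the monotone gradient.\<close>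

lemma convex_on_hessian_nonneg:
  fixes f :: "real^'n \<Rightarrow> real"
  assumes cv: "convex_on S f" and S: "open S"
    and der: "\<And>x. x \<in> S \<Longrightarrow> (f has_derivative (\<lambda>v. t x \<bullet> v)) (at x)"
    and x: "x \<in> S" and der2: "(t has_derivative (*v) A) (at x)"
  shows "v \<bullet> (A *v v) \<ge> 0"
proof -
  have "((\<lambda>s. x + s *\<^sub>R v) has_derivative (\<lambda>r. r *\<^sub>R v)) (at 0)" by (auto intro!: derivative_eq_intros)
  moreover have "(t has_derivative (*v) A) (at (x + 0 *\<^sub>R v))" using der2 by simp
  ultimately have "((\<lambda>s. t (x + s *\<^sub>R v)) has_derivative (\<lambda>r. A *v (r *\<^sub>R v))) (at 0)"
    by (rule has_derivative_compose)
  from has_derivative_inner_left[OF this, of v]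
  have "((\<lambda>s. t (x + s *\<^sub>R v) \<bullet> v) has_real_derivative (A *v v) \<bullet> v) (at 0)"
    unfolding has_field_derivative_def
    by (rule has_derivative_eq_rhs) (simp add: fun_eq_iff matrix_vector_mult_scaleR)
  then have "((\<lambda>s. (t (x + s *\<^sub>R v) \<bullet> v - t x \<bullet> v) / s) \<longlongrightarrow> (A *v v) \<bullet> v) (at 0)"
    by (simp add: has_field_derivative_iff)
  then have lim: "((\<lambda>s. (t (x + s *\<^sub>R v) \<bullet> v - t x \<bullet> v) / s) \<longlongrightarrow> (A *v v) \<bullet> v) (at_right 0)"
    by (rule tendsto_mono[rotated]) (simp add: at_le)
  have "((\<lambda>s. x + s *\<^sub>R v) \<longlongrightarrow> x + 0 *\<^sub>R v) (at_right 0)" by (intro tendsto_intros)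
  then have "\<forall>\<^sub>F s in at_right 0. x + s *\<^sub>R v \<in> S" using S x by (auto dest: topological_tendstoD)
  moreover have "\<forall>\<^sub>F s in at_right (0::real). 0 < s" by (rule eventually_at_right_less)
  ultimately have "\<forall>\<^sub>F s in at_right 0. (t (x + s *\<^sub>R v) \<bullet> v - t x \<bullet> v) / s \<ge> 0"
  proof eventually_elim
    case (elim s)
    then have "s * ((t (x + s *\<^sub>R v) - t x) \<bullet> v) \<ge> 0"
      using convex_on_gradient_monotone[OF cv S der x elim(1)] by simp
    then show ?case using elim(2) by (simp add: inner_diff_left zero_le_mult_iff)
  qed
  from tendsto_lowerbound[OF lim this] show ?thesis by (simp add: inner_commute)
qed

text \<open>A zero of a nonnegative form is a minimum, so the first order condition would put
  \<open>v\<close> into the kernel of \<open>A\<close>, which is trivial.\<close>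

lemma nonneg_nonsingular_imp_positive:
  fixes A :: "real^'n^'n"
  assumes sym: "transpose A = A" and nn: "\<And>v. v \<bullet> (A *v v) \<ge> 0" and det: "det A \<noteq> 0" and v: "v \<noteq> 0"
  shows "v \<bullet> (A *v v) > 0"
proof (rule ccontr)
  assume "\<not> v \<bullet> (A *v v) > 0"
  then have 0: "v \<bullet> (A *v v) = 0" using nn[of v] by simp
  have "(A *v v) \<bullet> w = 0" for w
  proof -
    have "(- 2 * ((A *v v) \<bullet> w)) * s + (- (w \<bullet> (A *v w))) * s\<^sup>2 \<le> 0" for s
      using nn[of "v + s *\<^sub>R w"] 0 inner_matrix_symmetric[OF sym, of v w] inner_commute[of w "A *v v"]
      by (simp add: matrix_vector_right_distrib matrix_vector_mult_scaleR inner_add_left inner_add_right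
          power2_eq_square algebra_simps)
    from linear_coeff_zero_if_nonpos[OF this] show ?thesis by simp
  qed
  from this[of "A *v v"] have "A *v v = 0" by simp
  moreover have "\<exists>B. B ** A = mat 1" using det by (metis invertible_def invertible_det_nz)
  ultimately show False using v unfolding matrix_left_invertible_ker by blast
qed

text \<open>The image is open by invariance of domain. It is also relatively closed: boundary points
  stay on their faces, so it is the intersection of the open cube with the compact image of the
  closed one. Connectedness finishes the argument.\<close>

lemma Omega_onto:
  fixes t :: "real^'n \<Rightarrow> real^'n"
  assumes cont: "continuous_on Omega_bar t" and inj: "inj_on t Omega"
    and into: "t ` Omega \<subseteq> Omega"
    and faces: "\<And>x i. x $ i = 0 \<or> x $ i = 1 \<Longrightarrow> t x $ i = x $ i"
  shows "t ` Omega = Omega"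
proof -
  have op: "open (t ` Omega)"
    using continuous_on_subset[OF cont Omega_subset] open_Omega inj by (rule invariance_of_domain)
  have "t x \<notin> Omega" if "x \<in> Omega_bar - Omega" for x
  proof -
    have "x \<notin> Omega" using that by simp
    then obtain i where "\<not> (0 < x $ i \<and> x $ i < 1)" unfolding mem_Omega by blast
    then have "x $ i = 0 \<or> x $ i = 1"
      using that by (auto simp: mem_Omega_bar not_less) (metis antisym)+
    with faces[OF this] have "t x $ i = 0 \<or> t x $ i = 1" by auto
    then show ?thesis by (auto simp: mem_Omega) (metis less_irrefl)+
  qed
  then have "t ` Omega = t ` Omega_bar \<inter> Omega" using into Omega_subset by blast
  moreover have "closed (t ` Omega_bar)"
    using compact_continuous_image[OF cont compact_Omega_bar] by (rule compact_imp_closed)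
  ultimately have "closedin (top_of_set Omega) (t ` Omega)" by (metis closedin_closed_Int inf_commute)
  moreover have "openin (top_of_set Omega) (t ` Omega)"
    using op into by (simp add: open_subset)
  moreover have "connected (Omega :: (real^'n) set)" by (rule convex_connected[OF convex_Omega])
  moreover have "vec (1 / 2) \<in> (Omega :: (real^'n) set)" by (simp add: mem_Omega)
  ultimately show ?thesis unfolding connected_clopen by blast
qed

section \<open>Transport maps and their interpolation\<close>

text \<open>Every clause survives convex combinations, the determinant bound by log-concavity.
  Bijectivity on the open cube is left out because it follows from positive definiteness and the
  preservation of faces, hence holds for all interpolations as well.\<close>

definition transport_map :: "(real^'n \<Rightarrow> real^'n) \<Rightarrow> (real^'n \<Rightarrow> real^'n^'n) \<Rightarrow> bool" where
  "transport_map t A \<longleftrightarrow> (\<forall>x. (t has_derivative (*v) (A x)) (at x)) \<and> continuous_on UNIV A \<and>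
     (\<forall>x. transpose (A x) = A x) \<and> (\<forall>x i. x $ i = 0 \<or> x $ i = 1 \<longrightarrow> t x $ i = x $ i) \<and>
     (\<forall>x\<in>Omega. t x \<in> Omega) \<and> (\<forall>x\<in>Omega. \<forall>v. v \<noteq> 0 \<longrightarrow> v \<bullet> (A x *v v) > 0) \<and>
     (\<exists>c>0. \<forall>x\<in>Omega. c \<le> det (A x))"

lemma X_plus_transport_map:
  fixes \<phi> :: "real^'n \<Rightarrow> real"
  assumes "\<phi> \<in> X_plus K"
  obtains \<psi> A where "\<psi> \<in> TX K" "\<phi> = (\<lambda>x. qfun x + \<psi> x)"
    "\<And>x. (\<phi> has_derivative (\<lambda>v. grad \<phi> x \<bullet> v)) (at x)" "transport_map (grad \<phi>) A"
proof -
  obtain \<psi> where \<psi>: "\<psi> \<in> TX K" "\<phi> = (\<lambda>x. qfun x + \<psi> x)"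
    using assms by (auto simp: X_plus_def X_ansatz_def)
  have X: "convex_on Omega_bar \<phi>" "\<And>x. x \<in> Omega \<Longrightarrow> \<phi> differentiable (at x) \<Longrightarrow> grad \<phi> x \<in> Omega"
    and inf: "(INF x\<in>Omega. det (hessian \<phi> x)) > 0"
    using assms by (auto simp: X_plus_def X_ansatz_def X_space_def)
  obtain g H where "neumann_potential \<psi> g H" using TX_neumann_potential[OF \<psi>(1)] .
  then have g: "\<And>x. (\<psi> has_derivative (\<lambda>v. g x \<bullet> v)) (at x)" "\<And>x. (g has_derivative (*v) (H x)) (at x)"
    "continuous_on UNIV H" "\<And>x. transpose (H x) = H x" "\<And>x i. x $ i = 0 \<or> x $ i = 1 \<Longrightarrow> g x $ i = 0"
    by (auto simp: neumann_potential_def)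
  define A where "A = (\<lambda>x. mat 1 + H x)"
  have dphi: "(\<phi> has_derivative (\<lambda>v. (x + g x) \<bullet> v)) (at x)" for x
    unfolding \<psi>(2) inner_add_left by (intro has_derivative_add has_derivative_qfun g)
  then have grad: "grad \<phi> = (\<lambda>x. x + g x)" by (intro ext grad_eqI)
  have dt: "(grad \<phi> has_derivative (*v) (A x)) (at x)" for x
    unfolding grad A_def matrix_vector_mult_add_rdistrib[abs_def] matrix_vector_mul_lid
    by (intro has_derivative_add g has_derivative_ident)
  have hess: "hessian \<phi> x = A x" for x
    unfolding hessian_def jacobian_def frechet_derivative_at[OF dt, symmetric] by simp
  have cA: "continuous_on UNIV A" unfolding A_def by (intro continuous_intros g)
  have sA: "transpose (A x) = A x" for x
    using g(4)[of x] by (auto simp: A_def transpose_def vec_eq_iff mat_def)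
  define c where "c = (INF x\<in>(Omega :: (real^'n) set). det (A x))"
  \<comment> \<open>An infimum of reals lies below the members only if the set is bounded below;
    continuity on the compact cube provides this.\<close>
  have "compact ((\<lambda>x. det (A x)) ` Omega_bar)"
    by (intro compact_continuous_image compact_Omega_bar continuous_intros continuous_on_subset[OF cA]) auto
  then have "bdd_below ((\<lambda>x. det (A x)) ` Omega)"
    by (meson bdd_below_mono bounded_imp_bdd_below compact_imp_bounded image_mono Omega_subset)
  then have c: "c \<le> det (A x)" if "x \<in> Omega" for x
    unfolding c_def using that by (rule cINF_lower)
  have "c > 0" using inf unfolding c_def hess .
  have cv: "convex_on Omega \<phi>" using X(1) Omega_subset convex_Omega by (rule convex_on_subset)
  have "v \<bullet> (A x *v v) > 0" if "x \<in> Omega" "v \<noteq> 0" for x v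
  proof (rule nonneg_nonsingular_imp_positive[OF sA])
    show "v \<bullet> (A x *v v) \<ge> 0" for v
      by (rule convex_on_hessian_nonneg[OF cv open_Omega _ that(1) dt]) (simp add: grad dphi)
    show "det (A x) \<noteq> 0" using c[OF that(1)] \<open>c > 0\<close> by simp
  qed (rule that(2))
  moreover have "grad \<phi> x \<in> Omega" if "x \<in> Omega" for x
    using X(2)[OF that] dphi[of x] differentiableI by blast
  ultimately have "transport_map (grad \<phi>) A"
    unfolding transport_map_def using dt cA sA c \<open>c > 0\<close> g(5) by (auto simp: grad)
  with \<psi> dphi that show thesis unfolding grad by blast
qed

text \<open>Positive definite Jacobians on a convex set make the map strictly monotone.\<close>

lemma transport_map_inj: "transport_map t A \<Longrightarrow> inj_on t Omega"
proof (rule inj_onI, rule ccontr)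
  fix x y assume t: "transport_map t A" and *: "x \<in> Omega" "y \<in> Omega" "t x = t y" "x \<noteq> y"
  have "\<And>x. x \<in> Omega \<Longrightarrow> (t has_derivative (*v) (A x)) (at x)" using t by (simp add: transport_map_def)
  from derivative_mean_value_inner[OF convex_Omega this *(1,2)]
  obtain z where z: "z \<in> Omega" "(t y - t x) \<bullet> (y - x) = (y - x) \<bullet> (A z *v (y - x))" by blast
  have "(y - x) \<bullet> (A z *v (y - x)) > 0" using t z(1) *(4) by (simp add: transport_map_def)
  then show False using * z by simp
qed

lemma transport_map_onto: "transport_map t A \<Longrightarrow> t ` Omega = Omega"
proof (rule Omega_onto[OF _ transport_map_inj])
  assume "transport_map t A"
  then show "continuous_on Omega_bar t" unfolding transport_map_def
    by (blast intro: continuous_at_imp_continuous_on has_derivative_continuous)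
qed (auto simp: transport_map_def)

lemma transport_map_interpolate:
  assumes t1: "transport_map t1 A1" and t2: "transport_map t2 A2" and r: "r \<in> {0..1}"
  shows "transport_map (\<lambda>x. t1 x + r *\<^sub>R (t2 x - t1 x)) (\<lambda>x. A1 x + r *\<^sub>R (A2 x - A1 x))"
    and "\<And>x. x \<in> Omega \<Longrightarrow> min (det (A1 x)) (det (A2 x)) \<le> det (A1 x + r *\<^sub>R (A2 x - A1 x))"
proof -
  note t = t1[unfolded transport_map_def] t2[unfolded transport_map_def]
  have pair: "spd_pair (A1 x) (A2 x)" if "x \<in> Omega" for x
    using t that by unfold_locales auto
  show le: "min (det (A1 x)) (det (A2 x)) \<le> det (A1 x + r *\<^sub>R (A2 x - A1 x))" if "x \<in> Omega" for x
    using spd_pair.det_interpolation_ge[OF pair[OF that], of r] r by auto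
  have cc: "t1 x + r *\<^sub>R (t2 x - t1 x) = (1 - r) *\<^sub>R t1 x + r *\<^sub>R t2 x" for x by (simp add: algebra_simps)
  have ccA: "A1 x + r *\<^sub>R (A2 x - A1 x) = (1 - r) *\<^sub>R A1 x + r *\<^sub>R A2 x" for x by (simp add: algebra_simps)
  have ccv: "(A1 x + r *\<^sub>R (A2 x - A1 x)) *v v = (1 - r) *\<^sub>R (A1 x *v v) + r *\<^sub>R (A2 x *v v)" for x v
    unfolding ccA by (simp add: matrix_vector_mult_add_rdistrib scaleR_matrix_vector_assoc)
  show "transport_map (\<lambda>x. t1 x + r *\<^sub>R (t2 x - t1 x)) (\<lambda>x. A1 x + r *\<^sub>R (A2 x - A1 x))"
    unfolding transport_map_def
  proof (intro conjI allI ballI impI)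
    show "((\<lambda>x. t1 x + r *\<^sub>R (t2 x - t1 x)) has_derivative (*v) (A1 x + r *\<^sub>R (A2 x - A1 x))) (at x)" for x
      unfolding cc ccv[abs_def] using t by (intro has_derivative_add has_derivative_scaleR_right) auto
    show "continuous_on UNIV (\<lambda>x. A1 x + r *\<^sub>R (A2 x - A1 x))"
      using t by (intro continuous_intros) auto
    show "transpose (A1 x + r *\<^sub>R (A2 x - A1 x)) = A1 x + r *\<^sub>R (A2 x - A1 x)" for x
      using t by (auto simp: transpose_def vec_eq_iff)
    show "(t1 x + r *\<^sub>R (t2 x - t1 x)) $ i = x $ i" if "x $ i = 0 \<or> x $ i = 1" for x i
    proof -
      have "t1 x $ i = x $ i" "t2 x $ i = x $ i" using t that by blast+
      then show ?thesis by simp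
    qed
    show "t1 x + r *\<^sub>R (t2 x - t1 x) \<in> Omega" if "x \<in> Omega" for x
      unfolding cc using t that r by (intro convexD[OF convex_Omega]) auto
    show "v \<bullet> ((A1 x + r *\<^sub>R (A2 x - A1 x)) *v v) > 0" if "x \<in> Omega" "v \<noteq> 0" for x v
    proof -
      have p: "v \<bullet> (A1 x *v v) > 0" "v \<bullet> (A2 x *v v) > 0" using t that by auto
      have "(1 - r) * (v \<bullet> (A1 x *v v)) + r * (v \<bullet> (A2 x *v v)) > 0"
        using p r by (cases "r = 0") (auto intro: add_nonneg_pos)
      then show ?thesis by (simp add: ccv inner_add_right)
    qed
    obtain c1 where "c1 > 0" "\<forall>x\<in>Omega. c1 \<le> det (A1 x)" using t by blast
    moreover obtain c2 where "c2 > 0" "\<forall>x\<in>Omega. c2 \<le> det (A2 x)" using t by blast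
    ultimately show "\<exists>c>0. \<forall>x\<in>Omega. c \<le> det (A1 x + r *\<^sub>R (A2 x - A1 x))"
      using le by (intro exI[of _ "min c1 c2"]) (fastforce simp: min_le_iff_disj)
  qed
qed

subsection \<open>Push-forwards\<close>

text \<open>Riesz representation: the gradient is the adjoint of the derivative applied to
  1.\<close>

lemma differentiable_grad:
  fixes f :: "real^'n \<Rightarrow> real"
  assumes "f differentiable (at x)"
  shows "(f has_derivative (\<lambda>v. grad f x \<bullet> v)) (at x)"
proof -
  obtain D where D: "(f has_derivative D) (at x)" using assms by (auto simp: differentiable_def)
  have "D = (\<lambda>v. adjoint D 1 \<bullet> v)"
    using adjoint_works[OF has_derivative_linear[OF D], of _ 1] by (auto simp: fun_eq_iff inner_commute)
  with D have "(f has_derivative (\<lambda>v. adjoint D 1 \<bullet> v)) (at x)" by simp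
  then show ?thesis by (metis grad_eqI)
qed

lemma continuous_bounded_Omega:
  fixes f :: "real^'n \<Rightarrow> 'b::real_normed_vector"
  assumes "continuous_on Omega_bar f"
  obtains C where "C \<ge> 0" "\<And>x. x \<in> Omega \<Longrightarrow> norm (f x) \<le> C"
proof -
  have "bounded (f ` Omega_bar)"
    using compact_continuous_image[OF assms compact_Omega_bar] by (rule compact_imp_bounded)
  then obtain C where C: "\<forall>y\<in>f ` Omega_bar. norm y \<le> C" by (auto simp: bounded_iff)
  show thesis
  proof (rule that[of "max C 0"])
    fix x :: "real^'n" assume "x \<in> Omega"
    then have "f x \<in> f ` Omega_bar" using Omega_subset by blast
    then have "norm (f x) \<le> C" using C by blast
    then show "norm (f x) \<le> max C 0" by simp
  qed simp
qed

text \<open>By invariance of domain, \<open>T\<close> and its inverse send the open cube to open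
  subsets of the closed one, hence into its interior. At interior points the derivative within the
  closed cube is a full derivative.\<close>

lemma Diff_plus_Omega:
  assumes "T \<in> Diff_plus"
  shows "bij_betw T Omega Omega"
    and "\<And>x. x \<in> Omega \<Longrightarrow> (T has_derivative (*v) (jacobian T (at x))) (at x)"
    and "\<And>x. x \<in> Omega \<Longrightarrow> det (jacobian T (at x)) > 0"
proof -
  have bij: "bij_betw T Omega_bar Omega_bar" and C1: "C1_on Omega_bar T"
    and C1': "C1_on Omega_bar (inv_into Omega_bar T)"
    and det: "\<And>x. x \<in> Omega \<Longrightarrow> det (jacobian T (at x)) > 0"
    using assms by (auto simp: Diff_plus_def)
  have int: "interior Omega_bar = (Omega :: (real^'n) set)"
    by (simp add: Omega_def Omega_bar_def interior_cbox)
  have image: "f ` Omega \<subseteq> Omega" if "bij_betw f Omega_bar Omega_bar" "C1_on Omega_bar f" for f :: "real^'n \<Rightarrow> real^'n"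
  proof -
    have "continuous_on Omega_bar f" using that(2) by (auto simp: C1_on_def intro: has_derivative_continuous_on)
    then have "continuous_on Omega f" using Omega_subset by (rule continuous_on_subset)
    moreover have "inj_on f Omega" using that(1) Omega_subset by (meson bij_betw_def inj_on_subset)
    ultimately have "open (f ` Omega)" using open_Omega by (intro invariance_of_domain)
    moreover have "f ` Omega \<subseteq> Omega_bar" using that(1) Omega_subset by (auto simp: bij_betw_def)
    ultimately show ?thesis unfolding int[symmetric] by (rule interior_maximal[rotated])
  qed
  have 1: "T ` Omega \<subseteq> Omega" by (rule image[OF bij C1])
  have 2: "inv_into Omega_bar T ` Omega \<subseteq> Omega" by (rule image[OF bij_betw_inv_into[OF bij] C1'])
  have "y \<in> T ` Omega" if y: "y \<in> Omega" for y
  proof (rule image_eqI)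
    show "y = T (inv_into Omega_bar T y)"
      using bij y Omega_subset by (metis bij_betw_inv_into_right subsetD)
    show "inv_into Omega_bar T y \<in> Omega" using 2 y by blast
  qed
  then show "bij_betw T Omega Omega"
    using 1 bij Omega_subset unfolding bij_betw_def by (metis inj_on_subset subsetI subset_antisym)
  show "(T has_derivative (*v) (jacobian T (at x))) (at x)" if x: "x \<in> Omega" for x
  proof -
    obtain T' where "(T has_derivative blinfun_apply T') (at x within Omega_bar)"
      using C1 x Omega_subset by (auto simp: C1_on_def)
    moreover have "at x within Omega_bar = at x" by (rule at_within_interior) (simp add: int x)
    ultimately have "(T has_derivative blinfun_apply T') (at x)" by metis
    then have "T differentiable (at x)" by (rule differentiableI)
    then show ?thesis by (simp add: jacobian_works)
  qed
  show "det (jacobian T (at x)) > 0" if "x \<in> Omega" for x using that by (rule det)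
qed

lemma has_derivative_matrix_imp_jacobian:
  fixes f :: "real^'n \<Rightarrow> real^'n"
  assumes "(f has_derivative (*v) A) (at x)"
  shows "jacobian f (at x) = A"
  unfolding jacobian_def frechet_derivative_at[OF assms, symmetric] by simp

lemma push_forward_pos:
  assumes T: "T \<in> Diff_plus" and pos: "\<And>x. x \<in> Omega \<Longrightarrow> ubar x > 0" and x: "x \<in> Omega"
  shows "push_forward T ubar x > 0"
proof -
  have "x \<in> T ` Omega" using Diff_plus_Omega(1)[OF T] x by (simp add: bij_betw_def)
  then have "inv_into Omega T x \<in> Omega" by (rule inv_into_into)
  then show ?thesis using Diff_plus_Omega(3)[OF T] pos by (simp add: push_forward_def)
qed

text \<open>By the chain rule and the multiplicativity of the determinant, the transported density
  depends on \<open>T\<close> only through the push-forward of \<open>ubar\<close> under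
  \<open>T\<close>.\<close>

lemma push_forward_compose:
  assumes T: "T \<in> Diff_plus" and t: "transport_map t A" and x: "x \<in> Omega"
  shows "push_forward (t \<circ> T) ubar (t x) = push_forward T ubar x / det (A x)"
proof -
  note bij = Diff_plus_Omega(1)[OF T]
  have xT: "x \<in> T ` Omega" using bij x by (simp add: bij_betw_def)
  define z where "z = inv_into Omega T x"
  have z: "z \<in> Omega" "T z = x" unfolding z_def using xT by (auto intro: inv_into_into f_inv_into_f)
  have "inj_on (t \<circ> T) Omega"
    using bij transport_map_inj[OF t] by (simp add: bij_betw_def comp_inj_on)
  then have "inv_into Omega (t \<circ> T) ((t \<circ> T) z) = z" using z(1) by (rule inv_into_f_f)
  then have inv: "inv_into Omega (t \<circ> T) (t x) = z" by (simp add: z(2))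
  have "(t has_derivative (*v) (A (T z))) (at (T z))" using t by (simp add: transport_map_def)
  from diff_chain_at[OF Diff_plus_Omega(2)[OF T z(1)] this]
  have "(t \<circ> T has_derivative (*v) (A (T z) ** jacobian T (at z))) (at z)"
    by (simp add: o_def matrix_vector_mul_assoc)
  then have "det (jacobian (t \<circ> T) (at z)) = det (A x) * det (jacobian T (at z))"
    by (simp add: has_derivative_matrix_imp_jacobian det_mul z(2))
  then show ?thesis by (simp add: push_forward_def inv z_def[symmetric] mult.commute)
qed

text \<open>Substituting \<open>T\<close> undoes the push-forward: the Jacobian weight cancels the
  denominator and leaves \<open>ubar\<close>.\<close>

lemma push_forward_integrable:
  assumes T: "T \<in> Diff_plus" and int: "set_integrable lborel Omega ubar"
    and m: "set_borel_measurable borel Omega (push_forward T ubar)"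
  shows "set_integrable lborel Omega (push_forward T ubar)"
proof -
  note bij = Diff_plus_Omega(1)[OF T]
  have img: "T ` Omega = Omega" and inj: "inj_on T Omega" using bij by (auto simp: bij_betw_def)
  have "\<bar>det (matrix ((*v) (jacobian T (at x))))\<bar> * push_forward T ubar (T x) = ubar x" if "x \<in> Omega" for x
    using Diff_plus_Omega(3)[OF T that] inv_into_f_f[OF inj that] by (simp add: push_forward_def)
  then have eq: "(\<lambda>x. indicator Omega x *\<^sub>R (\<bar>det (matrix ((*v) (jacobian T (at x))))\<bar> * push_forward T ubar (T x)))
      = (\<lambda>x. indicator Omega x *\<^sub>R ubar x)" by (auto simp: indicator_def fun_eq_iff)
  have "Omega \<in> sets (borel :: (real^'n) measure)" by (rule borel_open[OF open_Omega])
  moreover have "(T has_derivative (*v) (jacobian T (at x))) (at x within Omega)" if "x \<in> Omega" for x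
    using Diff_plus_Omega(2)[OF T that] by (rule has_derivative_at_withinI)
  moreover have "set_borel_measurable borel (T ` Omega) (push_forward T ubar)" using m img by simp
  moreover have "set_borel_measurable borel Omega
      (\<lambda>x. \<bar>det (matrix ((*v) (jacobian T (at x))))\<bar> * push_forward T ubar (T x))"
    unfolding set_borel_measurable_def eq
    using borel_measurable_integrable[OF int[unfolded set_integrable_def]] by simp
  ultimately have "set_integrable lborel Omega
      (\<lambda>x. \<bar>det (matrix ((*v) (jacobian T (at x))))\<bar> * push_forward T ubar (T x)) \<longleftrightarrow>
      set_integrable lborel (T ` Omega) (push_forward T ubar)"
    using inj by (intro change_of_variables(1))
  then show ?thesis using int unfolding img set_integrable_def eq by simp
qed

text \<open>\<open>V\<close> is meaningful only inside the cube; the gradient of its extension is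
  continuous everywhere, hence bounded on the closed cube.\<close>

lemma smooth_symmetric_periodic_gradient:
  assumes V: "smooth_symmetric_periodic V"
  obtains W :: "real^'n \<Rightarrow> real^'n" where "continuous_on UNIV W"
    "\<And>x. x \<in> Omega \<Longrightarrow> (V has_derivative (\<lambda>v. W x \<bullet> v)) (at x)"
    "\<And>x. x \<in> Omega \<Longrightarrow> (W has_derivative (*v) (hessian V x)) (at x)"
proof -
  obtain F where F: "\<And>x. x \<in> Omega \<Longrightarrow> F x = V x" and Ck: "\<And>k. Ck k F"
    using V by (auto simp: smooth_symmetric_periodic_def)
  have "Ck 1 F" "Ck (Suc (Suc 0)) F" using Ck by auto
  then have dF: "\<And>x. F differentiable (at x)" and cF: "\<And>i. continuous_on UNIV (\<lambda>x. grad F x $ i)"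
    and ddF: "\<And>i x. (\<lambda>x. grad F x $ i) differentiable (at x)" by auto
  have dV: "(V has_derivative (\<lambda>v. grad F x \<bullet> v)) (at x)" if "x \<in> Omega" for x
    using differentiable_grad[OF dF] open_Omega that F by (rule has_derivative_transform_within_open)
  have gV: "grad V x = grad F x" if "x \<in> Omega" for x by (rule grad_eqI[OF dV[OF that]])
  have dG: "grad F differentiable (at x)" for x
  proof -
    have "(\<lambda>x. \<chi> i. grad F x $ i) differentiable (at x)"
      by (subst differentiable_componentwise_within) (use ddF in \<open>auto simp: Basis_vec_def inner_axis\<close>)
    then show ?thesis by simp
  qed
  have "(grad F has_derivative (*v) (hessian V x)) (at x)" if x: "x \<in> Omega" for x
  proof -
    have d: "(grad F has_derivative (*v) (jacobian (grad F) (at x))) (at x)"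
      using dG by (simp add: jacobian_works)
    have "(grad V has_derivative (*v) (jacobian (grad F) (at x))) (at x)"
      using d open_Omega x gV[symmetric] by (rule has_derivative_transform_within_open)
    then have "hessian V x = jacobian (grad F) (at x)"
      unfolding hessian_def by (rule has_derivative_matrix_imp_jacobian)
    with d show ?thesis by simp
  qed
  moreover have "continuous_on UNIV (grad F)"
    using continuous_on_vec_lambda[of UNIV "\<lambda>i x. grad F x $ i", OF cF] by simp
  ultimately show thesis using that dV by blast
qed

subsection \<open>First variation of the internal energy\<close>

text \<open>\<open>u\<close> has finite mass, so L2 fields are also integrable against it:
  \<open>norm (v x)\<close> is at most its square plus 1. The extra 1 and the bound on
  \<open>b\<close> each contribute one \<open>C\<close> to the term
  \<open>2 * C * u x\<close>.\<close>

lemma L2_fields_weighted_integrable: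
  fixes u :: "real^'n \<Rightarrow> real"
  assumes u: "set_integrable lborel Omega u" "\<And>x. x \<in> Omega \<Longrightarrow> u x > 0"
    and v: "v \<in> L2_fields u" and b: "set_borel_measurable borel Omega b"
    and f: "set_borel_measurable borel Omega f" "\<And>x. x \<in> Omega \<Longrightarrow> \<bar>f x\<bar> \<le> C * norm (v x) + b x"
    and C: "0 \<le> C" "\<And>x. x \<in> Omega \<Longrightarrow> b x \<le> C"
  shows "set_integrable lborel Omega (\<lambda>x. f x * u x)"
proof (rule set_integrable_bound)
  show "set_integrable lborel Omega (\<lambda>x. C * ((norm (v x))\<^sup>2 * u x) + 2 * C * u x)"
    using u v by (intro set_integral_add set_integrable_mult_right) (auto simp: L2_fields_def)
  have [measurable]: "(\<lambda>x. indicator Omega x *\<^sub>R u x) \<in> borel_measurable borel"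
    "(\<lambda>x. indicator Omega x *\<^sub>R f x) \<in> borel_measurable borel"
    using borel_measurable_integrable[OF u(1)[unfolded set_integrable_def]] f(1)
    by (simp_all add: set_borel_measurable_def)
  have "(\<lambda>x. (indicator Omega x *\<^sub>R f x) * (indicator Omega x *\<^sub>R u x)) \<in> borel_measurable borel" by measurable
  moreover have "(\<lambda>x. (indicator Omega x *\<^sub>R f x) * (indicator Omega x *\<^sub>R u x)) = (\<lambda>x. indicator Omega x *\<^sub>R (f x * u x))"
    by (auto simp: indicator_def)
  ultimately show "set_borel_measurable lborel Omega (\<lambda>x. f x * u x)" by (simp add: set_borel_measurable_def)
  show "AE x in lborel. x \<in> Omega \<longrightarrow> norm (f x * u x) \<le> norm (C * ((norm (v x))\<^sup>2 * u x) + 2 * C * u x)"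
  proof (intro AE_I2 impI)
    fix x :: "real^'n" assume x: "x \<in> Omega"
    have "norm (v x) \<le> (norm (v x))\<^sup>2 + 1"
      using sum_squares_bound[of "norm (v x)" 1] by (simp add: power2_eq_square) (smt (verit) norm_ge_zero mult_nonneg_nonneg)
    then have "C * norm (v x) \<le> C * ((norm (v x))\<^sup>2 + 1)" using C(1) by (rule mult_left_mono)
    then have "\<bar>f x\<bar> \<le> C * (norm (v x))\<^sup>2 + 2 * C" using f(2)[OF x] C(2)[OF x] by (simp add: algebra_simps)
    then have "\<bar>f x\<bar> * u x \<le> (C * (norm (v x))\<^sup>2 + 2 * C) * u x" using u(2)[OF x] by (intro mult_right_mono) auto
    moreover have "(C * (norm (v x))\<^sup>2 + 2 * C) * u x = C * ((norm (v x))\<^sup>2 * u x) + 2 * C * u x" by (simp add: algebra_simps)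
    ultimately show "norm (f x * u x) \<le> norm (C * ((norm (v x))\<^sup>2 * u x) + 2 * C * u x)"
      using u(2)[OF x] by (simp add: abs_mult)
  qed
qed

text \<open>This is the continuity equation for the displacement from \<open>t\<close> to
  \<open>s\<close> and the normalized pressure of \<open>ut\<close>, with the pressure gradient
  expressed by the velocity. Adding \<open>W\<close> strips the potential from \<open>v\<close> and
  leaves the internal part.\<close>

lemma first_variation:
  fixes t s :: "real^'n \<Rightarrow> real^'n" and P h :: "real \<Rightarrow> real"
  assumes t: "transport_map t A" and s: "transport_map s B"
    and P: "\<And>r. r > 0 \<Longrightarrow> P differentiable (at r)"
    and h: "\<And>r. r > 0 \<Longrightarrow> deriv h differentiable (at r)"
    and h_eq: "\<And>r. r > 0 \<Longrightarrow> deriv P r = r * deriv (deriv h) r"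
    and W: "continuous_on UNIV W" "\<And>x. x \<in> Omega \<Longrightarrow> (V has_derivative (\<lambda>w. W x \<bullet> w)) (at x)"
    and u: "set_integrable lborel Omega u" "\<And>x. x \<in> Omega \<Longrightarrow> u x > 0"
    and ut: "ut differentiable_on Omega" "\<And>x. x \<in> Omega \<Longrightarrow> ut (t x) = u x / det (A x)"
    and v: "v = velocity h V ut \<circ> t" "v \<in> L2_fields u"
  defines "F \<equiv> \<lambda>x. ((v x + W (t x)) \<bullet> (t x - s x)) * u x
      + (P (u x / det (A x)) - P 0) * det_deriv (A x) (B x - A x)"
  shows "set_integrable lborel Omega F" and "(LINT x:Omega|lborel. F x) = 0"
proof -
  note T = t[unfolded transport_map_def] s[unfolded transport_map_def]
  have dt: "\<And>x. (t has_derivative (*v) (A x)) (at x)" and ds: "\<And>x. (s has_derivative (*v) (B x)) (at x)"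
    and cA: "continuous_on UNIV A" and cB: "continuous_on UNIV B"
    and t_in: "\<And>x. x \<in> Omega \<Longrightarrow> t x \<in> Omega"
    using T by blast+
  have ct: "continuous_on X t" and cs: "continuous_on X s" for X
    by (intro continuous_at_imp_continuous_on ballI has_derivative_continuous[OF dt]
      has_derivative_continuous[OF ds])+
  obtain cA where "cA > 0" "\<forall>x\<in>Omega. cA \<le> det (A x)" using T by blast
  then have cA0: "cA > 0" "\<And>x. x \<in> Omega \<Longrightarrow> cA \<le> det (A x)" by blast+
  obtain cB where "cB > 0" "\<forall>x\<in>Omega. cB \<le> det (B x)" using T by blast
  then have cB0: "cB > 0" "\<And>x. x \<in> Omega \<Longrightarrow> cB \<le> det (B x)" by blast+
  have onto: "t ` Omega = Omega" by (rule transport_map_onto[OF t])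
  have ut_pos: "ut y > 0" if "y \<in> Omega" for y
  proof -
    have "y \<in> t ` Omega" using that onto by simp
    then obtain x where x: "x \<in> Omega" "y = t x" by blast
    have "det (A x) > 0" using cA0(1) cA0(2)[OF x(1)] by simp
    then show ?thesis using ut(2)[OF x(1)] u(2)[OF x(1)] x(2) by simp
  qed
  define q where "q = (\<lambda>y. P (ut y) - P 0)"
  define G where "G = (\<lambda>y. deriv P (ut y) *\<^sub>R grad ut y)"
  have dut: "(ut has_derivative (\<lambda>w. grad ut y \<bullet> w)) (at y)" if "y \<in> Omega" for y
    using ut(1) that by (intro differentiable_grad) (simp add: differentiable_on_eq_differentiable_at[OF open_Omega])
  have dq: "(q has_derivative (\<lambda>w. G y \<bullet> w)) (at y)" if y: "y \<in> Omega" for y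
  proof -
    have "(P has_real_derivative deriv P (ut y)) (at (ut y))"
      using P[OF ut_pos[OF y]] by (simp add: DERIV_deriv_iff_real_differentiable)
    from has_derivative_compose[OF dut[OF y] this[unfolded has_field_derivative_def]]
    have "((\<lambda>y. P (ut y)) has_derivative (\<lambda>w. deriv P (ut y) * (grad ut y \<bullet> w))) (at y)" .
    from has_derivative_diff[OF this has_derivative_const[of "P 0"]]
    show ?thesis unfolding q_def G_def by simp
  qed
  have vel: "velocity h V ut y = - ((1 / ut y) *\<^sub>R G y) - W y" if y: "y \<in> Omega" for y
  proof -
    have pos: "ut y > 0" by (rule ut_pos[OF y])
    have "(deriv h has_real_derivative deriv (deriv h) (ut y)) (at (ut y))"
      using h[OF pos] by (simp add: DERIV_deriv_iff_real_differentiable)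
    from has_derivative_compose[OF dut[OF y] this[unfolded has_field_derivative_def]]
    have "((\<lambda>z. deriv h (ut z)) has_derivative (\<lambda>w. deriv (deriv h) (ut y) * (grad ut y \<bullet> w))) (at y)" .
    from has_derivative_add[OF this W(2)[OF y]]
    have "((\<lambda>z. deriv h (ut z) + V z) has_derivative
        (\<lambda>w. (deriv (deriv h) (ut y) *\<^sub>R grad ut y + W y) \<bullet> w)) (at y)"
      by (simp add: inner_add_left)
    from grad_eqI[OF this] show ?thesis
      using pos h_eq[OF pos] by (simp add: velocity_def G_def)
  qed
  \<comment> \<open>By \<open>h_eq\<close> the pressure gradient is \<open>ut\<close> times the
    gradient of \<open>deriv h\<close> along \<open>ut\<close>; the factor \<open>det (A x)\<close>
    turns \<open>ut (t x)\<close> into \<open>u x\<close>.\<close>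
  have G_eq: "det (A x) *\<^sub>R G (t x) = - u x *\<^sub>R (v x + W (t x))" if x: "x \<in> Omega" for x
  proof -
    have p: "det (A x) > 0" "u x > 0" using cA0(1) cA0(2)[OF x] u(2)[OF x] by auto
    have "v x + W (t x) = - ((det (A x) / u x) *\<^sub>R G (t x))"
      unfolding v(1) using vel[OF t_in[OF x]] ut(2)[OF x] by simp
    then show ?thesis using p by simp
  qed
  obtain M where M: "M \<ge> 0" "\<And>x. x \<in> Omega \<Longrightarrow> norm (s x - t x) \<le> M"
    using continuous_bounded_Omega[of "\<lambda>x. s x - t x"] continuous_on_diff[OF cs ct] by blast
  interpret d: displacement Omega t "\<lambda>x. s x - t x" A "\<lambda>x. B x - A x" M "min cA cB"
  proof
    fix r x assume r: "r \<in> {0..1::real}"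
    note i = transport_map_interpolate[OF t s r]
    show "inj_on (\<lambda>x. t x + r *\<^sub>R (s x - t x)) Omega" by (rule transport_map_inj[OF i(1)])
    assume x: "(x :: real^'n) \<in> Omega"
    show "t x + r *\<^sub>R (s x - t x) \<in> Omega" using i(1) x by (simp add: transport_map_def)
    show "min cA cB \<le> det (A x + r *\<^sub>R (B x - A x))"
      using i(2)[OF x] cA0(2)[OF x] cB0(2)[OF x] by linarith
  next
    show "((\<lambda>x. s x - t x) has_derivative (*v) (B x - A x)) (at x)" for x
      unfolding matrix_vector_mult_diff_rdistrib[abs_def] by (intro has_derivative_diff ds dt)
    show "continuous_on UNIV (\<lambda>x. B x - A x)" using cA cB by (intro continuous_intros)
  qed (use cA cA0 cB0 M dt open_Omega in auto)
  have z: "(0::real) \<in> {0..1}" by simp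
  have d0: "d.t 0 = t" "d.D 0 = (\<lambda>x. det (A x))" by (auto simp: d.t_def d.D_def)
  have Gm: "set_borel_measurable borel Omega G" by (rule set_borel_measurable_gradient[OF open_Omega dq])
  then have [measurable]: "(\<lambda>x. indicator Omega x *\<^sub>R G x) \<in> borel_measurable borel"
    by (simp add: set_borel_measurable_def)
  have "(\<lambda>x. norm (indicator Omega x *\<^sub>R G x)) \<in> borel_measurable borel" by measurable
  then have Gnm: "set_borel_measurable borel Omega (\<lambda>x. norm (G x))"
    by (simp add: set_borel_measurable_def)
  have [measurable]: "(\<lambda>x. indicator Omega x *\<^sub>R v x) \<in> borel_measurable borel"
    using v(2) by (simp add: L2_fields_def set_borel_measurable_def)
  have Wt: "continuous_on X (\<lambda>x. W (t x))" for X
    using continuous_on_compose2[OF W(1) ct] by simp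
  have Om[measurable]: "Omega \<in> sets (borel :: (real^'n) measure)" by (rule borel_open[OF open_Omega])
  have [measurable]: "(\<lambda>x. W (t x)) \<in> borel_measurable borel" by (rule borel_measurable_continuous_onI[OF Wt])
  obtain C where C: "C \<ge> 0" "\<And>x. x \<in> Omega \<Longrightarrow> norm (W (t x)) \<le> C"
    using continuous_bounded_Omega[OF Wt] by blast
  \<comment> \<open>The L2 velocity is integrable against \<open>u\<close>; undoing the substitution
    \<open>y = t x\<close> turns this into integrability of the pressure gradient.\<close>
  have "set_integrable lborel Omega (\<lambda>x. norm (v x + W (t x)) * u x)"
  proof (rule L2_fields_weighted_integrable[OF u v(2), where b = "\<lambda>x. norm (W (t x))" and C = "max 1 C"])
    have "(\<lambda>x. norm (indicator Omega x *\<^sub>R v x + indicator Omega x *\<^sub>R W (t x))) \<in> borel_measurable borel" by measurable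
    moreover have "(\<lambda>x. norm (indicator Omega x *\<^sub>R v x + indicator Omega x *\<^sub>R W (t x)))
        = (\<lambda>x. indicator Omega x *\<^sub>R norm (v x + W (t x)))" by (auto simp: indicator_def)
    ultimately show "set_borel_measurable borel Omega (\<lambda>x. norm (v x + W (t x)))"
      by (simp add: set_borel_measurable_def)
    show "set_borel_measurable borel Omega (\<lambda>x. norm (W (t x)))" unfolding set_borel_measurable_def by measurable
    show "\<bar>norm (v x + W (t x))\<bar> \<le> max 1 C * norm (v x) + norm (W (t x))" for x
      using norm_triangle_ineq[of "v x" "W (t x)"] mult_right_mono[of 1 "max 1 C" "norm (v x)"] by simp
    show "norm (W (t x)) \<le> max 1 C" if "x \<in> Omega" for x using C(2)[OF that] by simp
  qed (auto simp: le_max_iff_disj)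
  moreover have "indicator Omega x *\<^sub>R (norm (v x + W (t x)) * u x) = indicator Omega x *\<^sub>R (d.D 0 x * norm (G (d.t 0 x)))" for x
  proof (cases "x \<in> Omega")
    case True
    have "norm (det (A x) *\<^sub>R G (t x)) = norm (- u x *\<^sub>R (v x + W (t x)))" using G_eq[OF True] by simp
    then have "det (A x) * norm (G (t x)) = norm (v x + W (t x)) * u x"
      using u(2)[OF True] cA0(1) cA0(2)[OF True] by (simp add: mult.commute)
    then show ?thesis by (simp add: d0)
  qed simp
  ultimately have "set_integrable lborel Omega (\<lambda>x. d.D 0 x * norm (G (d.t 0 x)))"
    by (simp only: set_integrable_def)
  then have Gi: "set_integrable lborel Omega (\<lambda>x. norm (G x))"
    using d.change_of_variables_t(1)[OF z Gnm] onto by (simp add: d0)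
  have qi: "set_integrable lborel Omega q" by (rule gradient_integrable_imp_integrable_Omega[OF dq Gi])
  have d_onto: "d.t r ` Omega = Omega" if r: "r \<in> {0..1}" for r
    using transport_map_onto[OF transport_map_interpolate(1)[OF t s r]] by (simp add: d.t_def[abs_def])
  \<comment> \<open>The derivative of the determinant is continuous up to the boundary of the cube
    and to both endpoints in \<open>r\<close>, which yields the uniform bound
    \<open>L\<close>.\<close>
  have "compact ((\<lambda>(r, x). d.E r x) ` ({0..1} \<times> Omega_bar))"
    by (intro compact_continuous_image continuous_on_subset[OF d.cont_E] compact_Times compact_Omega_bar) auto
  then obtain L where L: "\<And>r x. r \<in> {0..1} \<Longrightarrow> x \<in> Omega_bar \<Longrightarrow> \<bar>d.E r x\<bar> \<le> L"
    unfolding compact_eq_bounded_closed bounded_iff by fastforce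
  have L': "\<bar>d.E r x\<bar> \<le> L" if "r \<in> {0..1}" "x \<in> Omega" for r x
    using L[OF that(1)] that(2) Omega_subset by blast
  note ce = d.continuity_equation[OF d_onto L' dq Gi qi]
  have "indicator Omega x *\<^sub>R ((G (t x) \<bullet> (s x - t x)) * det (A x) + q (t x) * det_deriv (A x) (B x - A x))
      = indicator Omega x *\<^sub>R F x" for x
  proof (cases "x \<in> Omega")
    case True
    have "(G (t x) \<bullet> (s x - t x)) * det (A x) = (det (A x) *\<^sub>R G (t x)) \<bullet> (s x - t x)" by simp
    also have "\<dots> = ((v x + W (t x)) \<bullet> (t x - s x)) * u x"
      unfolding G_eq[OF True] by (simp add: inner_diff_right algebra_simps)
    finally show ?thesis by (simp add: F_def q_def ut(2)[OF True])
  qed simp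
  then show "set_integrable lborel Omega F" "(LINT x:Omega|lborel. F x) = 0"
    using ce by (simp_all only: set_integrable_def set_lebesgue_integral_def)
qed

section \<open>Comparison of two approximate implicit Euler steps\<close>

theorem lemma15:
  fixes P h :: "real \<Rightarrow> real"
    and V ubar :: "real^'n \<Rightarrow> real"
    and T t1 t2 :: "real^'n \<Rightarrow> real^'n"
    and lam M \<delta> \<tau> \<rho>1 \<rho>2 :: real
    and K :: nat
  assumes P_cont: "continuous_on {0..} P"
    and P_smooth: "\<And>k r. r > 0 \<Longrightarrow> (deriv ^^ k) P differentiable (at r)"
    and P_strict_mono: "strict_mono_on {0..} P"
    and P_mccann: "mccann_condition CARD('n) P"
    and h_diff: "\<And>r. r > 0 \<Longrightarrow> h differentiable (at r) \<and> deriv h differentiable (at r)"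
    and h_eq: "\<And>r. r > 0 \<Longrightarrow> deriv P r = r * deriv (deriv h) r"
    and V_smooth: "smooth_symmetric_periodic V"
    and V_convex: "\<And>x w. x \<in> Omega \<Longrightarrow> w \<bullet> (hessian V x *v w) \<ge> lam * (w \<bullet> w)"
    and ubar_pos: "\<And>x. x \<in> Omega \<Longrightarrow> ubar x > 0"
    and ubar_int: "set_integrable lborel Omega ubar"
    and ubar_mass: "(LINT x:Omega|lborel. ubar x) = M"
    and T: "T \<in> Diff_plus"
    and \<delta>: "\<delta> > 0"
    and K: "real K * \<delta> \<in> {1..<2}"
    and \<tau>: "\<tau> > 0" "1 + \<tau> * lam > 0"
    and t1: "t1 \<in> grad_X_plus K"
    and t2: "t2 \<in> grad_X_plus K"
    and u1_diff: "push_forward (t1 \<circ> T) ubar differentiable_on Omega"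
    and u2_diff: "push_forward (t2 \<circ> T) ubar differentiable_on Omega"
    and v1_L2: "velocity_at h V ubar t1 T \<in> L2_fields (push_forward T ubar)"
    and v2_L2: "velocity_at h V ubar t2 T \<in> L2_fields (push_forward T ubar)"
    and \<rho>: "\<rho>1 \<ge> 0" "\<rho>2 \<ge> 0"
    and est1: "\<And>\<psi>. \<psi> \<in> TX K \<Longrightarrow>
      \<bar>L2_inner (push_forward T ubar)
         (\<lambda>x. (1 / \<tau>) *\<^sub>R (t1 x - x) - velocity_at h V ubar t1 T x) (grad \<psi>)\<bar>
      \<le> \<rho>1 * L2_norm (push_forward T ubar) (grad \<psi>)"
    and est2: "\<And>\<psi>. \<psi> \<in> TX K \<Longrightarrow>
      \<bar>L2_inner (push_forward T ubar)
         (\<lambda>x. (1 / \<tau>) *\<^sub>R (t2 x - x) - velocity_at h V ubar t2 T x) (grad \<psi>)\<bar>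
      \<le> \<rho>2 * L2_norm (push_forward T ubar) (grad \<psi>)"
  shows "L2_norm (push_forward T ubar) (\<lambda>x. t1 x - t2 x) \<le> \<tau> / (1 + \<tau> * lam) * (\<rho>1 + \<rho>2)"
proof -
  obtain \<phi>1 where \<phi>1: "\<phi>1 \<in> X_plus K" "t1 = grad \<phi>1" using t1 by (auto simp: grad_X_plus_def)
  obtain \<phi>2 where \<phi>2: "\<phi>2 \<in> X_plus K" "t2 = grad \<phi>2" using t2 by (auto simp: grad_X_plus_def)
  obtain \<psi>1 A1 where 1: "\<psi>1 \<in> TX K" "\<phi>1 = (\<lambda>x. qfun x + \<psi>1 x)"
      "\<And>x. (\<phi>1 has_derivative (\<lambda>v. t1 x \<bullet> v)) (at x)" "transport_map t1 A1"
    using X_plus_transport_map[OF \<phi>1(1)] unfolding \<phi>1(2) by metis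
  obtain \<psi>2 A2 where 2: "\<psi>2 \<in> TX K" "\<phi>2 = (\<lambda>x. qfun x + \<psi>2 x)"
      "\<And>x. (\<phi>2 has_derivative (\<lambda>v. t2 x \<bullet> v)) (at x)" "transport_map t2 A2"
    using X_plus_transport_map[OF \<phi>2(1)] unfolding \<phi>2(2) by metis
  define \<psi> where "\<psi> = (\<lambda>x. \<psi>1 x - \<psi>2 x)"
  define w where "w = (\<lambda>x. t1 x - t2 x)"
  have \<psi>: "\<psi> \<in> TX K" unfolding \<psi>_def by (rule TX_diff[OF 1(1) 2(1)])
  have grad_\<psi>: "grad \<psi> = w"
  proof (intro ext grad_eqI)
    fix x
    have "\<psi> = (\<lambda>x. \<phi>1 x - \<phi>2 x)" by (simp add: \<psi>_def 1(2) 2(2))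
    then show "(\<psi> has_derivative (\<lambda>v. w x \<bullet> v)) (at x)"
      unfolding w_def inner_diff_left using has_derivative_diff[OF 1(3) 2(3)] by simp
  qed
  note T1 = 1(4)[unfolded transport_map_def] note T2 = 2(4)[unfolded transport_map_def]
  have dt1: "\<And>x. (t1 has_derivative (*v) (A1 x)) (at x)" and dt2: "\<And>x. (t2 has_derivative (*v) (A2 x)) (at x)"
    using T1 T2 by blast+
  have ct1: "continuous_on X t1" and ct2: "continuous_on X t2" for X
    by (intro continuous_at_imp_continuous_on ballI has_derivative_continuous[OF dt1]
      has_derivative_continuous[OF dt2])+
  define u where "u = push_forward T ubar"
  define u1 where "u1 = push_forward (t1 \<circ> T) ubar"
  define u2 where "u2 = push_forward (t2 \<circ> T) ubar"
  define v1 where "v1 = velocity_at h V ubar t1 T"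
  define v2 where "v2 = velocity_at h V ubar t2 T"
  have u_pos: "u x > 0" if "x \<in> Omega" for x
    unfolding u_def by (rule push_forward_pos[OF T ubar_pos that])
  have u1: "u1 (t1 x) = u x / det (A1 x)" and u2: "u2 (t2 x) = u x / det (A2 x)" if "x \<in> Omega" for x
    unfolding u_def u1_def u2_def by (rule push_forward_compose[OF T _ that] 1(4) 2(4))+
  have Om[measurable]: "Omega \<in> sets (borel :: (real^'n) measure)" by (rule borel_open[OF open_Omega])
  \<comment> \<open>Differentiability makes \<open>u1\<close> continuous, and \<open>u\<close> is
    recovered as \<open>u1 (t1 x) * det (A1 x)\<close>; this yields measurability of the
    density.\<close>
  have um: "set_borel_measurable borel Omega u"
  proof -
    have "continuous_on (t1 ` Omega) u1"
      using u1_diff transport_map_onto[OF 1(4)] by (simp add: u1_def differentiable_imp_continuous_on)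
    from continuous_on_compose2[OF this ct1[of Omega]]
    have "continuous_on Omega (\<lambda>x. u1 (t1 x) * det (A1 x))"
      using T1 by (intro continuous_intros) (auto intro: continuous_on_subset)
    moreover have "u1 (t1 x) * det (A1 x) = u x" if "x \<in> Omega" for x
    proof -
      obtain c where "c > 0" "\<forall>x\<in>Omega. c \<le> det (A1 x)" using T1 by blast
      then have "det (A1 x) \<noteq> 0" using that by force
      then show ?thesis using u1[OF that] by simp
    qed
    ultimately have "continuous_on Omega u" by (simp cong: continuous_on_cong_simp)
    then show ?thesis unfolding set_borel_measurable_def
      by (rule borel_measurable_continuous_on_indicator[OF Om])
  qed
  then have ui: "set_integrable lborel Omega u"
    unfolding u_def by (rule push_forward_integrable[OF T ubar_int])
  obtain W where W: "continuous_on UNIV W" "\<And>x. x \<in> Omega \<Longrightarrow> (V has_derivative (\<lambda>v. W x \<bullet> v)) (at x)"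
      "\<And>x. x \<in> Omega \<Longrightarrow> (W has_derivative (*v) (hessian V x)) (at x)"
    using smooth_symmetric_periodic_gradient[OF V_smooth] by blast
  have P_diff: "P differentiable (at r)" if "r > 0" for r using P_smooth[OF that, of 0] by simp
  have h2: "deriv h differentiable (at r)" if "r > 0" for r using h_diff[OF that] by simp
  have L2: "v1 \<in> L2_fields u" "v2 \<in> L2_fields u"
    using v1_L2 v2_L2 by (simp_all add: v1_def v2_def u_def)
  define F1 where "F1 = (\<lambda>x. ((v1 x + W (t1 x)) \<bullet> (t1 x - t2 x)) * u x
      + (P (u x / det (A1 x)) - P 0) * det_deriv (A1 x) (A2 x - A1 x))"
  define F2 where "F2 = (\<lambda>x. ((v2 x + W (t2 x)) \<bullet> (t2 x - t1 x)) * u x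
      + (P (u x / det (A2 x)) - P 0) * det_deriv (A2 x) (A1 x - A2 x))"
  have v1: "v1 = velocity h V u1 \<circ> t1" by (simp only: v1_def velocity_at_def u1_def)
  note fv1 = first_variation[OF 1(4) 2(4) P_diff h2 h_eq W(1,2) ui u_pos u1_diff[folded u1_def] u1 v1 L2(1)]
  have F1: "set_integrable lborel Omega F1" "(LINT x:Omega|lborel. F1 x) = 0"
    unfolding F1_def
    by (rule fv1; assumption)+
  have v2: "v2 = velocity h V u2 \<circ> t2" by (simp only: v2_def velocity_at_def u2_def)
  note fv2 = first_variation[OF 2(4) 1(4) P_diff h2 h_eq W(1,2) ui u_pos u2_diff[folded u2_def] u2 v2 L2(2)]
  have F2: "set_integrable lborel Omega F2" "(LINT x:Omega|lborel. F2 x) = 0"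
    unfolding F2_def
    by (rule fv2; assumption)+
  define f1 where "f1 = (\<lambda>x. (((1 / \<tau>) *\<^sub>R (t1 x - x) - v1 x) \<bullet> w x) * u x)"
  define f2 where "f2 = (\<lambda>x. (((1 / \<tau>) *\<^sub>R (t2 x - x) - v2 x) \<bullet> w x) * u x)"
  define g where "g = (\<lambda>x. (w x \<bullet> w x) * u x)"
  have cw: "continuous_on X w" for X unfolding w_def by (intro continuous_intros ct1 ct2)
  obtain B where B: "B \<ge> 0" "\<And>x. x \<in> Omega \<Longrightarrow> norm (w x) \<le> B"
    using continuous_bounded_Omega[OF cw] by blast
  \<comment> \<open>Integrability of both residual pairings is what allows them to be combined under
    one integral. Since \<open>w\<close> is bounded, the L2 property of \<open>v\<close>
    suffices.\<close>
  have residual_integrable: "set_integrable lborel Omega (\<lambda>x. (((1 / \<tau>) *\<^sub>R (t x - x) - v x) \<bullet> w x) * u x)"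
    if ct: "\<And>X. continuous_on X t" and v: "v \<in> L2_fields u" for t v :: "real^'n \<Rightarrow> real^'n"
  proof -
    have [measurable]: "(\<lambda>x. indicator Omega x *\<^sub>R v x) \<in> borel_measurable borel"
      using v by (simp add: L2_fields_def set_borel_measurable_def)
    have cr: "continuous_on X (\<lambda>x. (1 / \<tau>) *\<^sub>R (t x - x))" for X by (intro continuous_intros ct)
    have [measurable]: "(\<lambda>x. (1 / \<tau>) *\<^sub>R (t x - x)) \<in> borel_measurable borel" "w \<in> borel_measurable borel"
      by (rule borel_measurable_continuous_onI[OF cr] borel_measurable_continuous_onI[OF cw])+
    obtain R where R: "R \<ge> 0" "\<And>x. x \<in> Omega \<Longrightarrow> norm ((1 / \<tau>) *\<^sub>R (t x - x)) \<le> R"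
      using continuous_bounded_Omega[OF cr] by blast
    show ?thesis
    proof (rule L2_fields_weighted_integrable[OF ui u_pos v, where b = "\<lambda>_. B * R" and C = "max B (B * R)"])
      have "(\<lambda>x. (indicator Omega x *\<^sub>R ((1 / \<tau>) *\<^sub>R (t x - x)) - indicator Omega x *\<^sub>R v x) \<bullet> w x) \<in> borel_measurable borel"
        by measurable
      moreover have "(\<lambda>x. (indicator Omega x *\<^sub>R ((1 / \<tau>) *\<^sub>R (t x - x)) - indicator Omega x *\<^sub>R v x) \<bullet> w x)
          = (\<lambda>x. indicator Omega x *\<^sub>R (((1 / \<tau>) *\<^sub>R (t x - x) - v x) \<bullet> w x))"
        by (auto simp: indicator_def)
      ultimately show "set_borel_measurable borel Omega (\<lambda>x. ((1 / \<tau>) *\<^sub>R (t x - x) - v x) \<bullet> w x)"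
        by (simp add: set_borel_measurable_def)
      fix x :: "real^'n" assume x: "x \<in> Omega"
      have "\<bar>((1 / \<tau>) *\<^sub>R (t x - x) - v x) \<bullet> w x\<bar> \<le> norm ((1 / \<tau>) *\<^sub>R (t x - x) - v x) * norm (w x)"
        by (rule Cauchy_Schwarz_ineq2)
      also have "\<dots> \<le> (R + norm (v x)) * B"
        using norm_triangle_ineq4[of "(1 / \<tau>) *\<^sub>R (t x - x)" "v x"] R B x
        by (intro mult_mono) (auto intro: order_trans)
      also have "\<dots> \<le> max B (B * R) * norm (v x) + B * R"
        using mult_right_mono[of B "max B (B * R)" "norm (v x)"] by (simp add: algebra_simps)
      finally show "\<bar>((1 / \<tau>) *\<^sub>R (t x - x) - v x) \<bullet> w x\<bar> \<le> max B (B * R) * norm (v x) + B * R" .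
    qed (use B R in \<open>auto simp: set_borel_measurable_def\<close>)
  qed
  have f1: "set_integrable lborel Omega f1" unfolding f1_def by (rule residual_integrable[OF ct1 L2(1)])
  have f2: "set_integrable lborel Omega f2" unfolding f2_def by (rule residual_integrable[OF ct2 L2(2)])
  have g: "set_integrable lborel Omega g"
    unfolding g_def
  proof (rule L2_fields_weighted_integrable[OF ui u_pos L2(1), where b = "\<lambda>x. B * B" and C = "B * B"])
    show "set_borel_measurable borel Omega (\<lambda>x. w x \<bullet> w x)" unfolding set_borel_measurable_def
      by (intro borel_measurable_continuous_on_indicator Om continuous_intros cw)
    fix x :: "real^'n" assume x: "x \<in> Omega"
    have "\<bar>w x \<bullet> w x\<bar> \<le> norm (w x) * norm (w x)" by (rule Cauchy_Schwarz_ineq2)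
    also have "\<dots> \<le> B * B" using B(2)[OF x] B(1) by (intro mult_mono) auto
    also have "\<dots> \<le> B * B * norm (v1 x) + B * B" by simp
    finally show "\<bar>w x \<bullet> w x\<bar> \<le> B * B * norm (v1 x) + B * B" .
  qed (auto simp: set_borel_measurable_def)
  \<comment> \<open>\<open>F1\<close> and \<open>F2\<close> have integral zero, so adding them is
    free. In the sum the velocities cancel, the potential terms form
    \<open>(W (t1 x) - W (t2 x)) \<bullet> w x\<close>, and the determinant terms are the
    nonnegative expression of \<open>mccann_pointwise\<close>.\<close>
  have point: "(1 / \<tau> + lam) * g x \<le> f1 x - f2 x + (F1 x + F2 x)" if x: "x \<in> Omega" for x
  proof -
    have pair: "spd_pair (A1 x) (A2 x)" using T1 T2 x by unfold_locales auto
    have internal: "(P (u x / det (A1 x)) - P 0) * det_deriv (A1 x) (A2 x - A1 x)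
        + (P (u x / det (A2 x)) - P 0) * det_deriv (A2 x) (A1 x - A2 x) \<ge> 0"
      using P_mccann unfolding mccann_condition_def
      by (rule mccann_pointwise[OF pair u_pos[OF x] _ P_strict_mono])
    have "t1 x \<in> Omega" "t2 x \<in> Omega" using T1 T2 x by auto
    from derivative_mean_value_inner[OF convex_Omega W(3) this(2,1)]
    obtain z where "z \<in> Omega" "(W (t1 x) - W (t2 x)) \<bullet> w x = w x \<bullet> (hessian V z *v w x)"
      unfolding w_def by blast
    then have "(W (t1 x) - W (t2 x)) \<bullet> w x \<ge> lam * (w x \<bullet> w x)" using V_convex by simp
    then have V_mono: "((W (t1 x) - W (t2 x)) \<bullet> w x) * u x \<ge> lam * (w x \<bullet> w x) * u x"
      using u_pos[OF x] by (intro mult_right_mono) auto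
    have "f1 x - f2 x + (((v1 x + W (t1 x)) \<bullet> (t1 x - t2 x)) * u x + ((v2 x + W (t2 x)) \<bullet> (t2 x - t1 x)) * u x)
        = (1 / \<tau>) * g x + ((W (t1 x) - W (t2 x)) \<bullet> w x) * u x"
    proof -
      have w12: "t1 x - t2 x = w x" "t2 x - t1 x = - w x" by (simp_all add: w_def)
      have "(1 / \<tau>) *\<^sub>R (t1 x - x) - v1 x - ((1 / \<tau>) *\<^sub>R (t2 x - x) - v2 x) + (v1 x + W (t1 x)) - (v2 x + W (t2 x))
          = (1 / \<tau>) *\<^sub>R w x + (W (t1 x) - W (t2 x))" by (simp add: w_def algebra_simps)
      then have "((1 / \<tau>) *\<^sub>R (t1 x - x) - v1 x - ((1 / \<tau>) *\<^sub>R (t2 x - x) - v2 x) + (v1 x + W (t1 x)) - (v2 x + W (t2 x))) \<bullet> w x * u x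
          = ((1 / \<tau>) *\<^sub>R w x + (W (t1 x) - W (t2 x))) \<bullet> w x * u x" by (rule arg_cong)
      then show ?thesis unfolding f1_def f2_def g_def w12
        by (simp only: inner_add_left inner_diff_left inner_minus_right inner_scaleR_left) (simp add: algebra_simps)
    qed
    then show ?thesis using internal V_mono
      by (simp add: F1_def F2_def g_def algebra_simps)
  qed
  have "(1 / \<tau> + lam) * (LINT x:Omega|lborel. g x) = (LINT x:Omega|lborel. (1 / \<tau> + lam) * g x)" by simp
  also have "\<dots> \<le> (LINT x:Omega|lborel. f1 x - f2 x + (F1 x + F2 x))"
    using g f1 f2 F1(1) F2(1) point by (intro set_integral_mono set_integral_add set_integral_diff) auto
  also have "\<dots> = (LINT x:Omega|lborel. f1 x) - (LINT x:Omega|lborel. f2 x)"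
    using f1 f2 F1 F2 by (simp add: set_integral_add set_integral_diff)
  \<comment> \<open>The estimate for \<open>t1\<close> bounds its integral from above, the one for
    \<open>t2\<close> bounds the subtracted integral from below.\<close>
  also have "\<dots> \<le> \<rho>1 * L2_norm u w + \<rho>2 * L2_norm u w"
    using est1[OF \<psi>] est2[OF \<psi>]
    unfolding grad_\<psi> u_def[symmetric] v1_def[symmetric] v2_def[symmetric] L2_inner_def f1_def f2_def by linarith
  finally have main: "(1 / \<tau> + lam) * (LINT x:Omega|lborel. g x) \<le> (\<rho>1 + \<rho>2) * L2_norm u w"
    by (simp add: algebra_simps)
  define N where "N = L2_norm u w"
  have "(LINT x:Omega|lborel. g x) \<ge> 0"
    by (rule set_integral_nonneg) (simp add: g_def less_imp_le[OF u_pos])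
  then have N: "N \<ge> 0" "(LINT x:Omega|lborel. g x) = N * N"
    by (simp_all add: N_def L2_norm_def L2_inner_def g_def)
  have pos: "(1 + \<tau> * lam) / \<tau> > 0" using \<tau> by simp
  have "((1 + \<tau> * lam) / \<tau> * N) * N \<le> (\<rho>1 + \<rho>2) * N"
    using main \<tau> unfolding N(2) N_def[symmetric] by (simp add: field_simps)
  \<comment> \<open>The integral of \<open>g\<close> is \<open>N * N\<close>, so one factor
    \<open>N\<close> can be cancelled; for \<open>N = 0\<close> the claim is the nonnegativity of
    \<open>\<rho>1 + \<rho>2\<close>.\<close>
  have "(1 + \<tau> * lam) / \<tau> * N \<le> \<rho>1 + \<rho>2"
  proof (cases "N = 0")
    case True
    then show ?thesis using \<rho> by simp
  next
    case False
    then have "N > 0" using N(1) by simp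
    then show ?thesis using \<open>((1 + \<tau> * lam) / \<tau> * N) * N \<le> (\<rho>1 + \<rho>2) * N\<close>
      by (rule mult_right_le_imp_le[rotated])
  qed
  then have "N \<le> \<tau> / (1 + \<tau> * lam) * (\<rho>1 + \<rho>2)" using \<tau> pos by (simp add: field_simps)
  then show ?thesis by (simp add: N_def u_def w_def)
qed

end
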